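(* Suppose $X$ satisfies condition (A) on $T$ (see context) and $d<Q:=\sum_{j=1}^N(1/H_j)$. Let $L^*(B)=\sup_{x\in\mathbb{R}^d}L(x,B)$. Then there exist finite constants $C$ and $C'$ such that for any $t\in T$, \[ \limsup_{r\to0}\frac{L^*(B_\rho(t,r))}{\varphi(r)}\le C\quad\text{a.s.,}\qquad\text{where }\varphi(r)=r^{Q-d}(\log\log(1/r))^{d/Q}, \] and \[ \limsup_{r\to0}\ \sup_{t\in T}\frac{L^*(B_\rho(t,r))}{\Phi(r)}\le C'\quad\text{a.s.,}\qquad\text{where }\Phi(r)=r^{Q-d}(\log(1/r))^{d/Q}. \]
   Context: **Field.** $N,d\ge1$ are integers, $\lambda_N$ is Lebesgue measure on $\mathbb{R}^N$. $X=\{X(t),t\in\mathbb{R}^N\}$, $X(t)=(X_1(t),\dots,X_d(t))$, is a mean zero continuous Gaussian random field with values in $\mathbb{R}^d$, where $X_1,\dots,X_d$ are i.i.d. copies of a real-valued Gaussian field $Y=\{Y(t),t\in\mathbb{R}^N\}$. $T$ is a closed (or open) bounded interval in $\mathbb{R}^N$ (interval means rectangle, i.e. product of one-dimensional intervals), with lower corner $(\tau_1,\dots,\tau_N)$ and side lengths $h_j>0$. **Condition (A) on $T$.** There is a constant vector $H=(H_1,\dots,H_N)\in(0,1)^N$ such that, with $\rho(t,s)=\sum_{j=1}^N|t_j-s_j|^{H_j}$: (A1) there are constants $0<C_1\le C_2<\infty$ with $C_1\rho^2(t,s)\le\mathbb{E}[(Y(t)-Y(s))^2]\le C_2\rho^2(t,s)$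 for all $t,s\in T$; (A2) there is a constant $C_3>0$ such that for all integers $n\ge1$ and all $t,t^1,\dots,t^n\in T$, $\mathrm{Var}(Y(t)\,|\,Y(t^1),\dots,Y(t^n))\ge C_3\min_{0\le k\le n}\rho^2(t,t^k)$, where $t^0=0$. $B_\rho(a,r)=\{t\in\mathbb{R}^N:\rho(t,a)\le r\}$. **Local time.** $X$ has a local time on a Borel set $S$ if the occupation measure $\mu_S(B)=\lambda_N\{t\in S:X(t)\in B\}$, $B\in\mathscr{B}(\mathbb{R}^d)$, is absolutely continuous with respect to $\lambda_d$; then $L(x,S)=\frac{d\mu_S}{d\lambda_d}(x)$. It is jointly continuous on $T$ if there is a version such that a.s. $(x,s)\mapsto L(x,T\cap\prod_{j=1}^N[\tau_j,\tau_j+s_j])$ is continuous on $\mathbb{R}^d\times\prod_{j=1}^N[0,h_j]$; such a version extends uniquely to a kernel, each $L(x,\cdot)$ being a finite Borel measure on $T$. It is known that under condition (A) on $T$ and $d<Q$, $X$ has a jointly continuous local time on $T$; $L$ always denotes this version. For a Borel set $B\subset\mathbb{R}^N$ not contained in $T$, $L(x,B)$ means $L(x,B\cap T)$. *)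

theory Defs
  imports "HOL-Probability.Probability"
begin

subsection \<open>Gaussian random fields\<close>

text \<open>The degenerate law, i.e. the point mass at 0, counts as Gaussian; it has no density
  and therefore needs its own disjunct.\<close>

definition centered_gaussian :: "'w measure \<Rightarrow> ('w \<Rightarrow> real) \<Rightarrow> bool" where
  "centered_gaussian M Z \<longleftrightarrow> Z \<in> borel_measurable M \<and>
     ((\<exists>\<sigma>>0. distributed M lborel Z (normal_density 0 \<sigma>)) \<or> (AE w in M. Z w = 0))"

definition centered_gaussian_field ::
  "'w measure \<Rightarrow> ('t \<Rightarrow> 'w \<Rightarrow> 'b::euclidean_space) \<Rightarrow> bool" where
  "centered_gaussian_field M X \<longleftrightarrow> prob_space M \<and> (\<forall>t. X t \<in> borel_measurable M) \<and>
     (\<forall>F a. finite F \<longrightarrow> centered_gaussian M (\<lambda>w. \<Sum>t\<in>F. a t \<bullet> X t w))"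

text \<open>The components of \<open>X\<close> are independent, and each of them has the law of the field \<open>Y\<close>.
  Laws of fields live on the product sigma-algebra, hence are determined by the
  finite-dimensional distributions; \<open>Y\<close> may live on another probability space.\<close>

definition iid_copies ::
  "'w measure \<Rightarrow> ('t \<Rightarrow> 'w \<Rightarrow> real ^ 'd) \<Rightarrow> 'v measure \<Rightarrow> ('t \<Rightarrow> 'v \<Rightarrow> real) \<Rightarrow> bool" where
  "iid_copies M X M' Y \<longleftrightarrow>
     prob_space.indep_vars M (\<lambda>_. Pi\<^sub>M UNIV (\<lambda>_. borel)) (\<lambda>i w t. X t w $ i) UNIV \<and>
     (\<forall>i. distr M (Pi\<^sub>M UNIV (\<lambda>_. borel)) (\<lambda>w t. X t w $ i) =
          distr M' (Pi\<^sub>M UNIV (\<lambda>_. borel)) (\<lambda>w t. Y t w))"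

subsection \<open>Condition (A)\<close>

definition rho :: "real ^ 'n \<Rightarrow> real ^ 'n \<Rightarrow> real ^ 'n \<Rightarrow> real" where
  "rho H t s = (\<Sum>j\<in>UNIV. \<bar>t $ j - s $ j\<bar> powr (H $ j))"

definition rho_ball :: "real ^ 'n \<Rightarrow> real ^ 'n \<Rightarrow> real \<Rightarrow> (real ^ 'n) set" where
  "rho_ball H a r = {t. rho H t a \<le> r}"

definition generated_algebra ::
  "'v measure \<Rightarrow> nat set \<Rightarrow> (nat \<Rightarrow> 'v \<Rightarrow> real) \<Rightarrow> 'v measure" where
  "generated_algebra M K Z =
     vimage_algebra (space M) (\<lambda>w. \<lambda>k\<in>K. Z k w) (Pi\<^sub>M K (\<lambda>_. borel))"

definition cond_variance :: "'v measure \<Rightarrow> 'v measure \<Rightarrow> ('v \<Rightarrow> real) \<Rightarrow> 'v \<Rightarrow> real" where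
  "cond_variance M F Z =
     real_cond_exp M F (\<lambda>w. (Z w - real_cond_exp M F Z w)\<^sup>2)"

text \<open>Conditional expectations are only defined up to null sets, hence the \<open>AE\<close> in the second
  part. The point \<open>u 0 = 0\<close> is the origin, which need not belong to \<open>T\<close>.\<close>

definition condition_A ::
  "'v measure \<Rightarrow> (real ^ 'n \<Rightarrow> 'v \<Rightarrow> real) \<Rightarrow> (real ^ 'n) set \<Rightarrow> real ^ 'n \<Rightarrow> bool" where
  "condition_A M Y T H \<longleftrightarrow>
     (\<forall>j. 0 < H $ j \<and> H $ j < 1) \<and>
     (\<exists>C1 C2. 0 < C1 \<and> C1 \<le> C2 \<and>
        (\<forall>t\<in>T. \<forall>s\<in>T.
           C1 * (rho H t s)\<^sup>2 \<le> (LINT w|M. (Y t w - Y s w)\<^sup>2) \<and>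
           (LINT w|M. (Y t w - Y s w)\<^sup>2) \<le> C2 * (rho H t s)\<^sup>2)) \<and>
     (\<exists>C3>0. \<forall>n\<ge>1. \<forall>t\<in>T. \<forall>u :: nat \<Rightarrow> real ^ 'n.
        u 0 = 0 \<longrightarrow> (\<forall>k\<in>{1..n}. u k \<in> T) \<longrightarrow>
        (AE w in M. cond_variance M (generated_algebra M {1..n} (\<lambda>k. Y (u k))) (Y t) w
                      \<ge> C3 * (MIN k\<in>{0..n}. (rho H t (u k))\<^sup>2)))"

subsection \<open>Local times\<close>

definition occupation_measure ::
  "(real ^ 'n \<Rightarrow> real ^ 'd) \<Rightarrow> (real ^ 'n) set \<Rightarrow> (real ^ 'd) measure" where
  "occupation_measure f S = distr (restrict_space lborel S) borel f"

definition is_local_time ::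
  "(real ^ 'n \<Rightarrow> real ^ 'd) \<Rightarrow> (real ^ 'n) set \<Rightarrow> (real ^ 'd \<Rightarrow> ennreal) \<Rightarrow> bool" where
  "is_local_time f S l \<longleftrightarrow>
     absolutely_continuous lborel (occupation_measure f S) \<and>
     (AE x in lborel. l x = RN_deriv lborel (occupation_measure f S) x)"

text \<open>Pathwise notion: \<open>f\<close> is a sample path, \<open>T\<close> the open or closed interval with lower corner
  \<open>\<tau>\<close> and side lengths \<open>h\<close>, and \<open>l x\<close> is the measure \<open>L(x, \<cdot>)\<close> on the Borel subsets of \<open>T\<close>.\<close>

definition jointly_continuous_local_time ::
  "(real ^ 'n \<Rightarrow> real ^ 'd) \<Rightarrow> (real ^ 'n) set \<Rightarrow> real ^ 'n \<Rightarrow> real ^ 'n \<Rightarrow>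
   (real ^ 'd \<Rightarrow> (real ^ 'n) measure) \<Rightarrow> bool" where
  "jointly_continuous_local_time f T \<tau> h l \<longleftrightarrow>
     (\<forall>x. finite_measure (l x) \<and> sets (l x) = sets (restrict_space borel T)) \<and>
     (\<forall>S\<in>sets borel. S \<subseteq> T \<longrightarrow> is_local_time f S (\<lambda>x. emeasure (l x) S)) \<and>
     continuous_on (UNIV \<times> cbox 0 h) (\<lambda>(x, s). measure (l x) (T \<inter> cbox \<tau> (\<tau> + s)))"

definition max_local_time ::
  "(real ^ 'd \<Rightarrow> (real ^ 'n) measure) \<Rightarrow> (real ^ 'n) set \<Rightarrow> (real ^ 'n) set \<Rightarrow> ennreal" where
  "max_local_time l T B = (SUP x. emeasure (l x) (B \<inter> T))"

definition Q_dim :: "real ^ 'n \<Rightarrow> real" where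
  "Q_dim H = (\<Sum>j\<in>UNIV. 1 / H $ j)"

definition phi_gauge :: "real \<Rightarrow> real \<Rightarrow> real \<Rightarrow> real" where
  "phi_gauge Q d r = r powr (Q - d) * ln (ln (1 / r)) powr (d / Q)"

definition Phi_gauge :: "real \<Rightarrow> real \<Rightarrow> real \<Rightarrow> real" where
  "Phi_gauge Q d r = r powr (Q - d) * ln (1 / r) powr (d / Q)"

end

theory Submission
  imports Defs
begin

text \<open>By condition (A2) and the independence of the components, the joint density of
  \<open>X(t\<^sub>1), \<dots>, X(t\<^sub>n)\<close> is at most \<open>C\<^sup>n\<close> times the product over \<open>k\<close> of the \<open>(-d)\<close>-th power of the
  \<open>\<rho>\<close>-distance of \<open>t\<^sub>k\<close> to the preceding points. Integrated over a \<open>\<rho>\<close>-ball of radius \<open>r\<close>, this bounds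
  the \<open>n\<close>-th moment of the local time at a point by the \<open>n\<close>-th power of \<open>C n\<close>\<open>\<^bsup>d/Q\<^esup> r\<^bsup>Q-d\<^esup>\<close>, hence
  controls it, outside an event of probability of order \<open>exp(-c n)\<close>, on a grid of at most \<open>exp(C n)\<close>
  points. A fixed high even moment of the difference of the local times at two points carries a
  Hoelder factor with the right power of \<open>r\<close>; it comes from the Fourier representation of Gaussian
  densities, after the time points are ordered greedily, each followed by its nearest successor.
  Chaining then passes from the grid to the supremum, and a second chaining bounds the range of \<open>X\<close> on
  the ball. Borel-Cantelli along the radii \<open>1/2\<^sup>k\<close>, with \<open>n\<close> of order \<open>log k\<close> for a fixed centre and
  of order \<open>k\<close> for a grid of centres, gives the two laws.

  All this is done for the local time mollified by a Gaussian kernel, uniformly in the width of the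
  kernel. The given local time enters only at the end, through its continuity in the space
  variable, so no measurability in the sample point is needed.\<close>

subsection \<open>Chaining\<close>

text \<open>The time points are integrated one after the other, so a moment bound asks only for the
  density of each new value given its predecessors. A difference in space brings in the g-th power
  of every Fourier variable at once, and absorbing these takes the variance of each value given all
  the others. The greedy order reduces this to separations from predecessors, at the price of the
  number of orderings and of a factor n per point. Such bounds are useless for growing n; hence the
  moment order for differences stays fixed, and smallness comes from the mesh r exp(-n) alone, whose
  Hoelder gain is made to beat the number of cells. Locations are measured from X(a), a the centre
  of the ball, because a deterministic grid can cover only the increments from a; this is why a
  joins the points on which one conditions. The exponent d/Q arises from cutting the singularities
  of n centres at radius r n^(-1/Q). Exceptional events depend on the width of the mollifier and are
  not united over the widths: by continuity in space, a bound for infinitely many widths is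
  enough.\<close>

definition dyadic_point :: "nat \<Rightarrow> ('m \<Rightarrow> nat) \<Rightarrow> real ^ 'm" where
  "dyadic_point k z = (\<chi> j. real (z j) / 2 ^ k)"

text \<open>The failure bound of level k is the number of lattice edges, at most m 2^m 2^(k m),
  times 2^(-k \<theta>), divided by the p-th power of the share of u given to that level. The shares
  decay at a rate that spends half of the surplus \<theta> - m, so the levels form a geometric
  series of ratio 2^(-(\<theta> - m)/2). The middle factor normalises the shares.\<close>

definition chain_const :: "nat \<Rightarrow> nat \<Rightarrow> real \<Rightarrow> real" where
  "chain_const m p \<theta> = real m * 2 ^ m * (real m / (1 - 2 powr (- ((\<theta> - m) / (2 * real p))))) ^ p
     / (1 - 2 powr (- ((\<theta> - m) / 2)))"

lemma chain_const_nonneg: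
  assumes "real m < \<theta>" "0 < p"
  shows "0 \<le> chain_const m p \<theta>"
proof -
  have "2 powr (- ((\<theta> - m) / (2 * real p))) < 2 powr 0" "2 powr (- ((\<theta> - m) / 2)) < 2 powr 0"
    using assms by (intro powr_less_mono; simp)+
  then show ?thesis unfolding chain_const_def
    by (intro divide_nonneg_nonneg mult_nonneg_nonneg zero_le_power) auto
qed

lemma finite_grid: "finite {z :: 'm::finite \<Rightarrow> nat. \<forall>i. z i \<le> N}"
  and card_grid: "card {z :: 'm::finite \<Rightarrow> nat. \<forall>i. z i \<le> N} = (N + 1) ^ CARD('m)"
proof -
  have *: "{z :: 'm \<Rightarrow> nat. \<forall>i. z i \<le> N} = (\<Pi>\<^sub>E i\<in>UNIV. {..N})"
    by (auto simp: PiE_def)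
  show "finite {z :: 'm \<Rightarrow> nat. \<forall>i. z i \<le> N}" unfolding * by (intro finite_PiE) auto
  show "card {z :: 'm \<Rightarrow> nat. \<forall>i. z i \<le> N} = (N + 1) ^ CARD('m)"
    unfolding * by (subst card_PiE) auto
qed

lemma emeasure_gt_le_of_moment:
  fixes f :: "'w \<Rightarrow> real"
  assumes [measurable]: "f \<in> borel_measurable M" and u: "0 < u"
    and le: "(\<integral>\<^sup>+w. ennreal (f w ^ n) \<partial>M) \<le> ennreal B"
  shows "emeasure M {w \<in> space M. u < f w} \<le> ennreal (B / u ^ n)"
proof -
  have "emeasure M {w \<in> space M. u < f w} \<le> emeasure M {w \<in> space M. 1 \<le> ennreal (1 / u ^ n) * ennreal (f w ^ n)}"
  proof (intro emeasure_mono subsetI)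
    fix w assume w: "w \<in> {w \<in> space M. u < f w}"
    then have "u ^ n \<le> f w ^ n" using u by (intro power_mono) auto
    then have "1 \<le> 1 / u ^ n * f w ^ n" using u by (simp add: field_simps)
    then have "ennreal 1 \<le> ennreal (1 / u ^ n * f w ^ n)" by (rule ennreal_leI)
    then show "w \<in> {w \<in> space M. 1 \<le> ennreal (1 / u ^ n) * ennreal (f w ^ n)}"
      using w u by (simp add: ennreal_mult'[symmetric])
  qed measurable
  also have "\<dots> \<le> ennreal (1 / u ^ n) * (\<integral>\<^sup>+w. ennreal (f w ^ n) * indicator (space M) w \<partial>M)"
    using nn_integral_Markov_inequality[of "\<lambda>w. ennreal (f w ^ n)" "space M" M "ennreal (1 / u ^ n)"] by simp
  also have "(\<integral>\<^sup>+w. ennreal (f w ^ n) * indicator (space M) w \<partial>M) = (\<integral>\<^sup>+w. ennreal (f w ^ n) \<partial>M)"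
    by (intro nn_integral_cong) simp
  also have "ennreal (1 / u ^ n) * \<dots> \<le> ennreal (1 / u ^ n) * ennreal B"
    by (intro mult_left_mono le) simp
  also have "\<dots> = ennreal (B / u ^ n)" using u by (simp add: ennreal_mult'[symmetric])
  finally show ?thesis .
qed

lemma tendsto_dyadic_floor: "(\<lambda>k. of_int \<lfloor>2 ^ k * x\<rfloor> / 2 ^ k) \<longlonglongrightarrow> (x :: real)"
proof -
  have lim: "(\<lambda>k. (1/2::real) ^ k) \<longlonglongrightarrow> 0" by (rule LIMSEQ_realpow_zero) auto
  have "\<bar>of_int \<lfloor>2 ^ k * x\<rfloor> / 2 ^ k - x\<bar> \<le> (1/2) ^ k" for k
  proof -
    have "of_int \<lfloor>2 ^ k * x\<rfloor> / 2 ^ k - x = (of_int \<lfloor>2 ^ k * x\<rfloor> - 2 ^ k * x) / 2 ^ k"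
      by (simp add: diff_divide_distrib)
    then have "\<bar>of_int \<lfloor>2 ^ k * x\<rfloor> / 2 ^ k - x\<bar> = \<bar>of_int \<lfloor>2 ^ k * x\<rfloor> - 2 ^ k * x\<bar> / 2 ^ k"
      by (simp only: abs_divide) simp
    also have "\<dots> \<le> 1 / 2 ^ k" by (rule divide_right_mono) (linarith, simp)
    finally show ?thesis by (simp add: power_one_over)
  qed
  then have "\<forall>\<^sub>F k in sequentially. norm (of_int \<lfloor>2 ^ k * x\<rfloor> / 2 ^ k - x) \<le> (1/2) ^ k"
    by (intro always_eventually allI) (simp only: real_norm_def)
  from Lim_null_comparison[OF this lim] show ?thesis by (rule LIM_zero_cancel)
qed

text \<open>Neighbouring points of a dyadic lattice differ in one coordinate, so axis-parallel
  increments suffice; this is the form in which differences of the local time in space can be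
  estimated. The outcome is an exceptional event and not the tail of a supremum, so that such events
  can be united later without treating suprema as random variables.\<close>

lemma chaining:
  fixes Z :: "real ^ 'm::finite \<Rightarrow> 'w \<Rightarrow> real"
  assumes Zm [measurable]: "\<And>s. Z s \<in> borel_measurable M"
    and cont: "\<And>w. w \<in> space M \<Longrightarrow> continuous_on (cbox 0 1) (\<lambda>s. Z s w)"
    and p: "0 < p" and th: "real CARD('m) < \<theta>" and K: "0 \<le> K" and u: "0 < u"
    and incr: "\<And>s t j. s \<in> cbox 0 1 \<Longrightarrow> t \<in> cbox 0 1 \<Longrightarrow> (\<And>i. i \<noteq> j \<Longrightarrow> s $ i = t $ i) \<Longrightarrow>
      (\<integral>\<^sup>+w. ennreal (\<bar>Z s w - Z t w\<bar> ^ p) \<partial>M) \<le> ennreal (K * \<bar>s $ j - t $ j\<bar> powr \<theta>)"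
  obtains E where "E \<in> sets M" "emeasure M E \<le> ennreal (chain_const CARD('m) p \<theta> * K / u ^ p)"
    "\<And>w s. w \<in> space M - E \<Longrightarrow> s \<in> cbox 0 1 \<Longrightarrow> \<bar>Z s w - Z 0 w\<bar> \<le> u"
proof -
  define m where "m = real CARD('m)"
  have m1: "m \<ge> 1" unfolding m_def by (simp add: Suc_leI)
  \<comment> \<open>Half of the surplus, per unit of p: the loss \<open>(q ^ k) ^ p\<close> in
    Markov's inequality leaves the other half for the summation over the levels.\<close>
  define \<beta> where "\<beta> = (\<theta> - m) / (2 * real p)"
  define q where "q = 2 powr (- \<beta>)"
  have b0: "\<beta> > 0" unfolding \<beta>_def m_def using th p by simp
  have q: "0 < q" "q < 1" unfolding q_def using powr_less_mono[of "- \<beta>" 0 2] b0 by auto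
  \<comment> \<open>Normalised so that crossing up to m edges on every level costs at most u in
    total.\<close>
  define U where "U = (\<lambda>k. u * (1 - q) * q ^ k / m)"
  have U: "U k > 0" for k unfolding U_def using u q m1 by simp
  define G where "G = (\<lambda>k. {z :: 'm \<Rightarrow> nat. \<forall>i. z i \<le> 2 ^ k})"
  have G: "finite (G k)" "card (G k) = (2 ^ k + 1) ^ CARD('m)" for k
    unfolding G_def using finite_grid card_grid by blast+
  define bad where "bad = (\<lambda>k. \<Union>(j, z)\<in>UNIV \<times> G k. if z j < 2 ^ k then
      {w \<in> space M. U k < \<bar>Z (dyadic_point k (z(j := Suc (z j)))) w - Z (dyadic_point k z) w\<bar>} else {})"
  have dp: "dyadic_point k z \<in> cbox 0 1" if "z \<in> G k" for k z
    using that unfolding dyadic_point_def G_def by (auto simp: mem_box_cart)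
  have each: "emeasure M {w \<in> space M. U k < \<bar>Z (dyadic_point k (z(j := Suc (z j)))) w - Z (dyadic_point k z) w\<bar>}
      \<le> ennreal (K * (1 / 2 ^ k) powr \<theta> / U k ^ p)" if z: "z \<in> G k" "z j < 2 ^ k" for k z j
  proof -
    have z': "z(j := Suc (z j)) \<in> G k" using z unfolding G_def by auto
    have "\<bar>dyadic_point k (z(j := Suc (z j))) $ j - dyadic_point k z $ j\<bar> = 1 / 2 ^ k"
      by (simp add: dyadic_point_def diff_divide_distrib[symmetric])
    then have "(\<integral>\<^sup>+w. ennreal (\<bar>Z (dyadic_point k (z(j := Suc (z j)))) w - Z (dyadic_point k z) w\<bar> ^ p) \<partial>M) \<le> ennreal (K * (1 / 2 ^ k) powr \<theta>)"
      using incr[OF dp[OF z'] dp[OF z(1)], of j] by (simp add: dyadic_point_def)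
    then show ?thesis by (intro emeasure_gt_le_of_moment U) measurable
  qed
  have bad_sets [measurable]: "bad k \<in> sets M" for k
  proof -
    have "(if z j < 2 ^ k then {w \<in> space M. U k < \<bar>Z (dyadic_point k (z(j := Suc (z j)))) w - Z (dyadic_point k z) w\<bar>} else {}) \<in> sets M" for j z
      by (cases "z j < 2 ^ k") simp_all
    then show ?thesis unfolding bad_def using G(1) by (intro sets.finite_UN) auto
  qed
  define \<alpha> where "\<alpha> = 2 powr (- ((\<theta> - m) / 2))"
  have al: "0 < \<alpha>" "\<alpha> < 1" unfolding \<alpha>_def m_def using powr_less_mono[of "- ((\<theta> - m) / 2)" 0 2] th by (auto simp: m_def)
  define B where "B = m * 2 ^ CARD('m) * K * (m / (1 - q)) ^ p / u ^ p"
  have B0: "0 \<le> B" unfolding B_def using m1 K q u by simp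
  have bad: "emeasure M (bad k) \<le> ennreal (B * \<alpha> ^ k)" for k
  proof -
    let ?c = "K * (1 / 2 ^ k) powr \<theta> / U k ^ p"
    have c0: "0 \<le> ?c" using K U[of k] by simp
    have "emeasure M (bad k) \<le> (\<Sum>x\<in>UNIV \<times> G k. emeasure M (case x of (j, z) \<Rightarrow> if z j < 2 ^ k then
      {w \<in> space M. U k < \<bar>Z (dyadic_point k (z(j := Suc (z j)))) w - Z (dyadic_point k z) w\<bar>} else {}))"
      unfolding bad_def using G(1) by (intro emeasure_subadditive_finite) (auto split: prod.split)
    also have "\<dots> \<le> (\<Sum>x\<in>(UNIV :: 'm set) \<times> G k. ennreal ?c)"
      using each by (intro sum_mono) (auto split: prod.split)
    also have "\<dots> = ennreal (real (CARD('m) * (2 ^ k + 1) ^ CARD('m)) * ?c)"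
    proof -
      have card: "card ((UNIV :: 'm set) \<times> G k) = CARD('m) * (2 ^ k + 1) ^ CARD('m)"
        by (simp add: card_cartesian_product G)
      show ?thesis unfolding sum_constant card ennreal_of_nat_eq_real_of_nat
        by (rule ennreal_mult''[symmetric, OF c0])
    qed
    also have "\<dots> \<le> ennreal (B * \<alpha> ^ k)"
    proof (rule ennreal_leI)
      have "real (CARD('m) * (2 ^ k + 1) ^ CARD('m)) \<le> m * (2 ^ CARD('m) * (2 ^ k) ^ CARD('m))"
      proof -
        have "(2 ^ k + 1 :: real) ^ CARD('m) \<le> (2 * 2 ^ k) ^ CARD('m)" by (intro power_mono) auto
        then show ?thesis unfolding m_def by (simp add: power_mult_distrib add.commute)
      qed
      then have "real (CARD('m) * (2 ^ k + 1) ^ CARD('m)) * ?c \<le> m * (2 ^ CARD('m) * (2 ^ k) ^ CARD('m)) * ?c"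
        using c0 by (rule mult_right_mono)
      also have "\<dots> = B * \<alpha> ^ k"
      proof -
        have "(2 ^ k) ^ CARD('m) * (1 / 2 ^ k) powr \<theta> = 2 powr (real k * (m - \<theta>))"
          unfolding m_def by (simp add: powr_divide powr_realpow[symmetric] powr_powr powr_diff power_mult[symmetric] right_diff_distrib)
        moreover have "\<alpha> ^ k = 2 powr (real k * (m - \<theta>)) / (q ^ k) ^ p"
        proof -
          have "(q ^ k) ^ p = 2 powr (- (real k * (\<theta> - m) / 2))"
            unfolding q_def \<beta>_def using p by (simp add: powr_realpow[symmetric] powr_powr mult.commute)
          moreover have "\<alpha> ^ k = 2 powr (- (real k * (\<theta> - m) / 2))"
            unfolding \<alpha>_def by (simp add: powr_realpow[symmetric] powr_powr mult.commute)
          moreover have "2 powr (real k * (m - \<theta>)) = 2 powr (- (real k * (\<theta> - m) / 2)) * 2 powr (- (real k * (\<theta> - m) / 2))"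
            unfolding powr_add[symmetric] by (simp add: algebra_simps)
          ultimately show ?thesis by simp
        qed
        moreover have "1 / U k ^ p = (m / (1 - q)) ^ p / u ^ p / (q ^ k) ^ p"
          unfolding U_def by (simp add: power_divide power_mult_distrib)
        moreover have "m * (2 ^ CARD('m) * (2 ^ k) ^ CARD('m)) * ?c = m * 2 ^ CARD('m) * K * ((2 ^ k) ^ CARD('m) * (1 / 2 ^ k) powr \<theta>) * (1 / U k ^ p)"
          by simp
        ultimately show ?thesis unfolding B_def by (simp del: times_divide_eq_right add: divide_inverse mult_ac)
      qed
      finally show "real (CARD('m) * (2 ^ k + 1) ^ CARD('m)) * ?c \<le> B * \<alpha> ^ k" .
    qed
    finally show ?thesis .
  qed
  define E where "E = (\<Union>k. bad k)"
  show ?thesis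
  proof (rule that)
    show "E \<in> sets M" unfolding E_def by measurable
    have "emeasure M E \<le> (\<Sum>k. emeasure M (bad k))"
      unfolding E_def by (intro emeasure_subadditive_countably) auto
    also have "\<dots> \<le> (\<Sum>k. ennreal (B * \<alpha> ^ k))"
      by (intro suminf_le bad) auto
    also have "\<dots> = ennreal (\<Sum>k. B * \<alpha> ^ k)"
      using al B0 by (intro suminf_ennreal2 summable_mult summable_geometric) auto
    also have "(\<Sum>k. B * \<alpha> ^ k) = B * (1 / (1 - \<alpha>))"
      using al by (subst suminf_mult) (auto simp: suminf_geometric intro!: summable_geometric)
    also have "\<dots> = chain_const CARD('m) p \<theta> * K / u ^ p"
      unfolding chain_const_def B_def \<alpha>_def q_def \<beta>_def m_def by (simp add: ac_simps)
    finally show "emeasure M E \<le> ennreal (chain_const CARD('m) p \<theta> * K / u ^ p)" .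
  next
    fix w s assume w: "w \<in> space M - E" and s: "s \<in> cbox 0 (1 :: real ^ 'm)"
    have step: "\<bar>Z (dyadic_point k (z(j := Suc (z j)))) w - Z (dyadic_point k z) w\<bar> \<le> U k"
      if "z \<in> G k" "z j < 2 ^ k" for k j z
    proof (rule ccontr)
      assume "\<not> ?thesis"
      then have "w \<in> bad k" unfolding bad_def using that w by (intro UN_I[of "(j, z)"]) auto
      then show False using w unfolding E_def by blast
    qed
    \<comment> \<open>The coordinates are raised one at a time; the induction runs over the set J of
      coordinates already treated, and each of them costs one lattice edge or none.\<close>
    have path: "\<bar>Z (dyadic_point k z') w - Z (dyadic_point k z) w\<bar> \<le> m * U k"
      if z: "z \<in> G k" "z' \<in> G k" "\<And>j. z' j = z j \<or> z' j = Suc (z j)" for k z z'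
    proof -
      have "\<bar>Z (dyadic_point k (\<lambda>j. if j \<in> J then z' j else z j)) w - Z (dyadic_point k z) w\<bar> \<le> real (card J) * U k"
        if "finite J" for J
        using that
      proof induction
        case empty then show ?case by simp
      next
        case (insert i J)
        let ?y = "\<lambda>j. if j \<in> J then z' j else z j"
        have y: "?y \<in> G k" using z(1,2) unfolding G_def by auto
        have e: "(\<lambda>j. if j \<in> insert i J then z' j else z j) = ?y(i := z' i)" by auto
        have "\<bar>Z (dyadic_point k (?y(i := z' i))) w - Z (dyadic_point k ?y) w\<bar> \<le> U k"
        proof (cases "z' i = z i")
          case True
          then have "?y(i := z' i) = ?y" using insert by auto
          then show ?thesis using U[of k] by simp
        next
          case False
          then have zi: "z' i = Suc (z i)" using z(3)[of i] by blast
          have "z' i \<le> 2 ^ k" using z(2) unfolding G_def by simp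
          then have "?y i < 2 ^ k" using insert.hyps by (simp add: zi)
          moreover have "?y(i := z' i) = ?y(i := Suc (?y i))" using insert.hyps zi by simp
          ultimately show ?thesis using step[OF y, of i] by (simp only:)
        qed
        then show ?case unfolding e using insert by (simp add: algebra_simps)
      qed
      from this[of UNIV] show ?thesis unfolding m_def by simp
    qed
    define zf where "zf = (\<lambda>k j. nat \<lfloor>2 ^ k * s $ j\<rfloor>)"
    have s01: "0 \<le> s $ j" "s $ j \<le> 1" for j using s by (auto simp: mem_box_cart)
    have zfr: "real (zf k j) = of_int \<lfloor>2 ^ k * s $ j\<rfloor>" for k j
      unfolding zf_def using s01[of j] by simp
    have zfG: "zf k \<in> G k" for k
    proof -
      have "zf k j \<le> 2 ^ k" for j
      proof -
        have "real (zf k j) \<le> 2 ^ k * s $ j" unfolding zfr by (rule of_int_floor_le)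
        also have "\<dots> \<le> 2 ^ k * 1" using s01[of j] by (intro mult_left_mono) auto
        finally have "real (zf k j) \<le> real (2 ^ k)" by simp
        then show ?thesis by (simp only: of_nat_le_iff)
      qed
      then show ?thesis unfolding G_def by simp
    qed
    \<comment> \<open>A refinement doubles the index up to an error of 0 or 1, so consecutive
      approximations of s, seen on the finer lattice, are joined by \<open>path\<close>.\<close>
    have dbl: "zf (Suc k) j = 2 * zf k j \<or> zf (Suc k) j = Suc (2 * zf k j)" for k j
    proof -
      have "real (zf (Suc k) j) < 2 * real (zf k j) + 2" "2 * real (zf k j) < real (zf (Suc k) j) + 1"
        unfolding zfr power_Suc mult.assoc by linarith+
      then show ?thesis by linarith
    qed
    have main: "\<bar>Z (dyadic_point k (zf k)) w - Z 0 w\<bar> \<le> (\<Sum>i\<le>k. m * U i)" for k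
    proof (induction k)
      \<comment> \<open>On level 0 the floor is 0 except in coordinates equal to 1: s is
        approximated by a vertex of the cube, one application of \<open>path\<close> away from the
        origin.\<close>
      case 0
      have "dyadic_point 0 (\<lambda>_. 0) = (0 :: real ^ 'm)" by (simp add: dyadic_point_def vec_eq_iff)
      moreover have "zf 0 j = 0 \<or> zf 0 j = Suc 0" for j
        using zfG[of 0] unfolding G_def by (auto simp: le_Suc_eq)
      ultimately show ?case using path[of "\<lambda>_. 0" 0 "zf 0"] zfG[of 0] by (simp add: G_def)
    next
      case (Suc k)
      have "dyadic_point (Suc k) (\<lambda>j. 2 * zf k j) = dyadic_point k (zf k)" by (simp add: dyadic_point_def vec_eq_iff)
      moreover have "(\<lambda>j. 2 * zf k j) \<in> G (Suc k)" using zfG[of k] unfolding G_def by auto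
      ultimately have "\<bar>Z (dyadic_point (Suc k) (zf (Suc k))) w - Z (dyadic_point k (zf k)) w\<bar> \<le> m * U (Suc k)"
        using path[of "\<lambda>j. 2 * zf k j" "Suc k" "zf (Suc k)"] zfG[of "Suc k"] dbl by auto
      then show ?case using Suc by simp
    qed
    have sumU: "(\<Sum>i\<le>k. m * U i) \<le> u" for k
    proof -
      have "(\<Sum>i\<le>k. m * U i) = u * ((1 - q) * (\<Sum>i\<le>k. q ^ i))"
        unfolding U_def sum_distrib_left using m1 by (intro sum.cong) auto
      also have "(1 - q) * (\<Sum>i\<le>k. q ^ i) = 1 - q ^ Suc k"
        using q by (simp add: sum_gp0)
      also have "u * (1 - q ^ Suc k) \<le> u * 1" using u q by (intro mult_left_mono) auto
      finally show ?thesis by simp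
    qed
    have lim: "(\<lambda>k. dyadic_point k (zf k)) \<longlonglongrightarrow> s"
      by (rule vec_tendstoI) (simp add: dyadic_point_def zfr tendsto_dyadic_floor)
    have "(\<lambda>k. Z (dyadic_point k (zf k)) w) \<longlonglongrightarrow> Z s w"
      using continuous_on_tendsto_compose[OF cont[of w] lim s] w dp[OF zfG] by auto
    then have "(\<lambda>k. \<bar>Z (dyadic_point k (zf k)) w - Z 0 w\<bar>) \<longlonglongrightarrow> \<bar>Z s w - Z 0 w\<bar>"
      by (intro tendsto_intros)
    then show "\<bar>Z s w - Z 0 w\<bar> \<le> u"
      by (rule LIMSEQ_le_const2) (use main sumU order_trans in blast)
  qed
qed

subsection \<open>Gaussian integrals\<close>

text \<open>Completing the square: \<open>C - B\<^sup>2 / A\<close> is the value of the quadratic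
  polynomial at its minimiser -B/A.\<close>

lemma nn_integral_gaussian_quadratic:
  fixes A B C :: real
  assumes "A > 0"
  shows "(\<integral>\<^sup>+y. ennreal (exp (- (A * y\<^sup>2 + 2 * B * y + C) / 2)) \<partial>lborel)
    = ennreal (sqrt (2 * pi / A) * exp (- (C - B\<^sup>2 / A) / 2))"
proof -
  define \<sigma> where "\<sigma> = 1 / sqrt A"
  have s: "\<sigma> > 0" "\<sigma>\<^sup>2 = 1 / A" using assms by (auto simp: \<sigma>_def power_divide)
  have eq: "exp (- (A * y\<^sup>2 + 2 * B * y + C) / 2) =
      (sqrt (2 * pi / A) * exp (- (C - B\<^sup>2 / A) / 2)) * normal_density (- B / A) \<sigma> y" for y
  proof -
    have "- (A * y\<^sup>2 + 2 * B * y + C) / 2 = - (C - B\<^sup>2 / A) / 2 + - (y - (- B / A))\<^sup>2 / (2 * \<sigma>\<^sup>2)"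
      using assms unfolding s by (simp add: field_simps power2_eq_square)
    then have "exp (- (A * y\<^sup>2 + 2 * B * y + C) / 2) =
        exp (- (C - B\<^sup>2 / A) / 2) * exp (- (y - (- B / A))\<^sup>2 / (2 * \<sigma>\<^sup>2))"
      by (simp only: exp_add)
    moreover have "sqrt (2 * pi / A) * (1 / sqrt (2 * pi * \<sigma>\<^sup>2)) = 1"
      using assms by (simp add: s)
    ultimately show ?thesis
      unfolding normal_density_def using assms s(1) by (simp add: mult.assoc mult.left_commute[of "sqrt (2 * pi / A)"])
  qed
  have "(\<integral>\<^sup>+y. ennreal (exp (- (A * y\<^sup>2 + 2 * B * y + C) / 2)) \<partial>lborel) =
     (\<integral>\<^sup>+y. ennreal (sqrt (2 * pi / A) * exp (- (C - B\<^sup>2 / A) / 2)) * ennreal (normal_density (- B / A) \<sigma> y) \<partial>lborel)"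
    by (intro nn_integral_cong) (subst eq, subst ennreal_mult', use assms in auto)
  also have "\<dots> = ennreal (sqrt (2 * pi / A) * exp (- (C - B\<^sup>2 / A) / 2)) * (\<integral>\<^sup>+y. ennreal (normal_density (- B / A) \<sigma> y) \<partial>lborel)"
    by (subst nn_integral_cmult) auto
  also have "(\<integral>\<^sup>+y. ennreal (normal_density (- B / A) \<sigma> y) \<partial>lborel) = 1"
    using s(1) by (subst nn_integral_eq_integral) auto
  finally show ?thesis by simp
qed

text \<open>Integrating out the first variable of a quadratic form replaces it by its Schur complement,
  which is the minimum of the form over that variable; the lower bounds \<open>v k\<close> are therefore
  inherited.\<close>

lemma nn_integral_exp_quadratic_form:
  fixes a :: "nat \<Rightarrow> nat \<Rightarrow> real" and v :: "nat \<Rightarrow> real"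
  assumes "m \<le> n" and sym: "\<And>i j. a i j = a j i"
    and v: "\<And>k. k \<in> {m..<n} \<Longrightarrow> 0 < v k"
    and lb: "\<And>k u. k \<in> {m..<n} \<Longrightarrow> u k = 1 \<Longrightarrow> (\<And>j. j > k \<Longrightarrow> u j = 0) \<Longrightarrow>
        v k \<le> (\<Sum>i\<in>{m..<n}. \<Sum>j\<in>{m..<n}. a i j * u i * u j)"
  shows "(\<integral>\<^sup>+u. ennreal (exp (- (\<Sum>i\<in>{m..<n}. \<Sum>j\<in>{m..<n}. a i j * u i * u j) / 2)) \<partial>(\<Pi>\<^sub>M i\<in>{m..<n}. lborel))
    \<le> ennreal (\<Prod>k\<in>{m..<n}. sqrt (2 * pi / v k))"
  using assms
proof (induction m arbitrary: a rule: inc_induct)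
  case base
  interpret product_sigma_finite "\<lambda>i::nat. lborel :: real measure" ..
  show ?case by (simp add: PiM_empty nn_integral_count_space_finite)
next
  case (step m)
  interpret product_sigma_finite "\<lambda>i::nat. lborel :: real measure" ..
  let ?I = "{Suc m..<n}"
  have I: "{m..<n} = insert m ?I" using step.hyps by auto
  define A where "A = a m m"
  define B where "B = (\<lambda>u::nat\<Rightarrow>real. \<Sum>j\<in>?I. a m j * u j)"
  define C where "C = (\<lambda>u::nat\<Rightarrow>real. \<Sum>i\<in>?I. \<Sum>j\<in>?I. a i j * u i * u j)"
  define a' where "a' = (\<lambda>i j. a i j - a m i * a m j / A)"
  have Q: "(\<Sum>i\<in>{m..<n}. \<Sum>j\<in>{m..<n}. a i j * u i * u j) = A * (u m)\<^sup>2 + 2 * B u * u m + C u" for u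
  proof -
    have "(\<Sum>i\<in>?I. a i m * u i * u m) = B u * u m"
      unfolding B_def sum_distrib_right by (intro sum.cong refl) (simp add: step.prems(1)[of _ m])
    moreover have "(\<Sum>j\<in>?I. a m j * u m * u j) = B u * u m"
      unfolding B_def sum_distrib_right by (intro sum.cong refl) simp
    ultimately show ?thesis
      unfolding I by (simp add: sum.distrib A_def C_def power2_eq_square)
  qed
  have vA: "v m \<le> A"
    using step.prems(3)[of m "\<lambda>i. if i = m then 1 else 0"] step.hyps
    unfolding Q by (simp add: B_def C_def)
  have v0: "0 < v m" using step.prems(2)[of m] step.hyps by auto
  have A0: "A > 0" using vA v0 by simp
  have Q': "(\<Sum>i\<in>?I. \<Sum>j\<in>?I. a' i j * u i * u j) = C u - (B u)\<^sup>2 / A" for u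
  proof -
    have "(B u)\<^sup>2 / A = (\<Sum>i\<in>?I. \<Sum>j\<in>?I. (a m i * a m j / A) * u i * u j)"
      unfolding B_def power2_eq_square sum_product sum_divide_distrib
      by (intro sum.cong refl) simp
    then show ?thesis
      unfolding a'_def C_def by (simp add: sum_subtractf left_diff_distrib)
  qed
  have "(\<integral>\<^sup>+u. ennreal (exp (- (\<Sum>i\<in>{m..<n}. \<Sum>j\<in>{m..<n}. a i j * u i * u j) / 2)) \<partial>(\<Pi>\<^sub>M i\<in>{m..<n}. lborel))
     = (\<integral>\<^sup>+u. (\<integral>\<^sup>+y. ennreal (exp (- (A * y\<^sup>2 + 2 * B u * y + C u) / 2)) \<partial>lborel) \<partial>(\<Pi>\<^sub>M i\<in>?I. lborel))"
    unfolding Q unfolding I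
  proof (subst product_nn_integral_insert)
    show "(\<lambda>u. ennreal (exp (- (A * (u m)\<^sup>2 + 2 * B u * u m + C u) / 2))) \<in> borel_measurable (Pi\<^sub>M (insert m ?I) (\<lambda>i. lborel))"
      unfolding B_def C_def by measurable
    have "B (u(m := y)) = B u" "C (u(m := y)) = C u" for u y
      unfolding B_def C_def by (auto intro!: sum.cong)
    then show "(\<integral>\<^sup>+ x. \<integral>\<^sup>+ y. ennreal (exp (- (A * ((x(m := y)) m)\<^sup>2 + 2 * B (x(m := y)) * (x(m := y)) m + C (x(m := y))) / 2)) \<partial>lborel \<partial>Pi\<^sub>M ?I (\<lambda>i. lborel)) =
      (\<integral>\<^sup>+ u. \<integral>\<^sup>+ y. ennreal (exp (- (A * y\<^sup>2 + 2 * B u * y + C u) / 2)) \<partial>lborel \<partial>Pi\<^sub>M ?I (\<lambda>i. lborel))"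
      by simp
  qed auto
  also have "\<dots> = (\<integral>\<^sup>+u. ennreal (sqrt (2 * pi / A)) * ennreal (exp (- (\<Sum>i\<in>?I. \<Sum>j\<in>?I. a' i j * u i * u j) / 2)) \<partial>(\<Pi>\<^sub>M i\<in>?I. lborel))"
    unfolding nn_integral_gaussian_quadratic[OF A0] Q' using A0 by (simp add: ennreal_mult)
  also have "\<dots> = ennreal (sqrt (2 * pi / A)) * (\<integral>\<^sup>+u. ennreal (exp (- (\<Sum>i\<in>?I. \<Sum>j\<in>?I. a' i j * u i * u j) / 2)) \<partial>(\<Pi>\<^sub>M i\<in>?I. lborel))"
    by (subst nn_integral_cmult) measurable
  also have "\<dots> \<le> ennreal (sqrt (2 * pi / v m)) * ennreal (\<Prod>k\<in>?I. sqrt (2 * pi / v k))"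
  proof (intro mult_mono)
    show "ennreal (sqrt (2 * pi / A)) \<le> ennreal (sqrt (2 * pi / v m))"
      using vA v0 by (intro ennreal_leI) (auto intro!: divide_left_mono mult_pos_pos)
    show "(\<integral>\<^sup>+u. ennreal (exp (- (\<Sum>i\<in>?I. \<Sum>j\<in>?I. a' i j * u i * u j) / 2)) \<partial>(\<Pi>\<^sub>M i\<in>?I. lborel))
        \<le> ennreal (\<Prod>k\<in>?I. sqrt (2 * pi / v k))"
    proof (rule step.IH)
      show "a' i j = a' j i" for i j unfolding a'_def using step.prems(1)[of i j] by simp
      show "0 < v k" if "k \<in> ?I" for k using step.prems(2)[of k] that by auto
      show "v k \<le> (\<Sum>i\<in>?I. \<Sum>j\<in>?I. a' i j * u i * u j)"
        if k: "k \<in> ?I" and u: "u k = 1" "\<And>j. j > k \<Longrightarrow> u j = 0" for k u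
      proof -
        \<comment> \<open>The bound is tested on vectors that vanish after k and are free before it.
          Since m < k, the coordinate m may be set to the minimiser, where the full form equals the
          reduced one.\<close>
        define y where "y = - B u / A"
        have BC: "B (u(m := y)) = B u" "C (u(m := y)) = C u"
          unfolding B_def C_def by (auto intro!: sum.cong)
        have "v k \<le> A * y\<^sup>2 + 2 * B u * y + C u"
          using step.prems(3)[of k "u(m := y)"] k u unfolding Q BC by auto
        also have "\<dots> = C u - (B u)\<^sup>2 / A"
          unfolding y_def using A0 by (simp add: field_simps power2_eq_square)
        finally show ?thesis unfolding Q' .
      qed
    qed
  qed auto
  also have "\<dots> = ennreal (\<Prod>k\<in>{m..<n}. sqrt (2 * pi / v k))"
  proof -
    have "0 \<le> sqrt (2 * pi / v k)" if "k \<in> {m..<n}" for k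
      using step.prems(2)[OF that] by simp
    then have "0 \<le> sqrt (2 * pi / v m)" "0 \<le> (\<Prod>k\<in>?I. sqrt (2 * pi / v k))"
      unfolding I by (auto intro!: prod_nonneg)
    then show ?thesis unfolding I by (simp add: ennreal_mult)
  qed
  finally show ?case .
qed

subsection \<open>Conditional variances\<close>

lemma centered_gaussian_char:
  assumes "prob_space M" "centered_gaussian M Z"
  shows "(\<integral>w. iexp (Z w) \<partial>M) = of_real (exp (- (\<integral>w. (Z w)\<^sup>2 \<partial>M) / 2))"
    and "integrable M (\<lambda>w. (Z w) ^ (2 * k))"
    and "(\<integral>w. (Z w) ^ (2 * k) \<partial>M) = fact (2 * k) / (2 ^ k * fact k) * (\<integral>w. (Z w)\<^sup>2 \<partial>M) ^ k"
proof -
  interpret prob_space M by fact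
  have [measurable]: "Z \<in> borel_measurable M" using assms(2) by (simp add: centered_gaussian_def)
  have "(\<integral>w. iexp (Z w) \<partial>M) = of_real (exp (- (\<integral>w. (Z w)\<^sup>2 \<partial>M) / 2)) \<and>
     integrable M (\<lambda>w. (Z w) ^ (2 * k)) \<and>
     (\<integral>w. (Z w) ^ (2 * k) \<partial>M) = fact (2 * k) / (2 ^ k * fact k) * (\<integral>w. (Z w)\<^sup>2 \<partial>M) ^ k"
  proof (cases "\<exists>\<sigma>>0. distributed M lborel Z (normal_density 0 \<sigma>)")
    case True
    then obtain \<sigma> where s: "\<sigma> > 0" "distributed M lborel Z (normal_density 0 \<sigma>)" by auto
    have mom: "has_bochner_integral M (\<lambda>w. (Z w) ^ (2 * k)) (fact (2 * k) / ((2 / \<sigma>\<^sup>2)^k * fact k))" for k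
    proof -
      have "has_bochner_integral lborel (\<lambda>x. normal_density 0 \<sigma> x * x ^ (2 * k)) (fact (2 * k) / ((2 / \<sigma>\<^sup>2)^k * fact k))"
        using normal_moment_even[OF s(1), of 0 k] by simp
      then show ?thesis
        using distributed_integrable[OF s(2), of "\<lambda>x. x ^ (2 * k)"]
          distributed_integral[OF s(2), of "\<lambda>x. x ^ (2 * k)"]
        by (simp add: has_bochner_integral_iff)
    qed
    have v: "(\<integral>w. (Z w)\<^sup>2 \<partial>M) = \<sigma>\<^sup>2"
      using mom[of 1] s(1) by (simp add: has_bochner_integral_iff fact_2 power2_eq_square)
    have "distributed M lborel (\<lambda>w. Z w / \<sigma>) std_normal_density"
      using normal_standard_normal_convert[OF s(1), of Z 0] s(2) by simp
    then have "distr M lborel (\<lambda>w. Z w / \<sigma>) = std_normal_distribution"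
      by (rule distributed_distr_eq_density)
    then have "char std_normal_distribution \<sigma> = (\<integral>x. iexp (\<sigma> * x) \<partial>distr M lborel (\<lambda>w. Z w / \<sigma>))"
      by (simp add: char_def)
    also have "\<dots> = (\<integral>w. iexp (Z w) \<partial>M)"
      using s(1) by (subst integral_distr) auto
    finally have "(\<integral>w. iexp (Z w) \<partial>M) = of_real (exp (- (\<integral>w. (Z w)\<^sup>2 \<partial>M) / 2))"
      unfolding v by (simp add: char_std_normal_distribution)
    moreover have "(2 / \<sigma>\<^sup>2) ^ k = 2 ^ k / (\<sigma>\<^sup>2) ^ k" by (simp add: power_divide)
    ultimately show ?thesis using mom[of k] s(1) unfolding v by (simp add: has_bochner_integral_iff)
  next
    case False
    then have z: "AE w in M. Z w = 0" using assms(2) by (auto simp: centered_gaussian_def)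
    have "(\<integral>w. iexp (Z w) \<partial>M) = (\<integral>w. 1 \<partial>M)" using z by (intro integral_cong_AE) auto
    moreover have int: "(\<integral>w. (Z w) ^ (2 * k) \<partial>M) = (\<integral>w. 0 ^ (2 * k) \<partial>M)" for k
      using z by (intro integral_cong_AE) auto
    moreover have "integrable M (\<lambda>w. (Z w) ^ (2 * k))"
    proof (rule integrable_cong_AE[THEN iffD2])
      show "AE w in M. (Z w) ^ (2 * k) = 0 ^ (2 * k)" using z by auto
    qed auto
    ultimately show ?thesis using int[of k] int[of 1]
      by (cases "k = 0") (simp_all add: prob_space power_0_left)
  qed
  then show "(\<integral>w. iexp (Z w) \<partial>M) = of_real (exp (- (\<integral>w. (Z w)\<^sup>2 \<partial>M) / 2))"
    and "integrable M (\<lambda>w. (Z w) ^ (2 * k))"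
    and "(\<integral>w. (Z w) ^ (2 * k) \<partial>M) = fact (2 * k) / (2 ^ k * fact k) * (\<integral>w. (Z w)\<^sup>2 \<partial>M) ^ k"
    by blast+
qed

lemma integrable_mult_of_square_integrable:
  fixes f g :: "'a \<Rightarrow> real"
  assumes [measurable]: "f \<in> borel_measurable M" "g \<in> borel_measurable M"
    and "integrable M (\<lambda>x. (f x)\<^sup>2)" "integrable M (\<lambda>x. (g x)\<^sup>2)"
  shows "integrable M (\<lambda>x. f x * g x)"
proof (rule Bochner_Integration.integrable_bound)
  show "integrable M (\<lambda>x. (f x)\<^sup>2 + (g x)\<^sup>2)" using assms by auto
  have "\<bar>a * b\<bar> \<le> a\<^sup>2 + b\<^sup>2" for a b :: real
  proof -
    have "2 * \<bar>a\<bar> * \<bar>b\<bar> \<le> a\<^sup>2 + b\<^sup>2" using sum_squares_bound[of "\<bar>a\<bar>" "\<bar>b\<bar>"] by simp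
    moreover have "0 \<le> \<bar>a\<bar> * \<bar>b\<bar>" by simp
    ultimately show ?thesis unfolding abs_mult by linarith
  qed
  then show "AE x in M. norm (f x * g x) \<le> norm ((f x)\<^sup>2 + (g x)\<^sup>2)" by (auto intro!: AE_I2 simp: abs_mult)
qed simp

lemma square_integrable_add:
  fixes f g :: "'a \<Rightarrow> real"
  assumes [measurable]: "f \<in> borel_measurable M" "g \<in> borel_measurable M"
    and "integrable M (\<lambda>x. (f x)\<^sup>2)" "integrable M (\<lambda>x. (g x)\<^sup>2)"
  shows "integrable M (\<lambda>x. (f x + g x)\<^sup>2)"
  using integrable_mult_of_square_integrable[OF assms] assms(3,4) by (simp add: power2_sum mult.assoc)

text \<open>The conditional expectation is the orthogonal projection of Z onto the square-integrable
  functions measurable in F. By Pythagoras no such W is closer to Z than the projection, and the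
  squared distance to the projection is the mean of the conditional variance.\<close>

lemma (in prob_space) integral_square_ge_of_cond_variance:
  fixes Z W :: "'a \<Rightarrow> real"
  assumes sub: "subalgebra M F" and Z [measurable]: "Z \<in> borel_measurable M"
    and Z2: "integrable M (\<lambda>w. (Z w)\<^sup>2)"
    and W: "W \<in> borel_measurable F" and W2: "integrable M (\<lambda>w. (W w)\<^sup>2)"
    and c: "AE w in M. c \<le> cond_variance M F Z w"
  shows "c \<le> (\<integral>w. (Z w - W w)\<^sup>2 \<partial>M)"
proof -
  interpret sigma_finite_subalgebra M F
    by (intro finite_measure_subalgebra_is_sigma_finite finite_measure_subalgebra.intro
        finite_measure_subalgebra_axioms.intro sub) (rule finite_measure_axioms)
  define m where "m = real_cond_exp M F Z"
  have mF [measurable]: "m \<in> borel_measurable F" unfolding m_def by simp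
  have mM [measurable]: "m \<in> borel_measurable M" unfolding m_def by simp
  have WM [measurable]: "W \<in> borel_measurable M" by (rule measurable_from_subalg[OF sub W])
  have Z1: "integrable M Z"
    using integrable_mult_of_square_integrable[of Z M "\<lambda>_. 1"] Z2 by auto
  have cv: "convex_on UNIV (\<lambda>x::real. x\<^sup>2)" by (rule convex_power2)
  have "AE w in M. (m w)\<^sup>2 \<le> real_cond_exp M F (\<lambda>w. (Z w)\<^sup>2) w"
    unfolding m_def
    using real_cond_exp_jensens_inequality(2)[of Z UNIV, OF Z1 _ _ Z2 cv] by simp
  then have bd: "AE w in M. norm ((m w)\<^sup>2) \<le> norm (real_cond_exp M F (\<lambda>w. (Z w)\<^sup>2) w)"
    by eventually_elim simp
  have m2: "integrable M (\<lambda>w. (m w)\<^sup>2)"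
    by (rule Bochner_Integration.integrable_bound[OF real_cond_exp_int(1)[OF Z2] _ bd]) simp
  have nm2: "integrable M (\<lambda>w. (- m w)\<^sup>2)" "integrable M (\<lambda>w. (- W w)\<^sup>2)" using m2 W2 by simp_all
  define U where "U = (\<lambda>w. m w - W w)"
  have UF: "U \<in> borel_measurable F" unfolding U_def using mF W by simp
  have UM [measurable]: "U \<in> borel_measurable M" unfolding U_def by simp
  have U2: "integrable M (\<lambda>w. (U w)\<^sup>2)"
    using square_integrable_add[of m M "\<lambda>w. - W w"] m2 nm2 by (simp add: U_def)
  have Zm2: "integrable M (\<lambda>w. (Z w - m w)\<^sup>2)"
    using square_integrable_add[of Z M "\<lambda>w. - m w"] Z2 nm2 by simp
  have UZ: "integrable M (\<lambda>w. U w * Z w)" by (intro integrable_mult_of_square_integrable U2 Z2) auto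
  have Um: "integrable M (\<lambda>w. U w * m w)" by (intro integrable_mult_of_square_integrable U2 m2) auto
  have cross: "(\<integral>w. U w * m w \<partial>M) = (\<integral>w. U w * Z w \<partial>M)"
    unfolding m_def by (rule real_cond_exp_intg(2)[OF UZ UF Z])
  have "(\<integral>w. (Z w - W w)\<^sup>2 \<partial>M) = (\<integral>w. (Z w - m w)\<^sup>2 + (U w)\<^sup>2 + 2 * (U w * Z w - U w * m w) \<partial>M)"
    by (intro Bochner_Integration.integral_cong refl) (simp add: U_def power2_eq_square algebra_simps)
  also have "\<dots> = (\<integral>w. (Z w - m w)\<^sup>2 \<partial>M) + (\<integral>w. (U w)\<^sup>2 \<partial>M)"
    using Zm2 U2 UZ Um cross by simp
  finally have 1: "(\<integral>w. (Z w - m w)\<^sup>2 \<partial>M) \<le> (\<integral>w. (Z w - W w)\<^sup>2 \<partial>M)" by simp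
  have "c = (\<integral>w. c \<partial>M)" by (simp add: prob_space)
  also have "\<dots> \<le> (\<integral>w. cond_variance M F Z w \<partial>M)"
    unfolding cond_variance_def
    by (intro integral_mono_AE c[unfolded cond_variance_def] real_cond_exp_int(1) Zm2[unfolded m_def]) simp
  also have "\<dots> = (\<integral>w. (Z w - m w)\<^sup>2 \<partial>M)"
    unfolding cond_variance_def m_def by (rule real_cond_exp_int(2)[OF Zm2[unfolded m_def]])
  finally show ?thesis using 1 by simp
qed

lemma centered_gaussian_field_real:
  fixes Y :: "'t \<Rightarrow> 'v \<Rightarrow> real"
  assumes "centered_gaussian_field M Y" "finite F"
  shows "centered_gaussian M (\<lambda>w. \<Sum>t\<in>F. a t * Y t w)"
  using assms unfolding centered_gaussian_field_def by simp

text \<open>Different indices may carry the same point, whereas the definition of the field speaks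
  of sums over a set of points; coefficients at equal points are added up.\<close>

lemma centered_gaussian_field_sum:
  fixes Y :: "'t \<Rightarrow> 'v \<Rightarrow> real"
  assumes Y: "centered_gaussian_field M Y" and F: "finite F"
  shows "centered_gaussian M (\<lambda>w. \<Sum>i\<in>F. a i * Y (u i) w)"
proof -
  have "(\<Sum>i\<in>F. a i * Y (u i) w) = (\<Sum>t\<in>u ` F. (\<Sum>i\<in>{i\<in>F. u i = t}. a i) * Y t w)" for w
  proof -
    have "(\<Sum>i\<in>F. a i * Y (u i) w) = (\<Sum>t\<in>u ` F. \<Sum>i\<in>{i\<in>F. u i = t}. a i * Y (u i) w)"
      by (rule sum.image_gen[OF F])
    also have "\<dots> = (\<Sum>t\<in>u ` F. (\<Sum>i\<in>{i\<in>F. u i = t}. a i) * Y t w)"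
      unfolding sum_distrib_right by (intro sum.cong refl) auto
    finally show ?thesis .
  qed
  then show ?thesis using centered_gaussian_field_real[OF Y, of "u ` F"] F by simp
qed

text \<open>Linear combinations of the conditioning values are measurable in the generated algebra,
  so the conditional variance can be traded for a lower bound on quadratic forms. All later uses of
  (A2) go through this form, which matches the quadratic forms in the characteristic
  functions.\<close>

lemma condition_A_linear:
  fixes Y :: "real ^ 'n::finite \<Rightarrow> 'v \<Rightarrow> real"
  assumes Y: "centered_gaussian_field M Y" and A: "condition_A M Y T H"
  obtains C3 where "C3 > 0"
    "\<And>(n::nat) t u b. n \<ge> 1 \<Longrightarrow> t \<in> T \<Longrightarrow> u 0 = 0 \<Longrightarrow> (\<And>k. k \<in> {1..n} \<Longrightarrow> u k \<in> T) \<Longrightarrow>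
       C3 * (MIN k\<in>{0..n}. (rho H t (u k))\<^sup>2) \<le> (\<integral>w. (Y t w - (\<Sum>k\<in>{1..n}. b k * Y (u k) w))\<^sup>2 \<partial>M)"
proof -
  interpret prob_space M using Y by (simp add: centered_gaussian_field_def)
  have [measurable]: "Y t \<in> borel_measurable M" for t using Y by (simp add: centered_gaussian_field_def)
  obtain C3 where C3: "C3 > 0" "\<And>n t u. n \<ge> 1 \<Longrightarrow> t \<in> T \<Longrightarrow> u 0 = 0 \<Longrightarrow> (\<forall>k\<in>{1..n}. u k \<in> T) \<Longrightarrow>
      (AE w in M. cond_variance M (generated_algebra M {1..n} (\<lambda>k. Y (u k))) (Y t) w
                      \<ge> C3 * (MIN k\<in>{0..n}. (rho H t (u k))\<^sup>2))"
    using A unfolding condition_A_def by blast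
  show ?thesis
  proof (rule that[OF C3(1)])
    fix n :: nat and t u and b :: "nat \<Rightarrow> real"
    assume *: "n \<ge> 1" "t \<in> T" "u 0 = 0" "\<And>k. k \<in> {1..n} \<Longrightarrow> u k \<in> T"
    let ?F = "generated_algebra M {1..n} (\<lambda>k. Y (u k))"
    have [measurable]: "(\<lambda>w. \<lambda>k\<in>{1..n}. Y (u k) w) \<in> measurable M (Pi\<^sub>M {1..n} (\<lambda>_. borel))"
      by measurable
    have sub: "subalgebra M ?F"
      unfolding subalgebra_def generated_algebra_def
      by (simp add: sets_image_in_sets)
    have G: "(\<lambda>w. \<lambda>k\<in>{1..n}. Y (u k) w) \<in> measurable ?F (Pi\<^sub>M {1..n} (\<lambda>_. borel))"
      unfolding generated_algebra_def by (intro measurable_vimage_algebra1) (auto simp: space_PiM)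
    have YF: "Y (u k) \<in> borel_measurable ?F" if "k \<in> {1..n}" for k
      using measurable_compose[OF G measurable_component_singleton[OF that]] that by simp
    have g: "centered_gaussian M (\<lambda>w. \<Sum>k\<in>{1..n}. b k * Y (u k) w)" "centered_gaussian M (Y t)"
      using centered_gaussian_field_sum[OF Y, of "{1..n}" b u] centered_gaussian_field_sum[OF Y, of "{()}" "\<lambda>_. 1" "\<lambda>_. t"] by auto
    show "C3 * (MIN k\<in>{0..n}. (rho H t (u k))\<^sup>2) \<le> (\<integral>w. (Y t w - (\<Sum>k\<in>{1..n}. b k * Y (u k) w))\<^sup>2 \<partial>M)"
    proof (rule integral_square_ge_of_cond_variance[OF sub])
      show "integrable M (\<lambda>w. (Y t w)\<^sup>2)" "integrable M (\<lambda>w. (\<Sum>k\<in>{1..n}. b k * Y (u k) w)\<^sup>2)"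
        using centered_gaussian_char(2)[OF prob_space_axioms g(1), of 1] centered_gaussian_char(2)[OF prob_space_axioms g(2), of 1] by simp_all
      show "(\<lambda>w. \<Sum>k\<in>{1..n}. b k * Y (u k) w) \<in> borel_measurable ?F"
        using YF by (intro borel_measurable_sum borel_measurable_times) auto
      show "AE w in M. C3 * (MIN k\<in>{0..n}. (rho H t (u k))\<^sup>2) \<le> cond_variance M ?F (Y t) w"
        using C3(2)[of n t u] * by auto
    qed auto
  qed
qed

subsection \<open>Integrals of powers of the separation\<close>

lemma rho_measurable [measurable (raw)]:
  fixes H :: "real ^ 'n::finite"
  assumes "f \<in> borel_measurable M" "g \<in> borel_measurable M"
  shows "(\<lambda>x. rho H (f x) (g x)) \<in> borel_measurable M"
proof -
  have c: "(\<lambda>v::real^'n. v $ j) \<in> borel_measurable borel" for j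
    by (intro borel_measurable_continuous_onI continuous_intros)
  note [measurable] = measurable_compose[OF assms(1) c] measurable_compose[OF assms(2) c]
  show ?thesis unfolding rho_def by measurable
qed

lemma rho_nonneg: "0 \<le> rho H t s"
  unfolding rho_def by (intro sum_nonneg) auto

lemma rho_commute: "rho H t s = rho H s t"
  unfolding rho_def by (simp add: abs_minus_commute)

lemma rho_self [simp]: "rho H t t = 0"
  unfolding rho_def by simp

lemma rho_coord_le: "\<bar>t $ j - s $ j\<bar> powr (H $ j) \<le> rho H t s"
  unfolding rho_def by (rule member_le_sum) auto

lemma rho_le_imp_abs_le:
  assumes "0 < H $ j" "rho H t s \<le> u"
  shows "\<bar>t $ j - s $ j\<bar> \<le> u powr (1 / H $ j)"
proof -
  have "(\<bar>t $ j - s $ j\<bar> powr (H $ j)) powr (1 / H $ j) \<le> u powr (1 / H $ j)"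
    using assms rho_coord_le[of t j s H] by (intro powr_mono2) auto
  then show ?thesis using assms(1) by (simp add: powr_powr)
qed

lemma emeasure_lborel_cbox_cart:
  fixes l u :: "real ^ 'n::finite"
  assumes "\<And>j. l $ j \<le> u $ j"
  shows "emeasure lborel (cbox l u) = ennreal (\<Prod>j\<in>UNIV. u $ j - l $ j)"
proof -
  have "cbox l u \<noteq> {}" using assms by (auto simp: interval_ne_empty_cart)
  then have "measure lborel (cbox l u) = (\<Prod>j\<in>UNIV. u $ j - l $ j)"
    by (rule content_cbox_cart)
  moreover have "emeasure lborel (cbox l u) = ennreal (measure lborel (cbox l u))"
    using emeasure_lborel_cbox_finite[of l u] by (intro emeasure_eq_ennreal_measure) auto
  ultimately show ?thesis by simp
qed

lemma prod_powr_inverse_eq_Q: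
  fixes H :: "real ^ 'n::finite"
  assumes "u > 0"
  shows "(\<Prod>j\<in>UNIV. u powr (1 / H $ j)) = u powr (Q_dim H)"
  using assms by (simp add: Q_dim_def powr_sum)

text \<open>The ball lies in a box with half sides u^(1/H_j), whose volume scales like u^Q: Q is the
  dimension belonging to \<open>rho\<close>.\<close>

lemma emeasure_rho_ball_le:
  fixes H :: "real ^ 'n::finite"
  assumes H: "\<And>j. 0 < H $ j" and u: "u > 0"
  shows "emeasure lborel {t. rho H t b \<le> u} \<le> ennreal (2 ^ CARD('n) * u powr (Q_dim H))"
proof -
  let ?l = "\<chi> j. b $ j - u powr (1 / H $ j)" and ?u = "\<chi> j. b $ j + u powr (1 / H $ j)"
  have "{t. rho H t b \<le> u} \<subseteq> cbox ?l ?u"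
  proof
    fix t assume "t \<in> {t. rho H t b \<le> u}"
    then have "\<bar>t $ j - b $ j\<bar> \<le> u powr (1 / H $ j)" for j
      using rho_le_imp_abs_le[OF H] by auto
    then show "t \<in> cbox ?l ?u" by (auto simp: mem_box_cart abs_le_iff) (smt (verit))+
  qed
  then have "emeasure lborel {t. rho H t b \<le> u} \<le> emeasure lborel (cbox ?l ?u)"
    by (intro emeasure_mono) auto
  also have "\<dots> = ennreal (\<Prod>j\<in>UNIV. 2 * u powr (1 / H $ j))"
    by (subst emeasure_lborel_cbox_cart) (auto simp: algebra_simps)
  also have "(\<Prod>j\<in>UNIV. 2 * u powr (1 / H $ j)) = 2 ^ CARD('n) * u powr (Q_dim H)"
    using u by (simp add: prod.distrib prod_powr_inverse_eq_Q)
  finally show ?thesis .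
qed

text \<open>The sum of the dyadic shell bounds: shell m contributes \<open>2 ^ N * 2 powr s\<close>
  times the m-th power of the ratio \<open>2 powr (s - q)\<close>, which is below 1 if s <
  q.\<close>

definition singular_const :: "nat \<Rightarrow> real \<Rightarrow> real \<Rightarrow> real" where
  "singular_const N q s = 2 ^ N * 2 powr s / (1 - 2 powr (s - q))"

lemma singular_const_nonneg: "s < q \<Longrightarrow> 0 \<le> singular_const N q s"
  using powr_mono[of "s - q" 0 2] unfolding singular_const_def by simp

text \<open>Dyadic shells about b. The shift e > 0 puts every point, b included, into some shell,
  and the resulting bound does not contain e. This uniformity is what later permits the width of the
  mollifier to tend to 0.\<close>

lemma nn_integral_rho_ball_powr_le:
  fixes H :: "real ^ 'n::finite"
  assumes H: "\<And>j. 0 < H $ j" and u: "u > 0" and e: "e > 0" and s: "0 \<le> s" "s < Q_dim H"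
  shows "(\<integral>\<^sup>+t. ennreal ((e + rho H t b) powr (- s)) * indicator {t. rho H t b \<le> u} t \<partial>lborel)
    \<le> ennreal (singular_const CARD('n) (Q_dim H) s * u powr (Q_dim H - s))"
proof -
  let ?Q = "Q_dim H"
  define c where "c = (\<lambda>m::nat. (u / 2 ^ Suc m) powr (- s))"
  define B where "B = (\<lambda>m::nat. {t. rho H t b \<le> u / 2 ^ m})"
  have Bm [measurable]: "B m \<in> sets borel" for m unfolding B_def by measurable
  have pw: "ennreal ((e + rho H t b) powr (- s)) * indicator {t. rho H t b \<le> u} t
      \<le> (\<Sum>m. ennreal (c m) * indicator (B m) t)" for t
  proof (cases "rho H t b \<le> u")
    case True
    obtain m0 :: nat where "u / 2 ^ Suc m0 < e + rho H t b"
    proof -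
      obtain m :: nat where "(1/2) ^ m < e / u" using real_arch_pow_inv[of "e/u" "1/2"] e u by auto
      then have "u / 2 ^ m < e" using u by (simp add: field_simps power_one_over)
      moreover have "u / 2 ^ Suc m \<le> u / 2 ^ m" using u by (simp add: field_simps)
      ultimately show ?thesis using rho_nonneg[of H t b] by (intro that[of m]) linarith
    qed
    \<comment> \<open>The first dyadic scale below the shifted distance; by minimality the point
      lies in the ball of twice that scale.\<close>
    then obtain m where m: "u / 2 ^ Suc m < e + rho H t b"
        "\<And>k. k < m \<Longrightarrow> e + rho H t b \<le> u / 2 ^ Suc k"
      using exists_least_iff[of "\<lambda>m. u / 2 ^ Suc m < e + rho H t b"] by (auto simp: not_less)
    have "t \<in> B m"
    proof (cases m)
      case 0 then show ?thesis using True by (simp add: B_def)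
    next
      case (Suc k) then show ?thesis using m(2)[of k] e by (simp add: B_def)
    qed
    moreover have "(e + rho H t b) powr (- s) \<le> c m"
      unfolding c_def using m(1) s u by (intro powr_mono2') auto
    ultimately have "ennreal ((e + rho H t b) powr (- s)) * indicator {t. rho H t b \<le> u} t
        \<le> ennreal (c m) * indicator (B m) t"
      using True by (simp add: ennreal_leI)
    also have "\<dots> \<le> (\<Sum>m. ennreal (c m) * indicator (B m) t)"
    proof -
      define f where "f = (\<lambda>m. ennreal (c m) * indicator (B m) t :: ennreal)"
      have "sum f {m} \<le> suminf f" by (intro sum_le_suminf) auto
      then have "f m \<le> suminf f" by simp
      then show ?thesis unfolding f_def .
    qed
    finally show ?thesis .
  qed simp
  define q where "q = 2 powr (s - ?Q)"
  have q: "0 < q" "q < 1" unfolding q_def using s powr_less_mono[of "s - ?Q" 0 2] by auto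
  have geom: "c m * (2 ^ CARD('n) * (u / 2 ^ m) powr ?Q) = 2 ^ CARD('n) * 2 powr s * u powr (?Q - s) * q ^ m" for m
  proof -
    have "(u / 2 ^ Suc m) powr (- s) = u powr (- s) * 2 powr s * 2 powr (s * real m)"
      using u by (simp add: powr_divide powr_minus powr_realpow[symmetric] powr_powr powr_mult field_simps powr_add)
    moreover have "(u / 2 ^ m) powr ?Q = u powr ?Q * 2 powr (- ?Q * real m)"
      using u by (simp add: powr_divide powr_minus powr_realpow[symmetric] powr_powr field_simps)
    moreover have "q ^ m = 2 powr (s * real m) * 2 powr (- ?Q * real m)"
      unfolding q_def by (simp add: powr_realpow[symmetric] powr_powr powr_add[symmetric] algebra_simps)
    moreover have "u powr (?Q - s) = u powr ?Q * u powr (- s)"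
      by (simp add: powr_add[symmetric])
    ultimately show ?thesis unfolding c_def by simp
  qed
  have "(\<integral>\<^sup>+t. ennreal ((e + rho H t b) powr (- s)) * indicator {t. rho H t b \<le> u} t \<partial>lborel)
      \<le> (\<integral>\<^sup>+t. (\<Sum>m. ennreal (c m) * indicator (B m) t) \<partial>lborel)"
    by (intro nn_integral_mono pw)
  also have "\<dots> = (\<Sum>m. ennreal (c m) * emeasure lborel (B m))"
    by (subst nn_integral_suminf) (auto simp: nn_integral_cmult_indicator)
  also have "\<dots> \<le> (\<Sum>m. ennreal (2 ^ CARD('n) * 2 powr s * u powr (?Q - s) * q ^ m))"
  proof (intro suminf_le)
    fix m
    have "ennreal (c m) * emeasure lborel (B m) \<le> ennreal (c m) * ennreal (2 ^ CARD('n) * (u / 2 ^ m) powr ?Q)"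
      unfolding B_def using u by (intro mult_left_mono emeasure_rho_ball_le H) auto
    also have "\<dots> = ennreal (2 ^ CARD('n) * 2 powr s * u powr (?Q - s) * q ^ m)"
      by (subst ennreal_mult[symmetric]) (auto simp: c_def geom[symmetric])
    finally show "ennreal (c m) * emeasure lborel (B m) \<le> \<dots>" .
  qed auto
  also have "\<dots> = ennreal (\<Sum>m. 2 ^ CARD('n) * 2 powr s * u powr (?Q - s) * q ^ m)"
    using q by (intro suminf_ennreal2 summable_mult summable_geometric) auto
  also have "(\<Sum>m. 2 ^ CARD('n) * 2 powr s * u powr (?Q - s) * q ^ m) = 2 ^ CARD('n) * 2 powr s * u powr (?Q - s) * (1 / (1 - q))"
    using q by (subst suminf_mult) (auto simp: suminf_geometric intro!: summable_geometric)
  also have "\<dots> = singular_const CARD('n) ?Q s * u powr (?Q - s)"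
    unfolding singular_const_def q_def by simp
  finally show ?thesis .
qed

text \<open>The source of the exponent s/Q. Summing the singularities of all k centres up to radius
  r would cost a factor k. Instead only balls of radius \<open>u0\<close> are treated as singular,
  and outside them the integrand is at most \<open>u0 powr (- s)\<close>.\<close>

lemma nn_integral_min_rho_powr_le:
  fixes H :: "real ^ 'n::finite"
  assumes H: "\<And>j. 0 < H $ j" and r: "r > 0" and e: "e > 0" and s: "0 \<le> s" "s < Q_dim H"
    and S: "S \<in> sets borel" "emeasure lborel S \<le> ennreal (cS * r powr (Q_dim H))" and cS: "0 \<le> cS"
    and P: "finite P" "P \<noteq> {}" "card P \<le> k"
  shows "(\<integral>\<^sup>+t. ennreal (min r (e + (MIN b\<in>P. rho H t b)) powr (- s)) \<partial>restrict_space lborel S)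
    \<le> ennreal ((cS + singular_const CARD('n) (Q_dim H) s) * real k powr (s / Q_dim H) * r powr (Q_dim H - s))"
proof -
  let ?Q = "Q_dim H"
  have Q0: "?Q > 0" using s by simp
  have k: "k \<ge> 1" using P by (metis One_nat_def Suc_leI card_gt_0_iff le_trans)
  \<comment> \<open>The radius that balances the two contributions: k balls of this radius have
    together a volume of order r^Q, and both parts become of order k^(s/Q) r^(Q-s).\<close>
  define u0 where "u0 = r * real k powr (- (1 / ?Q))"
  have "real k powr (- (1 / ?Q)) \<le> 1"
    using powr_mono[of "- (1 / ?Q)" 0 "real k"] k Q0 by simp
  then have u0: "0 < u0" "u0 \<le> r" unfolding u0_def using r k by (auto simp: mult_le_cancel_left2)
  have pw: "ennreal (min r (e + (MIN b\<in>P. rho H t b)) powr (- s)) * indicator S t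
     \<le> ennreal (u0 powr (- s)) * indicator S t +
       (\<Sum>b\<in>P. ennreal ((e + rho H t b) powr (- s)) * indicator {t. rho H t b \<le> u0} t)" (is "?l \<le> ?a + ?b") for t
  proof -
    let ?m = "MIN b\<in>P. rho H t b"
    have "?m \<in> (\<lambda>b. rho H t b) ` P" using P by (intro Min_in) auto
    then obtain b where b: "b \<in> P" "?m = rho H t b" by auto
    have m0: "0 \<le> ?m" using b rho_nonneg by metis
    show ?thesis
    proof (cases "u0 \<le> min r (e + ?m)")
      case True
      then have "min r (e + ?m) powr (- s) \<le> u0 powr (- s)" using u0 s by (intro powr_mono2') auto
      then have "?l \<le> ?a" by (intro mult_right_mono ennreal_leI) auto
      also have "\<dots> \<le> ?a + ?b" by simp
      finally show ?thesis .
    next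
      case False
      then have *: "min r (e + ?m) = e + rho H t b" "rho H t b \<le> u0"
        using u0 e b by (auto simp: min_def split: if_splits)
      have "?l \<le> ennreal ((e + rho H t b) powr (- s)) * indicator {t. rho H t b \<le> u0} t"
        unfolding *(1) using *(2) by (simp add: indicator_def)
      also have "\<dots> \<le> ?b" using P b by (intro member_le_sum) auto
      also have "\<dots> \<le> ?a + ?b" by simp
      finally show ?thesis .
    qed
  qed
  have "(\<integral>\<^sup>+t. ennreal (min r (e + (MIN b\<in>P. rho H t b)) powr (- s)) \<partial>restrict_space lborel S)
     = (\<integral>\<^sup>+t. ennreal (min r (e + (MIN b\<in>P. rho H t b)) powr (- s)) * indicator S t \<partial>lborel)"
    using S by (intro nn_integral_restrict_space) auto
  also have "\<dots> \<le> (\<integral>\<^sup>+t. ennreal (u0 powr (- s)) * indicator S t +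
       (\<Sum>b\<in>P. ennreal ((e + rho H t b) powr (- s)) * indicator {t. rho H t b \<le> u0} t) \<partial>lborel)"
    by (intro nn_integral_mono pw)
  also have "\<dots> = ennreal (u0 powr (- s)) * emeasure lborel S +
       (\<Sum>b\<in>P. \<integral>\<^sup>+t. ennreal ((e + rho H t b) powr (- s)) * indicator {t. rho H t b \<le> u0} t \<partial>lborel)"
    using S(1) by (subst nn_integral_add) (auto simp: nn_integral_cmult_indicator nn_integral_sum)
  also have "\<dots> \<le> ennreal (u0 powr (- s)) * ennreal (cS * r powr ?Q) +
       (\<Sum>b\<in>P. ennreal (singular_const CARD('n) ?Q s * u0 powr (?Q - s)))"
    using H e s u0 by (intro add_mono mult_left_mono S(2) sum_mono nn_integral_rho_ball_powr_le) auto
  also have "\<dots> \<le> ennreal (u0 powr (- s)) * ennreal (cS * r powr ?Q) +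
       ennreal (real k) * ennreal (singular_const CARD('n) ?Q s * u0 powr (?Q - s))"
    unfolding sum_constant ennreal_of_nat_eq_real_of_nat[symmetric]
    using P(3) by (intro add_left_mono mult_right_mono) auto
  also have "\<dots> = ennreal (u0 powr (- s) * (cS * r powr ?Q) + real k * (singular_const CARD('n) ?Q s * u0 powr (?Q - s)))"
    using cS singular_const_nonneg[OF s(2)] by (simp add: ennreal_mult ennreal_plus)
  also have "u0 powr (- s) * (cS * r powr ?Q) + real k * (singular_const CARD('n) ?Q s * u0 powr (?Q - s))
     = (cS + singular_const CARD('n) ?Q s) * real k powr (s / ?Q) * r powr (?Q - s)"
  proof -
    have "u0 powr (- s) = r powr (- s) * real k powr (s / ?Q)"
      unfolding u0_def using r k by (simp add: powr_mult powr_powr)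
    moreover have "real k * u0 powr (?Q - s) = real k powr (s / ?Q) * r powr (?Q - s)"
    proof -
      have "real k * u0 powr (?Q - s) = real k powr 1 * real k powr (- (1 / ?Q) * (?Q - s)) * r powr (?Q - s)"
        unfolding u0_def using r k by (simp add: powr_mult powr_powr)
      also have "real k powr 1 * real k powr (- (1 / ?Q) * (?Q - s)) = real k powr (s / ?Q)"
        unfolding powr_add[symmetric] using Q0 by (simp add: field_simps)
      finally show ?thesis .
    qed
    moreover have "r powr (- s) * r powr ?Q = r powr (?Q - s)" by (simp add: powr_add[symmetric])
    ultimately have "u0 powr (- s) * r powr ?Q = real k powr (s / ?Q) * r powr (?Q - s)"
      "real k * u0 powr (?Q - s) = real k powr (s / ?Q) * r powr (?Q - s)" by simp_all
    moreover have "u0 powr (- s) * (cS * r powr ?Q) + real k * (sc * u0 powr (?Q - s))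
        = cS * (u0 powr (- s) * r powr ?Q) + sc * (real k * u0 powr (?Q - s))" for sc by simp
    ultimately show ?thesis by (simp only: distrib_right mult.assoc)
  qed
  finally show ?thesis .
qed

text \<open>The points on which the \<open>k\<close>-th value of the field is conditioned: the origin (forced by
  condition (A2)), the base point \<open>a\<close>, and the preceding points.\<close>

definition cond_point :: "real ^ 'n \<Rightarrow> (nat \<Rightarrow> real ^ 'n) \<Rightarrow> nat \<Rightarrow> real ^ 'n" where
  "cond_point a t i = (if i = 0 then 0 else if i = 1 then a else t (i - 2))"

text \<open>The shift e is the width of the mollifier, which adds e^2 to each variance, and it keeps
  separations positive. The cap r lets the larger of two separations be replaced by r in
  \<open>prod_min_sep_le\<close>.\<close>

definition sep :: "real ^ 'n \<Rightarrow> real \<Rightarrow> real \<Rightarrow> real ^ 'n \<Rightarrow> (nat \<Rightarrow> real ^ 'n) \<Rightarrow> nat \<Rightarrow> real" where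
  "sep H r e a t k = min r (e + (MIN i\<in>{..<k + 2}. rho H (t k) (cond_point a t i)))"

lemma sep_pos: "r > 0 \<Longrightarrow> e > 0 \<Longrightarrow> 0 < sep H r e a t k"
proof -
  assume "r > 0" "e > 0"
  moreover have "0 \<le> (MIN i\<in>{..<k + 2}. rho H (t k) (cond_point a t i))"
    by (subst Min_ge_iff) (auto simp: rho_nonneg)
  ultimately show ?thesis unfolding sep_def by auto
qed

lemma sep_le: "sep H r e a t k \<le> r" unfolding sep_def by simp

lemma sep_cong: "(\<And>i. i \<le> k \<Longrightarrow> t i = t' i) \<Longrightarrow> sep H r e a t k = sep H r e a t' k"
  unfolding sep_def cond_point_def
  by (intro arg_cong[where f="\<lambda>x. min r (e + x)"] arg_cong[where f=Min] image_cong) auto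

lemma sep_measurable [measurable]:
  fixes a :: "real ^ 'n::finite"
  assumes "k < n"
  shows "(\<lambda>t. sep H r e a t k) \<in> borel_measurable (\<Pi>\<^sub>M i\<in>{..<n}. restrict_space lborel S)"
proof -
  have [measurable]: "(\<lambda>x. x) \<in> measurable (restrict_space lborel S) borel"
    by (intro measurable_restrict_space1) simp
  have c: "(\<lambda>t. t i) \<in> measurable (\<Pi>\<^sub>M i\<in>{..<n}. restrict_space lborel S) borel" if "i < n" for i
    using measurable_compose[OF measurable_component_singleton[of i "{..<n}" "\<lambda>_. restrict_space lborel S"], of "\<lambda>x. x" borel] that by simp
  have "(\<lambda>t. rho H (t k) (cond_point a t i)) \<in> borel_measurable (\<Pi>\<^sub>M i\<in>{..<n}. restrict_space lborel S)" if "i < k + 2" for i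
    unfolding cond_point_def using that assms
    by (cases "i = 0"; cases "i = 1") (auto intro!: rho_measurable c)
  then have "(\<lambda>t. MIN i\<in>{..<k + 2}. rho H (t k) (cond_point a t i)) \<in> borel_measurable (\<Pi>\<^sub>M i\<in>{..<n}. restrict_space lborel S)"
    by (intro borel_measurable_Min) auto
  then show ?thesis unfolding sep_def by measurable
qed

text \<open>The last point is integrated first: no earlier factor contains it, and it sees n + 2
  centres, namely the origin, a and the n preceding points. This is the origin of
  \<open>k + 2\<close> in all moment bounds.\<close>

lemma nn_integral_prod_sep_le:
  fixes H :: "real ^ 'n::finite"
  assumes H: "\<And>j. 0 < H $ j" and r: "r > 0" and e: "e > 0" and s: "0 \<le> s" "s < Q_dim H"
    and S: "S \<in> sets borel" "emeasure lborel S \<le> ennreal (cS * r powr (Q_dim H))" and cS: "0 \<le> cS"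
  shows "(\<integral>\<^sup>+t. (\<Prod>k<n. ennreal (sep H r e a t k powr (- s))) \<partial>(\<Pi>\<^sub>M i\<in>{..<n}. restrict_space lborel S))
    \<le> (\<Prod>k<n. ennreal ((cS + singular_const CARD('n) (Q_dim H) s) * real (k + 2) powr (s / Q_dim H) * r powr (Q_dim H - s)))"
proof (induction n)
  case 0
  interpret product_sigma_finite "\<lambda>i::nat. restrict_space lborel S"
    using S(1) by (intro product_sigma_finite.intro sigma_finite_measure_restrict_space sigma_finite_lborel) auto
  show ?case by (simp add: PiM_empty nn_integral_count_space_finite)
next
  case (Suc n)
  interpret product_sigma_finite "\<lambda>i::nat. restrict_space lborel S"
    using S(1) by (intro product_sigma_finite.intro sigma_finite_measure_restrict_space sigma_finite_lborel) auto
  let ?c = "\<lambda>k. ennreal ((cS + singular_const CARD('n) (Q_dim H) s) * real (k + 2) powr (s / Q_dim H) * r powr (Q_dim H - s))"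
  have "(\<integral>\<^sup>+t. (\<Prod>k<Suc n. ennreal (sep H r e a t k powr (- s))) \<partial>(\<Pi>\<^sub>M i\<in>{..<Suc n}. restrict_space lborel S))
     = (\<integral>\<^sup>+t. \<integral>\<^sup>+y. (\<Prod>k<Suc n. ennreal (sep H r e a (t(n := y)) k powr (- s))) \<partial>restrict_space lborel S \<partial>(\<Pi>\<^sub>M i\<in>{..<n}. restrict_space lborel S))"
    unfolding lessThan_Suc
  proof (subst product_nn_integral_insert)
    show "(\<lambda>t. \<Prod>k\<in>insert n {..<n}. ennreal (sep H r e a t k powr (- s))) \<in> borel_measurable (\<Pi>\<^sub>M i\<in>insert n {..<n}. restrict_space lborel S)"
      unfolding lessThan_Suc[symmetric] by (intro borel_measurable_prod_ennreal) auto
  qed auto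
  also have "\<dots> = (\<integral>\<^sup>+t. \<integral>\<^sup>+y. (\<Prod>k<n. ennreal (sep H r e a t k powr (- s))) * ennreal (sep H r e a (t(n := y)) n powr (- s)) \<partial>restrict_space lborel S \<partial>(\<Pi>\<^sub>M i\<in>{..<n}. restrict_space lborel S))"
  proof -
    have "sep H r e a (t(n := y)) k = sep H r e a t k" if "k < n" for t y k
      using that by (intro sep_cong) auto
    then show ?thesis by (intro nn_integral_cong) simp
  qed
  also have "\<dots> \<le> (\<integral>\<^sup>+t. (\<Prod>k<n. ennreal (sep H r e a t k powr (- s))) * ?c n \<partial>(\<Pi>\<^sub>M i\<in>{..<n}. restrict_space lborel S))"
  proof (intro nn_integral_mono)
    fix t assume "t \<in> space (\<Pi>\<^sub>M i\<in>{..<n}. restrict_space lborel S)"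
    define P where "P = cond_point a t ` {..<n + 2}"
    have P: "finite P" "P \<noteq> {}" "card P \<le> n + 2"
      unfolding P_def using card_image_le[of "{..<n+2}" "cond_point a t"] by (auto simp: lessThan_empty_iff)
    have sepP: "sep H r e a (t(n := y)) n = min r (e + (MIN b\<in>P. rho H y b))" for y
    proof -
      have "cond_point a (t(n := y)) i = cond_point a t i" if "i < n + 2" for i
        using that unfolding cond_point_def by auto
      then show ?thesis unfolding sep_def P_def image_image by (simp cong: image_cong_simp)
    qed
    have "(\<integral>\<^sup>+y. (\<Prod>k<n. ennreal (sep H r e a t k powr (- s))) * ennreal (sep H r e a (t(n := y)) n powr (- s)) \<partial>restrict_space lborel S)
       = (\<Prod>k<n. ennreal (sep H r e a t k powr (- s))) * (\<integral>\<^sup>+y. ennreal (min r (e + (MIN b\<in>P. rho H y b)) powr (- s)) \<partial>restrict_space lborel S)"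
      unfolding sepP
    proof (intro nn_integral_cmult)
      have [measurable]: "(\<lambda>y. MIN b\<in>P. rho H y b) \<in> borel_measurable borel"
        using P by (intro borel_measurable_Min) auto
      have "(\<lambda>y. ennreal (min r (e + (MIN b\<in>P. rho H y b)) powr (- s))) \<in> borel_measurable lborel"
        by measurable
      then show "(\<lambda>y. ennreal (min r (e + (MIN b\<in>P. rho H y b)) powr (- s))) \<in> borel_measurable (restrict_space lborel S)"
        by (rule measurable_restrict_space1)
    qed
    also have "\<dots> \<le> (\<Prod>k<n. ennreal (sep H r e a t k powr (- s))) * ?c n"
      using nn_integral_min_rho_powr_le[OF H r e s S cS P] by (intro mult_left_mono) auto
    finally show "(\<integral>\<^sup>+y. (\<Prod>k<n. ennreal (sep H r e a t k powr (- s))) * ennreal (sep H r e a (t(n := y)) n powr (- s)) \<partial>restrict_space lborel S) \<le> \<dots>" .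
  qed
  also have "\<dots> = (\<integral>\<^sup>+t. (\<Prod>k<n. ennreal (sep H r e a t k powr (- s))) \<partial>(\<Pi>\<^sub>M i\<in>{..<n}. restrict_space lborel S)) * ?c n"
    by (intro nn_integral_multc borel_measurable_prod_ennreal) auto
  also have "\<dots> \<le> (\<Prod>k<n. ?c k) * ?c n"
    by (intro mult_right_mono Suc.IH) auto
  finally show ?case by simp
qed

subsection \<open>Fourier bounds for Gaussian densities\<close>

abbreviation std_normal :: "real measure" where "std_normal \<equiv> std_normal_distribution"

lemma prob_space_std_normal: "prob_space std_normal"
  by (rule prob_space_normal_density) simp

lemma nn_integral_PiM_std_normal:
  assumes I: "finite I" and f: "f \<in> borel_measurable (PiM I (\<lambda>_. lborel))"
  shows "(\<integral>\<^sup>+x. f x \<partial>(\<Pi>\<^sub>M i\<in>I. std_normal)) = (\<integral>\<^sup>+x. (\<Prod>i\<in>I. ennreal (std_normal_density (x i))) * f x \<partial>(\<Pi>\<^sub>M i\<in>I. lborel))"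
  using I f
proof (induction I arbitrary: f)
  case empty
  show ?case by (simp add: PiM_empty)
next
  case (insert i I)
  interpret P: product_sigma_finite "\<lambda>_. std_normal"
    by (intro product_sigma_finite.intro prob_space_imp_sigma_finite prob_space_std_normal)
  interpret L: product_sigma_finite "\<lambda>_::'a. lborel :: real measure" ..
  note [measurable] = insert.prems
  have S: "sets (PiM J (\<lambda>_. std_normal)) = sets (PiM J (\<lambda>_. lborel :: real measure))" for J :: "'a set"
    by (intro sets_PiM_cong) auto
  have fm: "f \<in> borel_measurable (PiM (insert i I) (\<lambda>_. std_normal))"
    using insert.prems by (simp cong: measurable_cong_sets add: S)
  have fupd: "(\<lambda>y. f (x(i := y))) \<in> borel_measurable lborel" if "x \<in> space (PiM I (\<lambda>_. lborel :: real measure))" for x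
    using measurable_comp[OF measurable_component_update insert.prems, OF that insert.hyps(2)] unfolding comp_def .
  have "(\<integral>\<^sup>+x. f x \<partial>(\<Pi>\<^sub>M i\<in>insert i I. std_normal)) = (\<integral>\<^sup>+x. \<integral>\<^sup>+y. f (x(i := y)) \<partial>std_normal \<partial>(\<Pi>\<^sub>M i\<in>I. std_normal))"
    by (rule P.product_nn_integral_insert[OF insert.hyps fm])
  also have "\<dots> = (\<integral>\<^sup>+x. \<integral>\<^sup>+y. ennreal (std_normal_density y) * f (x(i := y)) \<partial>lborel \<partial>(\<Pi>\<^sub>M i\<in>I. std_normal))"
    by (intro nn_integral_cong nn_integral_density fupd) (auto simp: space_PiM)
  also have "\<dots> = (\<integral>\<^sup>+x. (\<Prod>i\<in>I. ennreal (std_normal_density (x i))) * (\<integral>\<^sup>+y. ennreal (std_normal_density y) * f (x(i := y)) \<partial>lborel) \<partial>(\<Pi>\<^sub>M i\<in>I. lborel))"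
  proof (rule insert.IH)
    have "(\<lambda>(x, y). f (x(i := y))) \<in> borel_measurable (PiM I (\<lambda>_. lborel) \<Otimes>\<^sub>M lborel)"
      using measurable_compose[OF measurable_add_dim insert.prems] by (simp add: split_beta')
    then have [measurable]: "(\<lambda>z. f ((fst z)(i := snd z))) \<in> borel_measurable (PiM I (\<lambda>_. lborel) \<Otimes>\<^sub>M lborel)"
      by (simp add: split_beta')
    show "(\<lambda>x. \<integral>\<^sup>+y. ennreal (std_normal_density y) * f (x(i := y)) \<partial>lborel) \<in> borel_measurable (PiM I (\<lambda>_. lborel))"
      by (rule lborel.borel_measurable_nn_integral) (simp add: split_beta')
  qed
  also have "\<dots> = (\<integral>\<^sup>+x. \<integral>\<^sup>+y. (\<Prod>j\<in>insert i I. ennreal (std_normal_density ((x(i := y)) j))) * f (x(i := y)) \<partial>lborel \<partial>(\<Pi>\<^sub>M i\<in>I. lborel))"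
  proof (intro nn_integral_cong)
    fix x assume x: "x \<in> space (\<Pi>\<^sub>M i\<in>I. lborel :: real measure)"
    have "(\<Prod>j\<in>insert i I. ennreal (std_normal_density ((x(i := y)) j))) = (\<Prod>j\<in>I. ennreal (std_normal_density (x j))) * ennreal (std_normal_density y)" for y
    proof -
      have "(\<Prod>j\<in>I. ennreal (std_normal_density ((x(i := y)) j))) = (\<Prod>j\<in>I. ennreal (std_normal_density (x j)))"
        using insert.hyps by (intro prod.cong) auto
      then show ?thesis using insert.hyps by (simp add: mult.commute)
    qed
    then show "(\<Prod>i\<in>I. ennreal (std_normal_density (x i))) * (\<integral>\<^sup>+y. ennreal (std_normal_density y) * f (x(i := y)) \<partial>lborel)
      = (\<integral>\<^sup>+y. (\<Prod>j\<in>insert i I. ennreal (std_normal_density ((x(i := y)) j))) * f (x(i := y)) \<partial>lborel)"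
      using fupd[OF x] by (subst nn_integral_cmult[symmetric]) (auto simp: mult.assoc)
  qed
  also have "\<dots> = (\<integral>\<^sup>+x. (\<Prod>j\<in>insert i I. ennreal (std_normal_density (x j))) * f x \<partial>(\<Pi>\<^sub>M i\<in>insert i I. lborel))"
    by (rule L.product_nn_integral_insert[symmetric, OF insert.hyps]) (use insert.hyps in measurable)
  finally show ?case .
qed

lemma integrable_std_normal_bounded:
  fixes f :: "real \<Rightarrow> complex"
  assumes "f \<in> borel_measurable borel" "\<And>x. norm (f x) \<le> B"
  shows "integrable std_normal f"
proof -
  interpret prob_space std_normal by (rule prob_space_std_normal)
  show ?thesis using assms by (intro integrable_const_bound[where B=B]) auto
qed

text \<open>Writing each factor as a Fourier integral against the standard normal law turns the
  expectation into an integral of characteristic functions of the Gaussian vector.\<close>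

lemma gaussian_product_le:
  fixes V :: "nat \<Rightarrow> 'v \<Rightarrow> real" and c :: "nat \<Rightarrow> real \<Rightarrow> complex"
  assumes "prob_space P" and G: "\<And>a. centered_gaussian P (\<lambda>w. \<Sum>j<n. a j * V j w)"
    and Vm [measurable]: "\<And>j. V j \<in> borel_measurable P"
    and cm [measurable]: "\<And>j. c j \<in> borel_measurable borel" and B: "\<And>j x. norm (c j x) \<le> B"
  shows "ennreal (norm (\<integral>w. (\<Prod>j<n. \<integral>x. iexp (V j w * x / e) * c j x \<partial>std_normal) \<partial>P))
    \<le> (\<integral>\<^sup>+x. (\<Prod>j<n. ennreal (norm (c j (x j)))) * ennreal (exp (- ((\<integral>w. (\<Sum>j<n. x j * V j w)\<^sup>2 \<partial>P) / e\<^sup>2) / 2)) \<partial>(\<Pi>\<^sub>M i\<in>{..<n}. std_normal))"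
proof -
  interpret P: prob_space P by fact
  interpret N: product_prob_space "\<lambda>_::nat. std_normal"
    by (rule product_prob_spaceI) (rule prob_space_std_normal)
  interpret NN: prob_space "\<Pi>\<^sub>M i\<in>{..<n}. std_normal"
    by (rule prob_space_PiM) (rule prob_space_std_normal)
  interpret PN: pair_prob_space P "\<Pi>\<^sub>M i\<in>{..<n}. std_normal" ..
  let ?N = "\<Pi>\<^sub>M i\<in>{..<n}. std_normal"
  have bnd1: "norm (iexp (v * x / e) * c j x) \<le> B" for v x j
    using B[of j x] by (simp add: norm_mult)
  have comp [measurable]: "(\<lambda>x. x j) \<in> borel_measurable ?N" if "j < n" for j
    using measurable_component_singleton[of j "{..<n}" "\<lambda>_. std_normal"] that by simp
  have int1: "integrable std_normal (\<lambda>x. iexp (v * x / e) * c j x)" for v j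
    by (rule integrable_std_normal_bounded[OF _ bnd1]) measurable
  let ?F = "\<lambda>w x. \<Prod>j<n. iexp (V j w * x j / e) * c j (x j)"
  have prod: "(\<Prod>j<n. \<integral>x. iexp (V j w * x / e) * c j x \<partial>std_normal) = (\<integral>x. ?F w x \<partial>?N)" for w
    by (rule N.product_integral_prod[symmetric]) (rule finite_lessThan, rule int1)
  have Fm: "(\<lambda>(w, x). ?F w x) \<in> borel_measurable (P \<Otimes>\<^sub>M ?N)"
    unfolding split_beta'
  proof (intro borel_measurable_prod)
    fix j assume "j \<in> {..<n}"
    then have [measurable]: "(\<lambda>z. snd z j) \<in> borel_measurable (P \<Otimes>\<^sub>M ?N)"
      using measurable_compose[OF measurable_snd comp] by auto
    show "(\<lambda>z. iexp (V j (fst z) * snd z j / e) * c j (snd z j)) \<in> borel_measurable (P \<Otimes>\<^sub>M ?N)"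
      by measurable
  qed
  have B0: "0 \<le> B" using B[of 0 0] norm_ge_zero order_trans by blast
  have FB: "norm (?F w x) \<le> B ^ n" for w x
  proof -
    have "norm (?F w x) \<le> (\<Prod>j<n. B)" unfolding prod_norm[symmetric]
      by (intro prod_mono conjI bnd1) auto
    then show ?thesis by simp
  qed
  have intF: "integrable (P \<Otimes>\<^sub>M ?N) (\<lambda>(w, x). ?F w x)"
  proof (rule PN.integrable_const_bound[where B="B ^ n", OF _ Fm])
    show "AE z in P \<Otimes>\<^sub>M ?N. norm (case z of (w, x) \<Rightarrow> ?F w x) \<le> B ^ n"
      unfolding split_beta' by (intro AE_I2 FB)
  qed
  have inner: "(\<integral>w. ?F w x \<partial>P) = (\<Prod>j<n. c j (x j)) * of_real (exp (- ((\<integral>w. (\<Sum>j<n. x j * V j w)\<^sup>2 \<partial>P) / e\<^sup>2) / 2))" for x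
  proof -
    have "(\<integral>w. ?F w x \<partial>P) = (\<integral>w. iexp (\<Sum>j<n. x j / e * V j w) * (\<Prod>j<n. c j (x j)) \<partial>P)"
      by (intro Bochner_Integration.integral_cong refl)
        (simp add: prod.distrib exp_sum[symmetric] sum_distrib_left of_real_sum mult_ac)
    also have "\<dots> = (\<integral>w. iexp (\<Sum>j<n. x j / e * V j w) \<partial>P) * (\<Prod>j<n. c j (x j))"
      by simp
    also have "(\<integral>w. iexp (\<Sum>j<n. x j / e * V j w) \<partial>P) = of_real (exp (- (\<integral>w. (\<Sum>j<n. x j / e * V j w)\<^sup>2 \<partial>P) / 2))"
      by (rule centered_gaussian_char(1)[OF \<open>prob_space P\<close> G])
    also have "(\<integral>w. (\<Sum>j<n. x j / e * V j w)\<^sup>2 \<partial>P) = (\<integral>w. (\<Sum>j<n. x j * V j w)\<^sup>2 / e\<^sup>2 \<partial>P)"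
      by (intro Bochner_Integration.integral_cong refl) (simp add: sum_divide_distrib[symmetric] power_divide)
    finally show ?thesis by simp
  qed
  have "(\<integral>w. (\<Prod>j<n. \<integral>x. iexp (V j w * x / e) * c j x \<partial>std_normal) \<partial>P) = (\<integral>x. (\<integral>w. ?F w x \<partial>P) \<partial>?N)"
    unfolding prod by (rule PN.Fubini_integral[symmetric, OF intF])
  also have "ennreal (norm \<dots>) \<le> (\<integral>\<^sup>+x. norm (\<integral>w. ?F w x \<partial>P) \<partial>?N)"
    by (rule integral_norm_bound_ennreal) (rule PN.integrable_snd[OF intF])
  also have "\<dots> = (\<integral>\<^sup>+x. (\<Prod>j<n. ennreal (norm (c j (x j)))) * ennreal (exp (- ((\<integral>w. (\<Sum>j<n. x j * V j w)\<^sup>2 \<partial>P) / e\<^sup>2) / 2)) \<partial>?N)"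
    unfolding inner by (simp add: norm_mult prod_norm[symmetric] ennreal_mult prod_ennreal prod_nonneg)
  finally show ?thesis .
qed

text \<open>The Gaussian is its own Fourier transform up to scaling. The standard normal law serves
  as the weight, so that every Fourier integral is over a probability measure.\<close>

lemma normal_density_fourier:
  assumes "e > 0"
  shows "complex_of_real (normal_density 0 e z) = of_real (1 / (e * sqrt (2 * pi))) * (\<integral>x. iexp (z * x / e) \<partial>std_normal)"
proof -
  have "(\<integral>x. iexp (z * x / e) \<partial>std_normal) = char std_normal (z / e)"
    unfolding char_def by (intro Bochner_Integration.integral_cong refl) simp
  also have "\<dots> = of_real (exp (- ((z / e)\<^sup>2) / 2))" by (simp only: char_std_normal_distribution)
  finally show ?thesis
    by (simp only:) (simp add: normal_density_def real_sqrt_mult power_divide mult.commute assms less_imp_le)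
qed

section \<open>Smoothed densities of a Gaussian vector with variances bounded below\<close>

context
  fixes P :: "'v measure" and V :: "nat \<Rightarrow> 'v \<Rightarrow> real" and n :: nat and e :: real and v :: "nat \<Rightarrow> real"
  assumes P: "prob_space P" and G: "\<And>a. centered_gaussian P (\<lambda>w. \<Sum>j<n. a j * V j w)"
    and Vm [measurable]: "\<And>j. V j \<in> borel_measurable P"
    and V2: "\<And>j. integrable P (\<lambda>w. (V j w)\<^sup>2)"
    and e: "e > 0"
    and v0: "\<And>k. k < n \<Longrightarrow> 0 \<le> v k"
    and lb: "\<And>k b. k < n \<Longrightarrow> v k \<le> (\<integral>w. (V k w + (\<Sum>i<k. b i * V i w))\<^sup>2 \<partial>P)"
begin

text \<open>Minus twice the exponent that results when the characteristic function of V at x/e is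
  multiplied by the standard normal densities: the covariance form scaled by 1/e^2, plus the
  identity.\<close>

definition quad :: "(nat \<Rightarrow> real) \<Rightarrow> real" where
  "quad x = (\<integral>w. (\<Sum>j<n. x j * V j w)\<^sup>2 \<partial>P) / e\<^sup>2 + (\<Sum>j<n. (x j)\<^sup>2)"

definition gram :: "nat \<Rightarrow> nat \<Rightarrow> real" where
  "gram i j = (\<integral>w. V i w * V j w \<partial>P) / e\<^sup>2 + (if i = j then 1 else 0)"

lemma quad_eq: "quad x = (\<Sum>i\<in>{0..<n}. \<Sum>j\<in>{0..<n}. gram i j * x i * x j)"
proof -
  have [simp]: "integrable P (\<lambda>w. V i w * V j w)" for i j
    by (intro integrable_mult_of_square_integrable V2) auto
  have "(\<integral>w. (\<Sum>j<n. x j * V j w)\<^sup>2 \<partial>P) = (\<integral>w. (\<Sum>i<n. \<Sum>j<n. x i * x j * (V i w * V j w)) \<partial>P)"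
    unfolding power2_eq_square sum_product by (intro Bochner_Integration.integral_cong refl sum.cong) simp
  also have "\<dots> = (\<Sum>i<n. \<Sum>j<n. x i * x j * (\<integral>w. V i w * V j w \<partial>P))"
    by (subst Bochner_Integration.integral_sum; (intro Bochner_Integration.integrable_sum)?; simp)+
  finally have 1: "(\<integral>w. (\<Sum>j<n. x j * V j w)\<^sup>2 \<partial>P) = (\<Sum>i<n. \<Sum>j<n. x i * x j * (\<integral>w. V i w * V j w \<partial>P))" .
  have 2: "(\<Sum>j<n. (x j)\<^sup>2) = (\<Sum>i<n. \<Sum>j<n. (if i = j then 1 else 0) * x i * x j)"
    by (intro sum.cong refl) (simp add: sum.delta power2_eq_square if_distrib[where f="\<lambda>c. c * _"] cong: if_cong)
  show ?thesis
    unfolding quad_def 1 2 gram_def sum_divide_distrib atLeast0LessThan sum.distrib[symmetric]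
    by (intro sum.cong refl) (simp add: field_simps)
qed

lemma quad_scale: "quad (\<lambda>j. s * x j) = s\<^sup>2 * quad x"
  unfolding quad_eq sum_distrib_left by (intro sum.cong refl) (simp add: power2_eq_square)

lemma quad_ge_last:
  assumes k: "k < n" and x: "x k = 1" "\<And>j. j > k \<Longrightarrow> x j = 0"
  shows "v k / e\<^sup>2 + 1 \<le> quad x"
proof -
  have spl: "{..<n} = insert k {..<k} \<union> {Suc k..<n}" using k by auto
  have "(\<Sum>j<n. x j * V j w) = V k w + (\<Sum>i<k. x i * V i w)" for w
    unfolding spl using x by (subst sum.union_disjoint) auto
  then have "v k \<le> (\<integral>w. (\<Sum>j<n. x j * V j w)\<^sup>2 \<partial>P)" using lb[OF k, of x] by simp
  moreover have "1 \<le> (\<Sum>j<n. (x j)\<^sup>2)"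
    using member_le_sum[of k "{..<n}" "\<lambda>j. (x j)\<^sup>2"] k x by simp
  ultimately show ?thesis unfolding quad_def using e by (intro add_mono divide_right_mono) auto
qed

lemma nn_integral_exp_quad:
  assumes s: "s > 0"
  shows "(\<integral>\<^sup>+x. ennreal (exp (- (s * quad x) / 2)) \<partial>(\<Pi>\<^sub>M i\<in>{..<n}. lborel))
    \<le> ennreal (\<Prod>k<n. sqrt (2 * pi / (s * (v k / e\<^sup>2 + 1))))"
proof -
  have "(\<integral>\<^sup>+x. ennreal (exp (- (\<Sum>i\<in>{0..<n}. \<Sum>j\<in>{0..<n}. (s * gram i j) * x i * x j) / 2)) \<partial>(\<Pi>\<^sub>M i\<in>{0..<n}. lborel))
    \<le> ennreal (\<Prod>k\<in>{0..<n}. sqrt (2 * pi / (s * (v k / e\<^sup>2 + 1))))"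
  proof (rule nn_integral_exp_quadratic_form)
    show "s * gram i j = s * gram j i" for i j unfolding gram_def by (simp add: mult.commute)
    show "0 < s * (v k / e\<^sup>2 + 1)" if "k \<in> {0..<n}" for k
      using v0[of k] that s e by (intro mult_pos_pos add_nonneg_pos) auto
    show "s * (v k / e\<^sup>2 + 1) \<le> (\<Sum>i\<in>{0..<n}. \<Sum>j\<in>{0..<n}. s * gram i j * u i * u j)"
      if "k \<in> {0..<n}" "u k = 1" "\<And>j. k < j \<Longrightarrow> u j = 0" for k u
    proof -
      have "s * (v k / e\<^sup>2 + 1) \<le> s * quad u" using quad_ge_last[of k u] that s by (intro mult_left_mono) auto
      then show ?thesis unfolding quad_eq by (simp add: sum_distrib_left mult.assoc)
    qed
  qed simp
  then show ?thesis unfolding quad_eq by (simp add: sum_distrib_left mult.assoc atLeast0LessThan)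
qed

lemma quad_measurable [measurable]: "quad \<in> borel_measurable (\<Pi>\<^sub>M i\<in>{..<n}. lborel)"
  unfolding quad_eq[abs_def] atLeast0LessThan by measurable

lemma prod_std_normal_density:
  "(\<Prod>i<n. ennreal (std_normal_density (x i))) * ennreal (exp (- ((\<integral>w. (\<Sum>j<n. x j * V j w)\<^sup>2 \<partial>P) / e\<^sup>2) / 2))
    = ennreal ((1 / sqrt (2 * pi)) ^ n) * ennreal (exp (- quad x / 2))"
proof -
  have "(\<Prod>i<n. std_normal_density (x i)) = (1 / sqrt (2 * pi)) ^ n * exp (- (\<Sum>j<n. (x j)\<^sup>2) / 2)"
    by (simp add: std_normal_density_def prod.distrib exp_sum[symmetric] sum_negf sum_divide_distrib prod_dividef power_one_over)
  then have "(\<Prod>i<n. std_normal_density (x i)) * exp (- ((\<integral>w. (\<Sum>j<n. x j * V j w)\<^sup>2 \<partial>P) / e\<^sup>2) / 2)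
      = (1 / sqrt (2 * pi)) ^ n * exp (- quad x / 2)"
    unfolding quad_def by (simp add: exp_add[symmetric] add_divide_distrib diff_divide_distrib mult.assoc)
  then show ?thesis
    by (simp add: prod_ennreal ennreal_mult'[symmetric] prod_nonneg)
qed

text \<open>Collects what belongs to one coordinate: the Fourier prefactor, the constant of the
  standard normal density and one factor of the Gaussian integral. The powers of e cancel except for
  the e^2 added to the variance. The number s is the fraction of the quadratic form left for
  integration, 1 or 1/2 below.\<close>

lemma gauss_factor:
  assumes "k < n" "s > 0"
  shows "1 / (e * sqrt (2 * pi)) * (1 / sqrt (2 * pi)) * sqrt (2 * pi / (s * (v k / e\<^sup>2 + 1)))
    \<le> 1 / sqrt s * (v k + e\<^sup>2) powr (- (1/2))"
proof -
  have p: "0 < v k + e\<^sup>2" using v0[OF assms(1)] e by (intro add_nonneg_pos) auto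
  have "v k / e\<^sup>2 + 1 = (v k + e\<^sup>2) / e\<^sup>2" using e by (simp add: field_simps)
  then have "sqrt (2 * pi / (s * (v k / e\<^sup>2 + 1))) = sqrt (2 * pi) * e / (sqrt s * sqrt (v k + e\<^sup>2))"
    using e by (simp add: real_sqrt_divide real_sqrt_mult)
  then have "1 / (e * sqrt (2 * pi)) * (1 / sqrt (2 * pi)) * sqrt (2 * pi / (s * (v k / e\<^sup>2 + 1)))
     = (1 / sqrt (2 * pi)) * (1 / sqrt s * (1 / sqrt (v k + e\<^sup>2)))"
    using e pi_gt_zero by simp
  also have "\<dots> \<le> 1 * (1 / sqrt s * (1 / sqrt (v k + e\<^sup>2)))"
    using p assms pi_gt3 by (intro mult_right_mono) (auto simp: divide_le_eq)
  finally show ?thesis using p by (simp add: powr_minus_divide powr_half_sqrt)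
qed

text \<open>The expectation is the density of V plus independent Gaussian noise of standard
  deviation e, at the point with all coordinates y. The Fourier weights have modulus 1, so y drops
  out of the bound.\<close>

lemma gaussian_density_product_le:
  "\<bar>\<integral>w. (\<Prod>j<n. normal_density 0 e (V j w - y)) \<partial>P\<bar> \<le> (\<Prod>k<n. (v k + e\<^sup>2) powr (- (1/2)))"
proof -
  define c where "c = (\<lambda>(j::nat) x. iexp (- y * x / e))"
  let ?A = "1 / (e * sqrt (2 * pi))"
  have fac: "complex_of_real (normal_density 0 e (V j w - y)) = of_real ?A * (\<integral>x. iexp (V j w * x / e) * c j x \<partial>std_normal)" for j w
  proof -
    have "iexp ((V j w - y) * x / e) = iexp (V j w * x / e) * c j x" for x
      unfolding c_def exp_add[symmetric] by (simp add: algebra_simps diff_divide_distrib)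
    then show ?thesis using normal_density_fourier[OF e, of "V j w - y"] by simp
  qed
  have "complex_of_real (\<integral>w. (\<Prod>j<n. normal_density 0 e (V j w - y)) \<partial>P) = of_real (?A ^ n) * (\<integral>w. (\<Prod>j<n. \<integral>x. iexp (V j w * x / e) * c j x \<partial>std_normal) \<partial>P)"
    unfolding integral_complex_of_real[symmetric] of_real_prod fac
    by (simp only: prod.distrib prod_constant card_lessThan of_real_power integral_mult_right_zero)
  then have "\<bar>\<integral>w. (\<Prod>j<n. normal_density 0 e (V j w - y)) \<partial>P\<bar> = ?A ^ n * norm (\<integral>w. (\<Prod>j<n. \<integral>x. iexp (V j w * x / e) * c j x \<partial>std_normal) \<partial>P)"
    by (metis (no_types, lifting) abs_of_nonneg norm_mult norm_of_real e less_eq_real_def divide_nonneg_nonneg mult_nonneg_nonneg real_sqrt_ge_zero zero_le_power zero_le_one pi_ge_zero zero_le_numeral)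
  then have "ennreal \<bar>\<integral>w. (\<Prod>j<n. normal_density 0 e (V j w - y)) \<partial>P\<bar> = ennreal (?A ^ n) * ennreal (norm (\<integral>w. (\<Prod>j<n. \<integral>x. iexp (V j w * x / e) * c j x \<partial>std_normal) \<partial>P))"
    using e by (simp add: ennreal_mult)
  also have "\<dots> \<le> ennreal (?A ^ n) * (\<integral>\<^sup>+x. (\<Prod>j<n. ennreal (norm (c j (x j)))) * ennreal (exp (- ((\<integral>w. (\<Sum>j<n. x j * V j w)\<^sup>2 \<partial>P) / e\<^sup>2) / 2)) \<partial>(\<Pi>\<^sub>M i\<in>{..<n}. std_normal))"
    by (intro mult_left_mono gaussian_product_le[OF P G Vm, where B=1]) (auto simp: c_def)
  also have "\<dots> = ennreal (?A ^ n) * (\<integral>\<^sup>+x. ennreal (exp (- ((\<integral>w. (\<Sum>j<n. x j * V j w)\<^sup>2 \<partial>P) / e\<^sup>2) / 2)) \<partial>(\<Pi>\<^sub>M i\<in>{..<n}. std_normal))"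
    by (simp add: c_def)
  also have "\<dots> = ennreal (?A ^ n) * (\<integral>\<^sup>+x. ennreal ((1 / sqrt (2 * pi)) ^ n) * ennreal (exp (- quad x / 2)) \<partial>(\<Pi>\<^sub>M i\<in>{..<n}. lborel))"
  proof -
    have "(\<lambda>x. (\<integral>w. (\<Sum>j<n. x j * V j w)\<^sup>2 \<partial>P) / e\<^sup>2) = (\<lambda>x. quad x - (\<Sum>j<n. (x j)\<^sup>2))"
      by (simp add: quad_def)
    then have "(\<lambda>x. (\<integral>w. (\<Sum>j<n. x j * V j w)\<^sup>2 \<partial>P) / e\<^sup>2) \<in> borel_measurable (\<Pi>\<^sub>M i\<in>{..<n}. lborel)"
      by (simp only:) measurable
    then have "(\<lambda>x. ennreal (exp (- ((\<integral>w. (\<Sum>j<n. x j * V j w)\<^sup>2 \<partial>P) / e\<^sup>2) / 2))) \<in> borel_measurable (\<Pi>\<^sub>M i\<in>{..<n}. lborel)"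
      by measurable
    from nn_integral_PiM_std_normal[OF finite_lessThan this] show ?thesis by (simp only: prod_std_normal_density)
  qed
  also have "\<dots> = ennreal (?A ^ n) * (ennreal ((1 / sqrt (2 * pi)) ^ n) * (\<integral>\<^sup>+x. ennreal (exp (- (1 * quad x) / 2)) \<partial>(\<Pi>\<^sub>M i\<in>{..<n}. lborel)))"
    by (subst nn_integral_cmult) auto
  also have "\<dots> \<le> ennreal (?A ^ n) * (ennreal ((1 / sqrt (2 * pi)) ^ n) * ennreal (\<Prod>k<n. sqrt (2 * pi / (1 * (v k / e\<^sup>2 + 1)))))"
    by (intro mult_left_mono nn_integral_exp_quad) auto
  also have "\<dots> = ennreal (\<Prod>k<n. ?A * (1 / sqrt (2 * pi)) * sqrt (2 * pi / (1 * (v k / e\<^sup>2 + 1))))"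
    using e v0 unfolding prod.distrib by (simp add: ennreal_mult'[symmetric] mult.assoc prod_nonneg)
  also have "\<dots> \<le> ennreal (\<Prod>k<n. (v k + e\<^sup>2) powr (- (1/2)))"
  proof (intro ennreal_leI prod_mono conjI)
    fix k assume "k \<in> {..<n}"
    then show "?A * (1 / sqrt (2 * pi)) * sqrt (2 * pi / (1 * (v k / e\<^sup>2 + 1))) \<le> (v k + e\<^sup>2) powr (- (1/2))"
      using gauss_factor[of k 1] by simp
    show "0 \<le> ?A * (1 / sqrt (2 * pi)) * sqrt (2 * pi / (1 * (v k / e\<^sup>2 + 1)))"
      using e v0[of k] \<open>k \<in> {..<n}\<close> by (intro mult_nonneg_nonneg) auto
  qed
  finally show ?thesis by (subst (asm) ennreal_le_iff) (auto intro!: prod_nonneg)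
qed

text \<open>With y = sqrt W |z| the claim becomes y^g \<le> 4 N exp(y^2 / (4 N)), which follows from
  y^g \<le> 1 + y^2. The weight 1/(4 N) is the share of one variable when a quarter of the quadratic
  form is spread over N variables.\<close>

lemma abs_powr_mult_exp_le:
  fixes z :: real
  assumes "0 < g" "g \<le> 1" "W > 0" "N \<ge> 1"
  shows "\<bar>z\<bar> powr g * exp (- (W * z\<^sup>2) / (4 * N)) \<le> 4 * N * W powr (- (g / 2))"
proof -
  define y where "y = sqrt W * \<bar>z\<bar>"
  have y: "0 \<le> y" "y\<^sup>2 = W * z\<^sup>2" unfolding y_def using assms by (auto simp: power_mult_distrib)
  have "y powr g \<le> 1 + y\<^sup>2"
  proof (cases "y \<le> 1")
    case True
    then have "y powr g \<le> 1" using y assms powr_mono2[of g y 1] by simp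
    then show ?thesis using y by (smt (verit) zero_le_power2)
  next
    case False
    then have "y powr g \<le> y powr 2" using assms by (intro powr_mono) auto
    then show ?thesis using y False by simp
  qed
  also have "\<dots> \<le> 4 * N * (1 + y\<^sup>2 / (4 * N))" using assms by (simp add: distrib_left)
  also have "\<dots> \<le> 4 * N * exp (y\<^sup>2 / (4 * N))" using assms by (intro mult_left_mono exp_ge_add_one_self) auto
  finally have "y powr g * exp (- (y\<^sup>2 / (4 * N))) \<le> 4 * N * exp (y\<^sup>2 / (4 * N)) * exp (- (y\<^sup>2 / (4 * N)))"
    by (rule mult_right_mono) simp
  also have "\<dots> = 4 * N" by (simp only: mult.assoc exp_add[symmetric]) simp
  finally have "y powr g * exp (- (W * z\<^sup>2) / (4 * N)) \<le> 4 * N"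
    unfolding y(2) by simp
  then have "W powr (- (g / 2)) * (y powr g * exp (- (W * z\<^sup>2) / (4 * N))) \<le> W powr (- (g / 2)) * (4 * N)"
    by (rule mult_left_mono) simp
  moreover have "y powr g = W powr (g / 2) * \<bar>z\<bar> powr g"
    unfolding y_def using assms by (simp add: powr_mult powr_half_sqrt[symmetric] powr_powr)
  moreover have "W powr (- (g / 2)) * W powr (g / 2) = 1" using assms by (simp add: powr_add[symmetric])
  ultimately show ?thesis by (simp add: mult.assoc[symmetric]) (simp add: mult_ac)
qed

text \<open>Interpolation between the Lipschitz bound |a - b| and the trivial bound 2, according to
  whether |a - b| exceeds 1.\<close>

lemma norm_iexp_diff_le:
  assumes "0 < g" "g \<le> 1"
  shows "norm (iexp a - iexp b) \<le> 2 * \<bar>a - b\<bar> powr g"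
proof (cases "\<bar>a - b\<bar> \<le> 1")
  case True
  have "iexp a - iexp b = iexp b * (iexp (a - b) - 1)"
    by (simp add: algebra_simps exp_diff)
  then have "norm (iexp a - iexp b) = norm (iexp (a - b) - 1)" by (simp add: norm_mult)
  also have "\<dots> \<le> \<bar>a - b\<bar>" using iexp_approx1[of "a - b" 0] by simp
  also have "\<dots> \<le> \<bar>a - b\<bar> powr g"
    using True assms powr_mono'[of g 1 "\<bar>a - b\<bar>"] by (cases "a = b") auto
  finally show ?thesis by (smt (verit) powr_ge_zero)
next
  case False
  have "norm (iexp a - iexp b) \<le> norm (iexp a) + norm (iexp b)" by (rule norm_triangle_ineq4)
  also have "\<dots> \<le> 2 * 1" by simp
  also have "\<dots> \<le> 2 * \<bar>a - b\<bar> powr g" using False assms by (intro mult_left_mono ge_one_powr_ge_zero) auto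
  finally show ?thesis .
qed

text \<open>Each factor contributes a power |x_j|^g. Half of the exponent is kept for the Gaussian
  integral and the other half absorbs these powers. For this the form must dominate each single
  x_j^2 with the other coordinates arbitrary: \<open>w\<close> bounds the variance of one value
  given all the others, later ones included, whereas \<open>v\<close> looks at earlier ones
  only.\<close>

lemma gaussian_density_difference_product_le:
  assumes g: "0 < g" "g \<le> 1" and n1: "n \<ge> 1" and w0: "\<And>k. k < n \<Longrightarrow> 0 \<le> w k"
    and lb2: "\<And>k b. k < n \<Longrightarrow> b k = 1 \<Longrightarrow> w k \<le> (\<integral>x. (\<Sum>i<n. b i * V i x)\<^sup>2 \<partial>P)"
  shows "\<bar>\<integral>x. (\<Prod>j<n. normal_density 0 e (V j x - y) - normal_density 0 e (V j x - z)) \<partial>P\<bar>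
    \<le> (\<Prod>k<n. 16 * real n * \<bar>y - z\<bar> powr g * (w k + e\<^sup>2) powr (- (g / 2)) * (v k + e\<^sup>2) powr (- (1/2)))"
proof -
  define c where "c = (\<lambda>(j::nat) x. iexp (- y * x / e) - iexp (- z * x / e))"
  let ?A = "1 / (e * sqrt (2 * pi))"
  define D where "D = 2 * (\<bar>y - z\<bar> / e) powr g"
  define W where "W = (\<lambda>k. w k / e\<^sup>2 + 1)"
  have W: "W k > 0" if "k < n" for k unfolding W_def using w0[OF that] e by (intro add_nonneg_pos) auto
  have D0: "0 \<le> D" unfolding D_def by simp
  have cb: "norm (c j x) \<le> D * \<bar>x\<bar> powr g" for j x
  proof -
    have "norm (c j x) \<le> 2 * \<bar>- y * x / e - (- z * x / e)\<bar> powr g"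
      unfolding c_def by (rule norm_iexp_diff_le[OF g])
    also have "\<bar>- y * x / e - (- z * x / e)\<bar> = (\<bar>y - z\<bar> / e) * \<bar>x\<bar>"
    proof -
      have "- y * x / e - (- z * x / e) = - ((y - z) / e * x)" by (simp add: algebra_simps diff_divide_distrib)
      then show ?thesis using e by (simp only: abs_minus_cancel abs_mult abs_divide abs_of_pos)
    qed
    also have "((\<bar>y - z\<bar> / e) * \<bar>x\<bar>) powr g = (\<bar>y - z\<bar> / e) powr g * \<bar>x\<bar> powr g"
      by (rule powr_mult)
    finally show ?thesis unfolding D_def by (simp only: mult.assoc)
  qed
  have fac: "complex_of_real (normal_density 0 e (V j w - y) - normal_density 0 e (V j w - z)) = of_real ?A * (\<integral>x. iexp (V j w * x / e) * c j x \<partial>std_normal)" for j w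
  proof -
    have i: "integrable std_normal (\<lambda>x. iexp (V j w * x / e) * iexp (- a * x / e))" for a
      by (rule integrable_std_normal_bounded[where B=1]) (auto simp: norm_mult)
    have "iexp ((V j w - a) * x / e) = iexp (V j w * x / e) * iexp (- a * x / e)" for x a
      unfolding exp_add[symmetric] by (simp add: algebra_simps diff_divide_distrib)
    then have *: "complex_of_real (normal_density 0 e (V j w - a)) = of_real ?A * (\<integral>x. iexp (V j w * x / e) * iexp (- a * x / e) \<partial>std_normal)" for a
      using normal_density_fourier[OF e, of "V j w - a"] by simp
    show ?thesis unfolding of_real_diff * c_def right_diff_distrib
      by (subst Bochner_Integration.integral_diff[OF i i]) (simp add: right_diff_distrib)
  qed
  let ?I = "\<integral>x. (\<Prod>j<n. normal_density 0 e (V j x - y) - normal_density 0 e (V j x - z)) \<partial>P"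
  have "complex_of_real ?I = of_real (?A ^ n) * (\<integral>w. (\<Prod>j<n. \<integral>x. iexp (V j w * x / e) * c j x \<partial>std_normal) \<partial>P)"
    unfolding integral_complex_of_real[symmetric] of_real_prod fac
    by (simp only: prod.distrib prod_constant card_lessThan of_real_power integral_mult_right_zero)
  then have "\<bar>?I\<bar> = ?A ^ n * norm (\<integral>w. (\<Prod>j<n. \<integral>x. iexp (V j w * x / e) * c j x \<partial>std_normal) \<partial>P)"
    by (metis (no_types, lifting) abs_of_nonneg norm_mult norm_of_real e less_eq_real_def divide_nonneg_nonneg mult_nonneg_nonneg real_sqrt_ge_zero zero_le_power zero_le_one pi_ge_zero zero_le_numeral)
  then have "ennreal \<bar>?I\<bar> = ennreal (?A ^ n) * ennreal (norm (\<integral>w. (\<Prod>j<n. \<integral>x. iexp (V j w * x / e) * c j x \<partial>std_normal) \<partial>P))"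
    using e by (simp add: ennreal_mult)
  also have "\<dots> \<le> ennreal (?A ^ n) * (\<integral>\<^sup>+x. (\<Prod>j<n. ennreal (norm (c j (x j)))) * ennreal (exp (- ((\<integral>w. (\<Sum>j<n. x j * V j w)\<^sup>2 \<partial>P) / e\<^sup>2) / 2)) \<partial>(\<Pi>\<^sub>M i\<in>{..<n}. std_normal))"
  proof (intro mult_left_mono gaussian_product_le[OF P G Vm, where B=2])
    show "norm (c j x) \<le> 2" for j x
      unfolding c_def by (rule order_trans[OF norm_triangle_ineq4]) simp
  qed (auto simp: c_def)
  also have "\<dots> = ennreal (?A ^ n) * (\<integral>\<^sup>+x. (\<Prod>j<n. ennreal (norm (c j (x j)))) * (ennreal ((1 / sqrt (2 * pi)) ^ n) * ennreal (exp (- quad x / 2))) \<partial>(\<Pi>\<^sub>M i\<in>{..<n}. lborel))"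
  proof -
    have "(\<lambda>x. (\<integral>w. (\<Sum>j<n. x j * V j w)\<^sup>2 \<partial>P) / e\<^sup>2) = (\<lambda>x. quad x - (\<Sum>j<n. (x j)\<^sup>2))"
      by (simp add: quad_def)
    then have [measurable]: "(\<lambda>x. (\<integral>w. (\<Sum>j<n. x j * V j w)\<^sup>2 \<partial>P) / e\<^sup>2) \<in> borel_measurable (\<Pi>\<^sub>M i\<in>{..<n}. lborel)"
      by (simp only:) measurable
    have [measurable]: "c j \<in> borel_measurable borel" for j unfolding c_def by measurable
    have "(\<lambda>x. (\<Prod>j<n. ennreal (norm (c j (x j)))) * ennreal (exp (- ((\<integral>w. (\<Sum>j<n. x j * V j w)\<^sup>2 \<partial>P) / e\<^sup>2) / 2))) \<in> borel_measurable (\<Pi>\<^sub>M i\<in>{..<n}. lborel)"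
      by measurable
    from nn_integral_PiM_std_normal[OF finite_lessThan this] show ?thesis
      by (simp only: prod_std_normal_density mult.left_commute[of "prod _ _" "prod _ _"])
  qed
  also have "\<dots> \<le> ennreal (?A ^ n) * (\<integral>\<^sup>+x. ennreal ((1 / sqrt (2 * pi)) ^ n * (\<Prod>j<n. D * (4 * real n * W j powr (- (g / 2))))) * ennreal (exp (- (1/2 * quad x) / 2)) \<partial>(\<Pi>\<^sub>M i\<in>{..<n}. lborel))"
  proof (intro mult_left_mono nn_integral_mono)
    fix x
    \<comment> \<open>By homogeneity x may be normalised to have j-th coordinate 1.\<close>
    have qx: "W j * (x j)\<^sup>2 \<le> quad x" if j: "j < n" for j
    proof (cases "x j = 0")
      case True
      have "0 \<le> quad x" unfolding quad_def using e by (intro add_nonneg_nonneg divide_nonneg_nonneg sum_nonneg) auto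
      then show ?thesis using True by simp
    next
      case False
      define x' where "x' = (\<lambda>i. x i / x j)"
      have "x = (\<lambda>i. x j * x' i)" unfolding x'_def using False by auto
      then have "quad x = (x j)\<^sup>2 * quad x'" using quad_scale[of "x j" x'] by metis
      moreover have "W j \<le> quad x'"
      proof -
        have "x' j = 1" unfolding x'_def using False by simp
        then have "w j \<le> (\<integral>y. (\<Sum>i<n. x' i * V i y)\<^sup>2 \<partial>P)" "1 \<le> (\<Sum>j<n. (x' j)\<^sup>2)"
          using lb2[OF j] member_le_sum[of j "{..<n}" "\<lambda>j. (x' j)\<^sup>2"] j by auto
        then show ?thesis unfolding quad_def W_def using e by (intro add_mono divide_right_mono) auto
      qed
      ultimately show ?thesis
        using mult_right_mono[of "W j" "quad x'" "(x j)\<^sup>2"] by (simp add: mult.commute)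
    qed
    \<comment> \<open>Averaging the n bounds puts 1/n into each exponent; this becomes the factor n
      in the final bound.\<close>
    have "(\<Sum>j<n. W j * (x j)\<^sup>2) \<le> (\<Sum>j<n. quad x)" using qx by (intro sum_mono) auto
    then have "(\<Sum>j<n. W j * (x j)\<^sup>2 / (4 * real n)) \<le> quad x / 4"
      using n1 by (simp add: sum_divide_distrib[symmetric] field_simps)
    then have ex: "exp (- quad x / 2) \<le> (\<Prod>j<n. exp (- (W j * (x j)\<^sup>2) / (4 * real n))) * exp (- (1/2 * quad x) / 2)"
      by (simp add: exp_sum[symmetric] exp_add[symmetric] sum_negf)
    have "(\<Prod>j<n. norm (c j (x j))) * ((1 / sqrt (2 * pi)) ^ n * exp (- quad x / 2))
       \<le> (\<Prod>j<n. D * \<bar>x j\<bar> powr g) * ((1 / sqrt (2 * pi)) ^ n * ((\<Prod>j<n. exp (- (W j * (x j)\<^sup>2) / (4 * real n))) * exp (- (1/2 * quad x) / 2)))"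
      using ex D0 by (intro mult_mono prod_mono cb prod_nonneg conjI mult_nonneg_nonneg zero_le_power) auto
    also have "\<dots> = (1 / sqrt (2 * pi)) ^ n * (\<Prod>j<n. D * (\<bar>x j\<bar> powr g * exp (- (W j * (x j)\<^sup>2) / (4 * real n)))) * exp (- (1/2 * quad x) / 2)"
      by (simp add: prod.distrib mult_ac)
    also have "\<dots> \<le> (1 / sqrt (2 * pi)) ^ n * (\<Prod>j<n. D * (4 * real n * W j powr (- (g / 2)))) * exp (- (1/2 * quad x) / 2)"
      using abs_powr_mult_exp_le[OF g W] n1 D0
      by (intro mult_right_mono mult_left_mono prod_mono conjI mult_nonneg_nonneg) auto
    finally show "(\<Prod>j<n. ennreal (norm (c j (x j)))) * (ennreal ((1 / sqrt (2 * pi)) ^ n) * ennreal (exp (- quad x / 2)))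
      \<le> ennreal ((1 / sqrt (2 * pi)) ^ n * (\<Prod>j<n. D * (4 * real n * W j powr (- (g / 2))))) * ennreal (exp (- (1/2 * quad x) / 2))"
      using D0 by (simp add: prod_ennreal ennreal_mult'[symmetric] ennreal_mult''[symmetric] prod_nonneg ennreal_leI)
  qed auto
  also have "\<dots> = ennreal (?A ^ n) * (ennreal ((1 / sqrt (2 * pi)) ^ n * (\<Prod>j<n. D * (4 * real n * W j powr (- (g / 2))))) * (\<integral>\<^sup>+x. ennreal (exp (- (1/2 * quad x) / 2)) \<partial>(\<Pi>\<^sub>M i\<in>{..<n}. lborel)))"
    by (subst nn_integral_cmult) auto
  also have "\<dots> \<le> ennreal (?A ^ n) * (ennreal ((1 / sqrt (2 * pi)) ^ n * (\<Prod>j<n. D * (4 * real n * W j powr (- (g / 2))))) * ennreal (\<Prod>k<n. sqrt (2 * pi / (1/2 * (v k / e\<^sup>2 + 1)))))"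
    by (intro mult_left_mono nn_integral_exp_quad) auto
  also have "\<dots> = ennreal (\<Prod>k<n. (?A * (1 / sqrt (2 * pi)) * sqrt (2 * pi / (1/2 * (v k / e\<^sup>2 + 1)))) * (D * (4 * real n * W k powr (- (g / 2)))))"
    using e v0 D0 unfolding prod.distrib
    by (simp add: ennreal_mult'[symmetric] ennreal_mult''[symmetric] prod_nonneg mult_ac)
  \<comment> \<open>The constant 16 is 2 from \<open>norm_iexp_diff_le\<close>, 4 from
    \<open>abs_powr_mult_exp_le\<close>, and 2 as a bound for the sqrt 2 that stems from integrating
    only half of the form.\<close>
  also have "\<dots> \<le> ennreal (\<Prod>k<n. 16 * real n * \<bar>y - z\<bar> powr g * (w k + e\<^sup>2) powr (- (g / 2)) * (v k + e\<^sup>2) powr (- (1/2)))"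
  proof (intro ennreal_leI prod_mono conjI)
    fix k assume k: "k \<in> {..<n}"
    have "D * W k powr (- (g / 2)) = 2 * \<bar>y - z\<bar> powr g * (w k + e\<^sup>2) powr (- (g / 2))"
    proof -
      have "W k = (w k + e\<^sup>2) / e\<^sup>2" unfolding W_def using e by (simp add: field_simps)
      then have "W k powr (- (g / 2)) = (w k + e\<^sup>2) powr (- (g / 2)) * e powr g"
      proof -
        have "(e\<^sup>2) powr (- (g / 2)) = e powr (- g)" using e powr_powr[of e 2 "- (g / 2)"] by simp
        moreover have "e powr (- g) = inverse (e powr g)" by (rule powr_minus)
        ultimately have "(e\<^sup>2) powr (- (g / 2)) = inverse (e powr g)" by (rule trans)
        moreover have "W k powr (- (g / 2)) = (w k + e\<^sup>2) powr (- (g / 2)) / (e\<^sup>2) powr (- (g / 2))"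
          unfolding \<open>W k = (w k + e\<^sup>2) / e\<^sup>2\<close> by (rule powr_divide; use w0[of k] k e in simp)
        ultimately show ?thesis by (metis divide_inverse inverse_inverse_eq)
      qed
      moreover have "D = 2 * (\<bar>y - z\<bar> powr g / e powr g)" unfolding D_def using e by (simp add: powr_divide)
      ultimately show ?thesis using e by simp
    qed
    then have eq: "D * (4 * real n * W k powr (- (g / 2))) = 8 * real n * \<bar>y - z\<bar> powr g * (w k + e\<^sup>2) powr (- (g / 2))"
      by simp
    have "?A * (1 / sqrt (2 * pi)) * sqrt (2 * pi / (1/2 * (v k / e\<^sup>2 + 1))) \<le> 1 / sqrt (1/2) * (v k + e\<^sup>2) powr (- (1/2))"
      using gauss_factor[of k "1/2"] k by simp
    also have "\<dots> \<le> 2 * (v k + e\<^sup>2) powr (- (1/2))"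
      by (intro mult_right_mono) (auto simp: real_sqrt_divide intro!: real_le_lsqrt)
    finally have b: "?A * (1 / sqrt (2 * pi)) * sqrt (2 * pi / (1/2 * (v k / e\<^sup>2 + 1))) \<le> 2 * (v k + e\<^sup>2) powr (- (1/2))" .
    have "(?A * (1 / sqrt (2 * pi)) * sqrt (2 * pi / (1/2 * (v k / e\<^sup>2 + 1)))) * (D * (4 * real n * W k powr (- (g / 2))))
      \<le> (2 * (v k + e\<^sup>2) powr (- (1/2))) * (8 * real n * \<bar>y - z\<bar> powr g * (w k + e\<^sup>2) powr (- (g / 2)))"
      unfolding eq by (rule mult_right_mono[OF b]) auto
    then show "(?A * (1 / sqrt (2 * pi)) * sqrt (2 * pi / (1/2 * (v k / e\<^sup>2 + 1)))) * (D * (4 * real n * W k powr (- (g / 2))))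
      \<le> 16 * real n * \<bar>y - z\<bar> powr g * (w k + e\<^sup>2) powr (- (g / 2)) * (v k + e\<^sup>2) powr (- (1/2))"
      by (simp add: mult_ac)
    show "0 \<le> (?A * (1 / sqrt (2 * pi)) * sqrt (2 * pi / (1/2 * (v k / e\<^sup>2 + 1)))) * (D * (4 * real n * W k powr (- (g / 2))))"
      using e v0[of k] k D0 by (intro mult_nonneg_nonneg) auto
  qed
  finally show ?thesis by (subst (asm) ennreal_le_iff) (auto intro!: prod_nonneg)
qed

end

subsection \<open>Greedy orderings\<close>

definition greedy :: "real ^ 'n \<Rightarrow> nat \<Rightarrow> (nat \<Rightarrow> real ^ 'n) \<Rightarrow> bool" where
  "greedy H n t \<longleftrightarrow> (\<forall>j k. j < k \<longrightarrow> k < n \<longrightarrow> rho H (t j) (t (Suc j)) \<le> rho H (t j) (t k))"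

text \<open>Lists of indices and not sets of points, because different indices may carry the same
  point. The start i is fixed, and a nearest remaining index is put next, recursively.\<close>

lemma greedy_list_exists:
  fixes d :: "'a \<Rightarrow> 'a \<Rightarrow> real"
  assumes "finite A"
  shows "\<exists>xs. distinct xs \<and> set xs = A \<and>
    (\<forall>j k. j < k \<longrightarrow> k < Suc (length xs) \<longrightarrow> d ((i # xs) ! j) ((i # xs) ! Suc j) \<le> d ((i # xs) ! j) ((i # xs) ! k))"
  using assms
proof (induction "card A" arbitrary: A i)
  case 0
  then show ?case by (intro exI[of _ "[]"]) auto
next
  case (Suc m)
  then have "A \<noteq> {}" by auto
  then obtain b where b: "b \<in> A" "\<And>x. x \<in> A \<Longrightarrow> d i b \<le> d i x"
    using Suc.prems by (metis arg_min_if_finite(1) arg_min_least)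
  have "m = card (A - {b})" "finite (A - {b})" using Suc b by auto
  from Suc.hyps(1)[OF this, of b] obtain xs where xs: "distinct xs" "set xs = A - {b}"
    "\<And>j k. j < k \<Longrightarrow> k < Suc (length xs) \<Longrightarrow> d ((b # xs) ! j) ((b # xs) ! Suc j) \<le> d ((b # xs) ! j) ((b # xs) ! k)"
    by blast
  show ?case
  proof (intro exI[of _ "b # xs"] conjI allI impI)
    show "distinct (b # xs)" "set (b # xs) = A" using xs b by auto
    fix j k assume jk: "j < k" "k < Suc (length (b # xs))"
    show "d ((i # b # xs) ! j) ((i # b # xs) ! Suc j) \<le> d ((i # b # xs) ! j) ((i # b # xs) ! k)"
    proof (cases j)
      case 0
      have "(i # b # xs) ! k \<in> set (b # xs)" using jk 0
        by (metis Suc_less_eq gr0_implies_Suc length_Cons nth_Cons_Suc nth_mem)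
      then show ?thesis using 0 b(2) xs(2) b(1) by auto
    next
      case (Suc j')
      then obtain k' where "k = Suc k'" using jk by (cases k) auto
      then show ?thesis using xs(3)[of j' k'] jk Suc by simp
    qed
  qed
qed

definition orderings :: "nat \<Rightarrow> nat list set" where
  "orderings n = {xs. distinct xs \<and> set xs = {..<n}}"

lemma finite_orderings: "finite (orderings n)"
proof (rule finite_subset)
  show "orderings n \<subseteq> {xs. set xs \<subseteq> {..<n} \<and> length xs = n}"
    unfolding orderings_def using distinct_card by fastforce
  show "finite {xs :: nat list. set xs \<subseteq> {..<n} \<and> length xs = n}"
    by (rule finite_lists_length_eq) auto
qed

lemma orderings_bij: "xs \<in> orderings n \<Longrightarrow> bij_betw ((!) xs) {..<n} {..<n}"
  unfolding orderings_def using distinct_card[of xs] by (intro bij_betw_nth) auto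

lemma greedy_ordering_exists:
  fixes t :: "nat \<Rightarrow> real ^ 'n"
  shows "\<exists>xs\<in>orderings n. greedy H n (\<lambda>i\<in>{..<n}. t (xs ! i))"
proof (cases n)
  case 0
  then show ?thesis by (intro bexI[of _ "[]"]) (auto simp: greedy_def orderings_def)
next
  case (Suc m)
  obtain xs where xs: "distinct xs" "set xs = {1..<n}"
    "\<And>j k. j < k \<Longrightarrow> k < Suc (length xs) \<Longrightarrow> rho H (t ((0 # xs) ! j)) (t ((0 # xs) ! Suc j)) \<le> rho H (t ((0 # xs) ! j)) (t ((0 # xs) ! k))"
    using greedy_list_exists[of "{1..<n}" "\<lambda>i j. rho H (t i) (t j)" 0] by blast
  have len: "Suc (length xs) = n" using distinct_card[OF xs(1)] xs(2) Suc by simp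
  have "0 # xs \<in> orderings n" unfolding orderings_def using xs(1,2) Suc by auto
  moreover have "greedy H n (\<lambda>i\<in>{..<n}. t ((0 # xs) ! i))"
    unfolding greedy_def using xs(3) len by (auto simp: restrict_def)
  ultimately show ?thesis by blast
qed

lemma distr_PiM_reorder:
  fixes N :: "'b measure"
  assumes I: "finite I" and \<pi>: "bij_betw \<pi> I I" and N: "sigma_finite_measure N"
  shows "distr (PiM I (\<lambda>_. N)) (PiM I (\<lambda>_. N)) (\<lambda>t. \<lambda>i\<in>I. t (\<pi> i)) = PiM I (\<lambda>_. N)"
proof -
  interpret product_sigma_finite "\<lambda>_. N" using N by (intro product_sigma_finite.intro)
  have \<pi>I: "\<pi> i \<in> I" if "i \<in> I" for i using \<pi> that by (auto simp: bij_betw_def)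
  have m [measurable]: "(\<lambda>t. \<lambda>i\<in>I. t (\<pi> i)) \<in> measurable (PiM I (\<lambda>_. N)) (PiM I (\<lambda>_. N))"
    using \<pi>I by (intro measurable_restrict measurable_component_singleton) auto
  show ?thesis
  proof (rule PiM_eqI[OF I])
    fix A assume A: "\<And>i. i \<in> I \<Longrightarrow> A i \<in> sets N"
    define A' where "A' = (\<lambda>j. A (inv_into I \<pi> j))"
    have inv: "inv_into I \<pi> (\<pi> i) = i" if "i \<in> I" for i
      using \<pi> that by (auto simp: bij_betw_def)
    have invI: "inv_into I \<pi> j \<in> I" "\<pi> (inv_into I \<pi> j) = j" if "j \<in> I" for j
      using \<pi> that by (auto simp: bij_betw_def inv_into_into f_inv_into_f)
    have "(\<lambda>t. \<lambda>i\<in>I. t (\<pi> i)) -` (Pi\<^sub>E I A) \<inter> space (PiM I (\<lambda>_. N)) = Pi\<^sub>E I A'"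
    proof (intro set_eqI iffI)
      fix t assume t: "t \<in> (\<lambda>t. \<lambda>i\<in>I. t (\<pi> i)) -` (Pi\<^sub>E I A) \<inter> space (PiM I (\<lambda>_. N))"
      then have "t \<in> extensional I" by (auto simp: space_PiM PiE_def)
      moreover have "t j \<in> A' j" if "j \<in> I" for j
        using t invI[OF that] unfolding A'_def by (auto simp: PiE_iff)
      ultimately show "t \<in> Pi\<^sub>E I A'" by (auto simp: PiE_iff)
    next
      fix t assume t: "t \<in> Pi\<^sub>E I A'"
      have "A' j \<subseteq> space N" if "j \<in> I" for j
        using A[OF invI(1)[OF that]] sets.sets_into_space unfolding A'_def by auto
      then have "t \<in> space (PiM I (\<lambda>_. N))" using t by (auto simp: space_PiM PiE_iff)
      moreover have "t (\<pi> i) \<in> A i" if "i \<in> I" for i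
        proof -
          have "t (\<pi> i) \<in> A' (\<pi> i)" using t \<pi>I[OF that] by (auto simp: PiE_iff)
          then show ?thesis unfolding A'_def inv[OF that] .
        qed
      ultimately show "t \<in> (\<lambda>t. \<lambda>i\<in>I. t (\<pi> i)) -` (Pi\<^sub>E I A) \<inter> space (PiM I (\<lambda>_. N))" by auto
    qed
    then have "emeasure (distr (PiM I (\<lambda>_. N)) (PiM I (\<lambda>_. N)) (\<lambda>t. \<lambda>i\<in>I. t (\<pi> i))) (Pi\<^sub>E I A)
       = emeasure (PiM I (\<lambda>_. N)) (Pi\<^sub>E I A')"
      using A I by (subst emeasure_distr) (auto intro!: sets_PiM_I_finite)
    also have "\<dots> = (\<Prod>j\<in>I. emeasure N (A' j))"
      using A invI I unfolding A'_def by (intro emeasure_PiM) auto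
    also have "\<dots> = (\<Prod>i\<in>I. emeasure N (A' (\<pi> i)))"
      by (rule prod.reindex_bij_betw[OF \<pi>, symmetric])
    also have "\<dots> = (\<Prod>i\<in>I. emeasure N (A i))"
      unfolding A'_def using inv by (intro prod.cong) auto
    finally show "emeasure (distr (PiM I (\<lambda>_. N)) (PiM I (\<lambda>_. N)) (\<lambda>t. \<lambda>i\<in>I. t (\<pi> i))) (Pi\<^sub>E I A) = (\<Prod>i\<in>I. emeasure N (A i))" .
  qed simp
qed

text \<open>F is symmetric but estimated only on greedily ordered tuples. Every tuple has a greedy
  reordering, so W summed over all reorderings is an upper bound, and no reordering has to be
  selected measurably. The price is the number of orderings, acceptable because n stays fixed where
  this is used for tail bounds.\<close>

lemma nn_integral_greedy_le:
  fixes F W :: "(nat \<Rightarrow> real ^ 'n) \<Rightarrow> ennreal"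
  assumes N: "sigma_finite_measure N"
    and W [measurable]: "W \<in> borel_measurable (\<Pi>\<^sub>M i\<in>{..<n}. N)"
    and sym: "\<And>xs t. xs \<in> orderings n \<Longrightarrow> F (\<lambda>i\<in>{..<n}. t (xs ! i)) = F t"
    and le: "\<And>t. t \<in> space (\<Pi>\<^sub>M i\<in>{..<n}. N) \<Longrightarrow> greedy H n t \<Longrightarrow> F t \<le> W t"
  shows "(\<integral>\<^sup>+t. F t \<partial>(\<Pi>\<^sub>M i\<in>{..<n}. N)) \<le> of_nat (card (orderings n)) * (\<integral>\<^sup>+t. W t \<partial>(\<Pi>\<^sub>M i\<in>{..<n}. N))"
proof -
  let ?P = "\<Pi>\<^sub>M i\<in>{..<n}. N"
  let ?R = "\<lambda>xs t. \<lambda>i\<in>{..<n}. t (xs ! i)"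
  have R [measurable]: "?R xs \<in> measurable ?P ?P" if "xs \<in> orderings n" for xs
    using orderings_bij[OF that] by (intro measurable_restrict measurable_component_singleton) (auto simp: bij_betw_def)
  have "(\<integral>\<^sup>+t. F t \<partial>?P) \<le> (\<integral>\<^sup>+t. (\<Sum>xs\<in>orderings n. W (?R xs t)) \<partial>?P)"
  proof (intro nn_integral_mono)
    fix t assume t: "t \<in> space ?P"
    obtain xs where xs: "xs \<in> orderings n" "greedy H n (?R xs t)" using greedy_ordering_exists by blast
    have "F t = F (?R xs t)" using sym[OF xs(1)] by simp
    also have "\<dots> \<le> W (?R xs t)" using xs measurable_space[OF R t] by (intro le) auto
    also have "\<dots> \<le> (\<Sum>xs\<in>orderings n. W (?R xs t))" using xs finite_orderings by (intro member_le_sum) auto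
    finally show "F t \<le> (\<Sum>xs\<in>orderings n. W (?R xs t))" .
  qed
  also have "\<dots> = (\<Sum>xs\<in>orderings n. \<integral>\<^sup>+t. W (?R xs t) \<partial>?P)"
    by (intro nn_integral_sum measurable_compose[OF R W])
  also have "\<dots> = (\<Sum>xs\<in>orderings n. \<integral>\<^sup>+t. W t \<partial>?P)"
  proof (intro sum.cong refl)
    fix xs assume xs: "xs \<in> orderings n"
    have "(\<integral>\<^sup>+t. W (?R xs t) \<partial>?P) = (\<integral>\<^sup>+t. W t \<partial>distr ?P ?P (?R xs))"
      by (rule nn_integral_distr[symmetric, OF R[OF xs]]) simp
    also have "distr ?P ?P (?R xs) = ?P" by (rule distr_PiM_reorder[OF _ orderings_bij[OF xs] N]) simp
    finally show "(\<integral>\<^sup>+t. W (?R xs t) \<partial>?P) = (\<integral>\<^sup>+t. W t \<partial>?P)" .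
  qed
  also have "\<dots> = of_nat (card (orderings n)) * (\<integral>\<^sup>+t. W t \<partial>?P)" by simp
  finally show ?thesis .
qed

lemma sep_le_cond: "i < k + 2 \<Longrightarrow> sep H r e a t k \<le> e + rho H (t k) (cond_point a t i)"
  unfolding sep_def by (intro min.coboundedI2 add_left_mono Min_le) auto

text \<open>With the convention that the separation after the last point is \<open>r\<close>.\<close>

definition next_sep :: "real ^ 'n \<Rightarrow> real \<Rightarrow> real \<Rightarrow> real ^ 'n \<Rightarrow> nat \<Rightarrow> (nat \<Rightarrow> real ^ 'n) \<Rightarrow> nat \<Rightarrow> real" where
  "next_sep H r e a n t k = (if Suc k < n then sep H r e a t (Suc k) else r)"

lemma next_sep_bounds: "r > 0 \<Longrightarrow> e > 0 \<Longrightarrow> 0 < next_sep H r e a n t k \<and> next_sep H r e a n t k \<le> r"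
  unfolding next_sep_def using sep_pos sep_le by auto

text \<open>Earlier points are covered by the separation of the j-th point itself. A later point is
  no nearer than the successor, and the separation of the successor takes the j-th point into
  account. Thus two consecutive separations control the distances to all other points.\<close>

lemma greedy_sep_le:
  assumes g: "greedy H n t" and j: "j < n" and r: "r > 0"
    and i: "i < n" "i \<noteq> j"
  shows "min (sep H r e a t j) (next_sep H r e a n t j) \<le> e + rho H (t j) (t i)"
proof (cases "i < j")
  case True
  then have "sep H r e a t j \<le> e + rho H (t j) (t i)"
    using sep_le_cond[of "i + 2" j H r e a t] by (simp add: cond_point_def)
  then show ?thesis by simp
next
  case False
  then have ji: "j < i" using i by simp
  then have s: "Suc j < n" using i by simp
  have "sep H r e a t (Suc j) \<le> e + rho H (t (Suc j)) (t j)"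
    using sep_le_cond[of "j + 2" "Suc j" H r e a t] by (simp add: cond_point_def)
  also have "\<dots> \<le> e + rho H (t j) (t i)"
    using g ji i unfolding greedy_def rho_commute[of H "t (Suc j)"] by auto
  finally show ?thesis using s by (simp add: next_sep_def)
qed

text \<open>The product of two numbers is the product of their minimum and maximum, and the maximum
  is at most r; so the minimum can be replaced by both numbers at the price of a power of r. The
  product of the shifted separations is again one over all separations, the factor r at the end
  giving way to the separation at index 0. Hence the doubled exponent.\<close>

lemma prod_min_sep_le:
  assumes r: "r > 0" and e: "e > 0" and g: "g \<ge> 0" and n: "n \<ge> 1"
  shows "(\<Prod>k<n. min (sep H r e a t k) (next_sep H r e a n t k) powr (- g))
    \<le> (\<Prod>k<n. r powr g * sep H r e a t k powr (- (2 * g)))"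
proof -
  let ?s = "\<lambda>k. sep H r e a t k" and ?x = "\<lambda>k. next_sep H r e a n t k"
  have s: "0 < ?s k" "?s k \<le> r" "0 < ?x k" "?x k \<le> r" for k
    using sep_pos[OF r e, of H a t k] sep_le[of H r e a t k] next_sep_bounds[OF r e, of H a n t k] by auto
  have one: "min x y powr (- g) \<le> r powr g * (x powr (- g) * y powr (- g))"
    if "0 < x" "x \<le> r" "0 < y" "y \<le> r" for x y
  proof -
    have "min x y powr (- g) * max x y powr (- g) = x powr (- g) * y powr (- g)"
      by (simp add: min_def max_def)
    moreover have "1 \<le> r powr g * max x y powr (- g)"
    proof -
      have "max x y powr g \<le> r powr g" using that g by (intro powr_mono2) auto
      then show ?thesis using that by (simp add: powr_minus field_simps)
    qed
    ultimately show ?thesis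
      using mult_left_mono[of 1 "r powr g * max x y powr (- g)" "min x y powr (- g)"] by (simp add: mult_ac)
  qed
  have "(\<Prod>k<n. min (?s k) (?x k) powr (- g)) \<le> (\<Prod>k<n. r powr g * (?s k powr (- g) * ?x k powr (- g)))"
    by (intro prod_mono conjI one s) auto
  also have "\<dots> = (\<Prod>k<n. r powr g * ?s k powr (- g)) * (\<Prod>k<n. ?x k powr (- g))"
    by (simp add: prod.distrib)
  also have "\<dots> \<le> (\<Prod>k<n. r powr g * ?s k powr (- g)) * (\<Prod>k<n. ?s k powr (- g))"
  proof (intro mult_left_mono)
    obtain m where m: "n = Suc m" using n by (cases n) auto
    have "(\<Prod>k<n. ?x k powr (- g)) = (\<Prod>k<m. ?s (Suc k) powr (- g)) * r powr (- g)"
      unfolding m by (simp add: next_sep_def)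
    also have "\<dots> \<le> (\<Prod>k<m. ?s (Suc k) powr (- g)) * ?s 0 powr (- g)"
      using s[of 0] g by (intro mult_left_mono powr_mono2' prod_nonneg) auto
    also have "\<dots> = (\<Prod>k<n. ?s k powr (- g))"
      unfolding m prod.lessThan_Suc_shift by simp
    finally show "(\<Prod>k<n. ?x k powr (- g)) \<le> (\<Prod>k<n. ?s k powr (- g))" .
  qed (auto intro!: prod_nonneg)
  also have "\<dots> = (\<Prod>k<n. r powr g * ?s k powr (- (2 * g)))"
    unfolding prod.distrib[symmetric] by (intro prod.cong refl) (simp add: powr_add[symmetric] mult.assoc)
  finally show ?thesis .
qed

section \<open>Local nondeterminism of the increments from a base point\<close>

lemma condition_A_increments:
  fixes Y :: "real ^ 'n::finite \<Rightarrow> 'v \<Rightarrow> real"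
  assumes Y: "centered_gaussian_field M Y" and A: "condition_A M Y T H"
  obtains \<kappa> where "0 < \<kappa>" "\<kappa> \<le> 1"
    "\<And>(I :: nat set) t a p b m. finite I \<Longrightarrow> t \<in> T \<Longrightarrow> a \<in> T \<Longrightarrow> (\<And>i. i \<in> I \<Longrightarrow> p i \<in> T) \<Longrightarrow>
       0 \<le> m \<Longrightarrow> m \<le> rho H t 0 \<Longrightarrow> m \<le> rho H t a \<Longrightarrow> (\<And>i. i \<in> I \<Longrightarrow> m \<le> rho H t (p i)) \<Longrightarrow>
       \<kappa> * m\<^sup>2 \<le> (\<integral>w. (Y t w - Y a w + (\<Sum>i\<in>I. b i * (Y (p i) w - Y a w)))\<^sup>2 \<partial>M)"
proof (rule condition_A_linear[OF Y A])
  fix C3 :: real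
  assume C3: "C3 > 0" and C: "\<And>(n::nat) t u b. n \<ge> 1 \<Longrightarrow> t \<in> T \<Longrightarrow> u 0 = 0 \<Longrightarrow> (\<And>k. k \<in> {1..n} \<Longrightarrow> u k \<in> T) \<Longrightarrow>
       C3 * (MIN k\<in>{0..n}. (rho H t (u k))\<^sup>2) \<le> (\<integral>w. (Y t w - (\<Sum>k\<in>{1..n}. b k * Y (u k) w))\<^sup>2 \<partial>M)"
  show ?thesis
  proof (rule that[of "min C3 1"])
    fix I :: "nat set" and t a p and b :: "nat \<Rightarrow> real" and m
    assume I: "finite I" "t \<in> T" "a \<in> T" "\<And>i. i \<in> I \<Longrightarrow> p i \<in> T"
      and m: "0 \<le> m" "m \<le> rho H t 0" "m \<le> rho H t a" "\<And>i. i \<in> I \<Longrightarrow> m \<le> rho H t (p i)"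
    obtain h where h: "bij_betw h {0..<card I} I" using ex_bij_betw_nat_finite[OF I(1)] by blast
    have hI: "h i \<in> I" if "i < card I" for i using h that by (auto simp: bij_betw_def)
    \<comment> \<open>The combination of increments is Y t minus a linear combination of values:
      index 0 is the origin and carries no coefficient, index 1 is a with coefficient 1 plus the sum
      of b, and the other indices enumerate p.\<close>
    define u where "u = cond_point a (\<lambda>i. p (h i))"
    define b' where "b' = (\<lambda>i. if i = 1 then 1 + (\<Sum>i\<in>I. b i) else - b (h (i - 2)))"
    have uT: "u k \<in> T" if "k \<in> {1..card I + 1}" for k
      using that I hI[of "k - 2"] unfolding u_def cond_point_def by auto
    have le: "(MIN k\<in>{0..card I + 1}. (rho H t (u k))\<^sup>2) \<ge> m\<^sup>2"
    proof (subst Min_ge_iff; (intro ballI)?)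
      fix x assume "x \<in> (\<lambda>k. (rho H t (u k))\<^sup>2) ` {0..card I + 1}"
      then obtain k where k: "k \<le> card I + 1" "x = (rho H t (u k))\<^sup>2" by auto
      have "m \<le> rho H t (u k)" unfolding u_def cond_point_def using m k hI[of "k - 2"] by auto
      then show "m\<^sup>2 \<le> x" unfolding k using m(1) by (intro power_mono) auto
    qed auto
    have eq: "Y t w - (\<Sum>k\<in>{1..card I + 1}. b' k * Y (u k) w) = Y t w - Y a w + (\<Sum>i\<in>I. b i * (Y (p i) w - Y a w))" for w
    proof -
      have "{1..card I + 1} = insert 1 ((\<lambda>i. i + 2) ` {0..<card I})"
      proof (intro set_eqI iffI)
        fix x assume "x \<in> {1..card I + 1}"
        then have "x = 1 \<or> x = (x - 2) + 2 \<and> x - 2 \<in> {0..<card I}" by auto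
        then show "x \<in> insert 1 ((\<lambda>i. i + 2) ` {0..<card I})" by blast
      qed auto
      then have "(\<Sum>k\<in>{1..card I + 1}. b' k * Y (u k) w) = b' 1 * Y (u 1) w + (\<Sum>k\<in>(\<lambda>i. i + 2) ` {0..<card I}. b' k * Y (u k) w)"
        by (simp only:) (subst sum.insert, auto)
      also have "(\<Sum>k\<in>(\<lambda>i. i + 2) ` {0..<card I}. b' k * Y (u k) w) = (\<Sum>i\<in>{0..<card I}. - b (h i) * Y (p (h i)) w)"
        by (subst sum.reindex) (auto simp: b'_def u_def cond_point_def inj_on_def)
      also have "\<dots> = (\<Sum>i\<in>I. - b i * Y (p i) w)"
        by (rule sum.reindex_bij_betw[OF h])
      finally show ?thesis
        by (simp add: b'_def u_def cond_point_def algebra_simps sum_distrib_right sum_subtractf sum_negf)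
    qed
    have "min C3 1 * m\<^sup>2 \<le> C3 * (MIN k\<in>{0..card I + 1}. (rho H t (u k))\<^sup>2)"
      using le C3 by (intro mult_mono) auto
    also have "\<dots> \<le> (\<integral>w. (Y t w - (\<Sum>k\<in>{1..card I + 1}. b' k * Y (u k) w))\<^sup>2 \<partial>M)"
      using I(2) uT by (intro C) (auto simp: u_def cond_point_def)
    finally show "min C3 1 * m\<^sup>2 \<le> (\<integral>w. (Y t w - Y a w + (\<Sum>i\<in>I. b i * (Y (p i) w - Y a w)))\<^sup>2 \<partial>M)"
      unfolding eq .
  qed (use C3 in auto)
qed

lemma increments_gaussian:
  fixes Y :: "'t \<Rightarrow> 'v \<Rightarrow> real"
  assumes Y: "centered_gaussian_field M Y"
  shows "centered_gaussian M (\<lambda>w. \<Sum>j<(n::nat). b j * (Y (t j) w - Y a w))"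
proof -
  have "(\<Sum>j<n. b j * (Y (t j) w - Y a w)) =
      (\<Sum>j<Suc n. (if j < n then b j else - (\<Sum>j<n. b j)) * Y (if j < n then t j else a) w)" for w
  proof -
    have "(\<Sum>j<n. (if j < n then b j else - (\<Sum>j<n. b j)) * Y (if j < n then t j else a) w) = (\<Sum>j<n. b j * Y (t j) w)"
      by (intro sum.cong) auto
    then show ?thesis by (simp add: right_diff_distrib sum_subtractf sum_distrib_right)
  qed
  then show ?thesis
    using centered_gaussian_field_sum[OF Y, of "{..<Suc n}" "\<lambda>j. if j < n then b j else - (\<Sum>j<n. b j)" "\<lambda>j. if j < n then t j else a"]
    by simp
qed

lemma increment_gaussian:
  fixes Y :: "'t \<Rightarrow> 'v \<Rightarrow> real"
  assumes Y: "centered_gaussian_field M Y"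
  shows "centered_gaussian M (\<lambda>w. Y t w - Y a w)"
  using increments_gaussian[OF Y, of "\<lambda>_. 1" "\<lambda>_. t" a 1] by simp

text \<open>Turns a variance plus the variance of the mollifier into a power of the separation s: (e
  + m)^2 \<le> 2 (m^2 + e^2), and k \<le> 1 makes k a common factor of both terms.\<close>

lemma add_square_powr_le:
  fixes m e k s g :: real
  assumes "0 < k" "k \<le> 1" "0 \<le> m" "0 < e" "0 < s" "s \<le> e + m" "0 \<le> g"
  shows "(k * m\<^sup>2 + e\<^sup>2) powr (- (g / 2)) \<le> (k / 2) powr (- (g / 2)) * s powr (- g)"
proof -
  have "(e + m)\<^sup>2 \<le> 2 * (m\<^sup>2 + e\<^sup>2)"
    using sum_squares_bound[of e m] by (simp add: power2_sum)
  then have "k / 2 * (e + m)\<^sup>2 \<le> k / 2 * (2 * (m\<^sup>2 + e\<^sup>2))"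
    using assms by (intro mult_left_mono) auto
  also have "\<dots> \<le> k * m\<^sup>2 + e\<^sup>2"
    using assms by (simp add: distrib_left mult_left_le_one_le)
  finally have 1: "k / 2 * (e + m)\<^sup>2 \<le> k * m\<^sup>2 + e\<^sup>2" .
  have "s\<^sup>2 \<le> (e + m)\<^sup>2" using assms by (intro power_mono) auto
  then have "k / 2 * s\<^sup>2 \<le> k / 2 * (e + m)\<^sup>2" using assms by (intro mult_left_mono) auto
  with 1 have "k / 2 * s\<^sup>2 \<le> k * m\<^sup>2 + e\<^sup>2" by linarith
  then have "(k * m\<^sup>2 + e\<^sup>2) powr (- (g / 2)) \<le> (k / 2 * s\<^sup>2) powr (- (g / 2))"
    using assms by (intro powr_mono2') auto
  also have "\<dots> = (k / 2) powr (- (g / 2)) * (s\<^sup>2) powr (- (g / 2))" by (rule powr_mult)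
  also have "(s\<^sup>2) powr (- (g / 2)) = (s powr 2) powr (- (g / 2))"
    using assms(5) by (simp only: powr_numeral)
  also have "\<dots> = s powr (2 * (- (g / 2)))" by (rule powr_powr)
  also have "2 * (- (g / 2)) = - g" by simp
  finally show ?thesis .
qed

text \<open>Strong local nondeterminism in linear form, with the constant exposed so that a locale
  can fix it. A free m in place of a minimum of distances admits the truncated separations that come
  from greedy orders, and a general finite I permits conditioning on later points as well.\<close>

definition nondeterminism :: "'v measure \<Rightarrow> (real ^ 'n \<Rightarrow> 'v \<Rightarrow> real) \<Rightarrow> (real ^ 'n) set \<Rightarrow> real ^ 'n \<Rightarrow> real \<Rightarrow> bool" where
  "nondeterminism M Y T H \<kappa> \<longleftrightarrow> 0 < \<kappa> \<and> \<kappa> \<le> 1 \<and> (\<forall>(I :: nat set) t a p b m. finite I \<longrightarrow> t \<in> T \<longrightarrow> a \<in> T \<longrightarrow>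
     (\<forall>i\<in>I. p i \<in> T) \<longrightarrow> 0 \<le> m \<longrightarrow> m \<le> rho H t 0 \<longrightarrow> m \<le> rho H t a \<longrightarrow> (\<forall>i\<in>I. m \<le> rho H t (p i)) \<longrightarrow>
       \<kappa> * m\<^sup>2 \<le> (\<integral>w. (Y t w - Y a w + (\<Sum>i\<in>I. b i * (Y (p i) w - Y a w)))\<^sup>2 \<partial>M))"

lemma nondeterminismD:
  fixes I :: "nat set"
  assumes "nondeterminism M Y T H \<kappa>" "finite I" "t \<in> T" "a \<in> T" "\<And>i. i \<in> I \<Longrightarrow> p i \<in> T"
    "0 \<le> m" "m \<le> rho H t 0" "m \<le> rho H t a" "\<And>i. i \<in> I \<Longrightarrow> m \<le> rho H t (p i)"
  shows "\<kappa> * m\<^sup>2 \<le> (\<integral>w. (Y t w - Y a w + (\<Sum>i\<in>I. b i * (Y (p i) w - Y a w)))\<^sup>2 \<partial>M)"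
proof -
  note nd = assms(1)[unfolded nondeterminism_def, THEN conjunct2, THEN conjunct2, rule_format]
  show ?thesis by (rule nd) (use assms(2-) in simp_all)
qed

lemma condition_A_nondeterminism:
  fixes Y :: "real ^ 'n::finite \<Rightarrow> 'v \<Rightarrow> real"
  assumes Y: "centered_gaussian_field M Y" and A: "condition_A M Y T H"
  shows "\<exists>\<kappa>. nondeterminism M Y T H \<kappa>"
proof (rule condition_A_increments[OF Y A])
  fix \<kappa> :: real
  assume 1: "0 < \<kappa>" "\<kappa> \<le> 1"
    and 2: "\<And>(I :: nat set) t a p b m. finite I \<Longrightarrow> t \<in> T \<Longrightarrow> a \<in> T \<Longrightarrow> (\<And>i. i \<in> I \<Longrightarrow> p i \<in> T) \<Longrightarrow>
       0 \<le> m \<Longrightarrow> m \<le> rho H t 0 \<Longrightarrow> m \<le> rho H t a \<Longrightarrow> (\<And>i. i \<in> I \<Longrightarrow> m \<le> rho H t (p i)) \<Longrightarrow>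
       \<kappa> * m\<^sup>2 \<le> (\<integral>w. (Y t w - Y a w + (\<Sum>i\<in>I. b i * (Y (p i) w - Y a w)))\<^sup>2 \<partial>M)"
  show "\<exists>\<kappa>. nondeterminism M Y T H \<kappa>"
    unfolding nondeterminism_def
  proof (intro exI[of _ \<kappa>] conjI allI impI)
    fix I :: "nat set" and t a p and b :: "nat \<Rightarrow> real" and m
    assume *: "finite I" "t \<in> T" "a \<in> T" "\<forall>i\<in>I. p i \<in> T" "0 \<le> m" "m \<le> rho H t 0" "m \<le> rho H t a" "\<forall>i\<in>I. m \<le> rho H t (p i)"
    show "\<kappa> * m\<^sup>2 \<le> (\<integral>w. (Y t w - Y a w + (\<Sum>i\<in>I. b i * (Y (p i) w - Y a w)))\<^sup>2 \<partial>M)"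
      by (rule 2) (use * in simp_all)
  qed (rule 1)+
qed

section \<open>Density bounds for increments in terms of separations\<close>

context
  fixes M :: "'v measure" and Y :: "real ^ 'n::finite \<Rightarrow> 'v \<Rightarrow> real" and T H \<kappa> and t :: "nat \<Rightarrow> real ^ 'n" and a and n :: nat and r e :: real
  assumes Y: "centered_gaussian_field M Y" and nd: "nondeterminism M Y T H \<kappa>"
    and t: "\<And>i. i < n \<Longrightarrow> t i \<in> T" and a: "a \<in> T" and r: "r > 0" and e: "e > 0"
begin

lemma kappa_unit: "0 < \<kappa>" "\<kappa> \<le> 1" using nd unfolding nondeterminism_def by auto

lemma min_rho_bounds:
  shows "0 \<le> (MIN i\<in>{..<k + 2}. rho H (t k) (cond_point a t i))"
    and "i < k + 2 \<Longrightarrow> (MIN i\<in>{..<k + 2}. rho H (t k) (cond_point a t i)) \<le> rho H (t k) (cond_point a t i)"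
    and "sep H r e a t k \<le> e + (MIN i\<in>{..<k + 2}. rho H (t k) (cond_point a t i))"
proof -
  show "0 \<le> (MIN i\<in>{..<k + 2}. rho H (t k) (cond_point a t i))"
    by (subst Min_ge_iff) (auto simp: rho_nonneg)
  show "i < k + 2 \<Longrightarrow> (MIN i\<in>{..<k + 2}. rho H (t k) (cond_point a t i)) \<le> rho H (t k) (cond_point a t i)"
    by (intro Min_le) auto
qed (simp add: sep_def)

lemma increments_lower_bound:
  assumes k: "k < n"
  shows "\<kappa> * (MIN i\<in>{..<k + 2}. rho H (t k) (cond_point a t i))\<^sup>2
    \<le> (\<integral>w. (Y (t k) w - Y a w + (\<Sum>i<k. b i * (Y (t i) w - Y a w)))\<^sup>2 \<partial>M)"
proof (rule nondeterminismD[OF nd])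
  show "(MIN i\<in>{..<k + 2}. rho H (t k) (cond_point a t i)) \<le> rho H (t k) 0"
    using min_rho_bounds(2)[of 0 k] by (simp add: cond_point_def)
  show "(MIN i\<in>{..<k + 2}. rho H (t k) (cond_point a t i)) \<le> rho H (t k) a"
    using min_rho_bounds(2)[of 1 k] by (simp add: cond_point_def)
  show "(MIN i\<in>{..<k + 2}. rho H (t k) (cond_point a t i)) \<le> rho H (t k) (t i)" if "i \<in> {..<k}" for i
    using min_rho_bounds(2)[of "i + 2" k] that by (simp add: cond_point_def)
qed (use k t a min_rho_bounds in auto)

lemma gaussian_conditions:
  shows "prob_space M" "\<And>b. centered_gaussian M (\<lambda>w. \<Sum>j<n. b j * (Y (t j) w - Y a w))"
    "\<And>j. (\<lambda>w. Y (t j) w - Y a w) \<in> borel_measurable M"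
    "\<And>j. integrable M (\<lambda>w. (Y (t j) w - Y a w)\<^sup>2)"
proof -
  show P: "prob_space M" using Y by (simp add: centered_gaussian_field_def)
  show "centered_gaussian M (\<lambda>w. \<Sum>j<n. b j * (Y (t j) w - Y a w))" for b by (rule increments_gaussian[OF Y])
  show "(\<lambda>w. Y (t j) w - Y a w) \<in> borel_measurable M" for j
    using increment_gaussian[OF Y, of "t j" a] by (simp add: centered_gaussian_def)
  show "integrable M (\<lambda>w. (Y (t j) w - Y a w)\<^sup>2)" for j
    using centered_gaussian_char(2)[OF P increment_gaussian[OF Y], of "t j" a 1] by simp
qed

lemma density_product_sep_le:
  "\<bar>\<integral>w. (\<Prod>j<n. normal_density 0 e (Y (t j) w - Y a w - y)) \<partial>M\<bar>
    \<le> (\<Prod>k<n. (\<kappa> / 2) powr (- (1/2)) * sep H r e a t k powr (-1))"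
proof -
  let ?v = "\<lambda>k. \<kappa> * (MIN i\<in>{..<k + 2}. rho H (t k) (cond_point a t i))\<^sup>2"
  have "\<bar>\<integral>w. (\<Prod>j<n. normal_density 0 e (Y (t j) w - Y a w - y)) \<partial>M\<bar> \<le> (\<Prod>k<n. (?v k + e\<^sup>2) powr (- (1/2)))"
    by (rule gaussian_density_product_le[OF gaussian_conditions e _ increments_lower_bound])
      (use kappa_unit in auto)
  also have "\<dots> \<le> (\<Prod>k<n. (\<kappa> / 2) powr (- (1/2)) * sep H r e a t k powr (-1))"
    using kappa_unit e min_rho_bounds sep_pos[OF r e] by (intro prod_mono conjI add_square_powr_le) auto
  finally show ?thesis .
qed

lemma density_difference_product_sep_le:
  assumes g: "0 < g" "g \<le> 1" and n1: "n \<ge> 1" and gr: "greedy H n t"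
  shows "\<bar>\<integral>w. (\<Prod>j<n. normal_density 0 e (Y (t j) w - Y a w - y) - normal_density 0 e (Y (t j) w - Y a w - z)) \<partial>M\<bar>
    \<le> (\<Prod>k<n. 16 * real n * \<bar>y - z\<bar> powr g * ((\<kappa> / 2) powr (- (g / 2)) * min (sep H r e a t k) (next_sep H r e a n t k) powr (- g))
        * ((\<kappa> / 2) powr (- (1/2)) * sep H r e a t k powr (-1)))"
proof -
  let ?v = "\<lambda>k. \<kappa> * (MIN i\<in>{..<k + 2}. rho H (t k) (cond_point a t i))\<^sup>2"
  let ?s = "\<lambda>k. min (sep H r e a t k) (next_sep H r e a n t k)"
  \<comment> \<open>By \<open>greedy_sep_le\<close> the smaller of two consecutive separations, less
    e, is at most the distance to every other point. Capped below at 0 it is admissible as m, and e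
    plus it still dominates the separation.\<close>
  let ?w = "\<lambda>k. \<kappa> * (max 0 (?s k - e))\<^sup>2"
  have lb2: "?w k \<le> (\<integral>x. (\<Sum>i<n. b i * (Y (t i) x - Y a x))\<^sup>2 \<partial>M)" if k: "k < n" and b: "b k = 1" for k b
  proof -
    have "?w k \<le> (\<integral>w. (Y (t k) w - Y a w + (\<Sum>i\<in>{..<n} - {k}. b i * (Y (t i) w - Y a w)))\<^sup>2 \<partial>M)"
    proof (rule nondeterminismD[OF nd])
      show "max 0 (?s k - e) \<le> rho H (t k) 0"
        using sep_le_cond[of 0 k H r e a t] rho_nonneg[of H "t k" 0] by (simp add: cond_point_def)
      show "max 0 (?s k - e) \<le> rho H (t k) a"
        using sep_le_cond[of 1 k H r e a t] rho_nonneg[of H "t k" a] by (simp add: cond_point_def)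
      show "max 0 (?s k - e) \<le> rho H (t k) (t i)" if "i \<in> {..<n} - {k}" for i
        using greedy_sep_le[OF gr k r, of i e a] rho_nonneg[of H "t k" "t i"] that by simp
    qed (use k t a in auto)
    also have "(\<lambda>w. Y (t k) w - Y a w + (\<Sum>i\<in>{..<n} - {k}. b i * (Y (t i) w - Y a w))) = (\<lambda>w. \<Sum>i<n. b i * (Y (t i) w - Y a w))"
      using k b by (simp add: sum.remove[of "{..<n}" k])
    finally show ?thesis .
  qed
  have "\<bar>\<integral>w. (\<Prod>j<n. normal_density 0 e (Y (t j) w - Y a w - y) - normal_density 0 e (Y (t j) w - Y a w - z)) \<partial>M\<bar>
     \<le> (\<Prod>k<n. 16 * real n * \<bar>y - z\<bar> powr g * (?w k + e\<^sup>2) powr (- (g / 2)) * (?v k + e\<^sup>2) powr (- (1/2)))"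
    by (rule gaussian_density_difference_product_le[OF gaussian_conditions e _ increments_lower_bound g n1 _ lb2])
      (use kappa_unit in auto)
  also have "\<dots> \<le> (\<Prod>k<n. 16 * real n * \<bar>y - z\<bar> powr g * ((\<kappa> / 2) powr (- (g / 2)) * ?s k powr (- g))
        * ((\<kappa> / 2) powr (- (1/2)) * sep H r e a t k powr (-1)))"
  proof (intro prod_mono conjI mult_mono mult_nonneg_nonneg order_refl)
    fix k
    have s: "0 < ?s k" using sep_pos[OF r e, of H a t k] next_sep_bounds[OF r e, of H a n t k] by simp
    show "(?w k + e\<^sup>2) powr (- (g / 2)) \<le> (\<kappa> / 2) powr (- (g / 2)) * ?s k powr (- g)"
      using kappa_unit e s g by (intro add_square_powr_le) auto
    show "(?v k + e\<^sup>2) powr (- (1/2)) \<le> (\<kappa> / 2) powr (- (1/2)) * sep H r e a t k powr (-1)"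
      using kappa_unit e min_rho_bounds sep_pos[OF r e] by (intro add_square_powr_le) auto
  qed auto
  finally show ?thesis .
qed

end

subsection \<open>Moments of the mollified local time\<close>

lemma borel_measurable_vec_component [measurable (raw)]:
  fixes f :: "'a \<Rightarrow> real ^ 'n::finite"
  assumes "f \<in> borel_measurable M"
  shows "(\<lambda>x. f x $ j) \<in> borel_measurable M"
proof -
  have "(\<lambda>v::real^'n. v $ j) \<in> borel_measurable borel"
    by (intro borel_measurable_continuous_onI continuous_intros)
  from measurable_compose[OF assms this] show ?thesis .
qed

lemma normal_density_bounds:
  assumes "e > 0"
  shows "0 \<le> normal_density 0 e z" "normal_density 0 e z \<le> 1 / (e * sqrt (2 * pi))"
proof -
  show "0 \<le> normal_density 0 e z" by simp
  have "exp (- (z - 0)\<^sup>2 / (2 * e\<^sup>2)) \<le> 1" using assms by simp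
  then show "normal_density 0 e z \<le> 1 / (e * sqrt (2 * pi))"
    unfolding normal_density_def using assms
    by (simp add: real_sqrt_mult mult.commute divide_right_mono)
qed

lemma powr_minus_one_power:
  assumes "0 < (s :: real)"
  shows "(s powr (-1)) ^ m = s powr (- real m)"
proof -
  have "0 < s powr (-1)" using assms by simp
  then have "(s powr (-1)) ^ m = (s powr (-1)) powr real m" by (rule powr_realpow[symmetric])
  also have "\<dots> = s powr ((-1) * real m)" by (rule powr_powr)
  finally show ?thesis by (simp only: mult_minus1)
qed

text \<open>\<open>factor\<close> and \<open>moment\<close> are the only links between the laws of X
  and Y: independence and equality in law, already reduced to integrals of functions of increments.
  Continuity of paths is assumed for every sample point, which is reached by changing X on a null
  set.\<close>

locale smooth_field =
  fixes M :: "'w measure" and X :: "real ^ 'n::finite \<Rightarrow> 'w \<Rightarrow> real ^ 'd::finite"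
    and M' :: "'v measure" and Y :: "real ^ 'n \<Rightarrow> 'v \<Rightarrow> real" and T :: "(real ^ 'n) set"
    and H :: "real ^ 'n" and \<kappa> C2 :: real
  assumes prob: "prob_space M"
    and X_measurable [measurable]: "\<And>t. X t \<in> borel_measurable M"
    and X_cont: "\<And>w. w \<in> space M \<Longrightarrow> continuous_on UNIV (\<lambda>t. X t w)"
    and Y_field: "centered_gaussian_field M' Y"
    and nd: "nondeterminism M' Y T H \<kappa>"
    and H01: "\<And>j. 0 < H $ j" "\<And>j. H $ j < 1"
    and dQ: "real CARD('d) < Q_dim H"
    and C2: "0 \<le> C2" "\<And>t s. t \<in> T \<Longrightarrow> s \<in> T \<Longrightarrow> (\<integral>w. (Y t w - Y s w)\<^sup>2 \<partial>M') \<le> C2 * (rho H t s)\<^sup>2"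
    and factor: "\<And>(n::nat) t a (\<phi> :: nat \<Rightarrow> 'd \<Rightarrow> real \<Rightarrow> real) B. (\<And>j c. \<phi> j c \<in> borel_measurable borel) \<Longrightarrow> (\<And>j c z. \<bar>\<phi> j c z\<bar> \<le> B) \<Longrightarrow>
        (\<integral>w. (\<Prod>c\<in>UNIV. \<Prod>j<n. \<phi> j c (X (t j) w $ c - X a w $ c)) \<partial>M)
        = (\<Prod>c\<in>UNIV. \<integral>w. (\<Prod>j<n. \<phi> j c (Y (t j) w - Y a w)) \<partial>M')"
    and moment: "\<And>t s c k. (\<integral>\<^sup>+w. ennreal ((X t w $ c - X s w $ c) ^ (2 * k)) \<partial>M) = (\<integral>\<^sup>+w. ennreal ((Y t w - Y s w) ^ (2 * k)) \<partial>M')"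
begin

sublocale prob_space M by (rule prob)

lemma kappa_bounds: "0 < \<kappa>" "\<kappa> \<le> 1" using nd unfolding nondeterminism_def by auto

text \<open>By continuity of the paths, X is the limit of its values at the lattice points below t,
  of which there are countably many on each level.\<close>

lemma X_joint_measurable: "(\<lambda>z. X (fst z) (snd z)) \<in> borel_measurable (borel \<Otimes>\<^sub>M M)"
proof (rule borel_measurable_LIMSEQ_metric)
  define rd where "rd = (\<lambda>(k::nat) (i :: 'n \<Rightarrow> int). (\<chi> j. of_int (i j) / 2 ^ k) :: real ^ 'n)"
  define fl where "fl = (\<lambda>(k::nat) (t :: real ^ 'n) j. \<lfloor>2 ^ k * t $ j\<rfloor>)"
  show "(\<lambda>z. X (rd k (fl k (fst z))) (snd z)) \<in> borel_measurable (borel \<Otimes>\<^sub>M M)" for k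
  proof (rule measurable_compose_countable[where f="\<lambda>i (z :: (real ^ 'n) \<times> 'w). X (rd k i) (snd z)" and g="\<lambda>z :: (real ^ 'n) \<times> 'w. fl k (fst z)"])
    show "(\<lambda>z. X (rd k i) (snd z)) \<in> borel_measurable (borel \<Otimes>\<^sub>M M)" for i by measurable
    have "fl k \<in> measurable borel (count_space UNIV)"
    proof (subst measurable_count_space_eq2_countable)
      have "fl k -` {i} = {t. \<forall>j. \<lfloor>2 ^ k * t $ j\<rfloor> = i j}" for i unfolding fl_def by (auto simp: fun_eq_iff)
      moreover have "{t :: real ^ 'n. \<forall>j. \<lfloor>2 ^ k * t $ j\<rfloor> = i j} \<in> sets borel" for i :: "'n \<Rightarrow> int"
        by measurable
      ultimately show "fl k \<in> space borel \<rightarrow> UNIV \<and> (\<forall>i\<in>UNIV. fl k -` {i} \<inter> space borel \<in> sets borel)" by simp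
    qed
    then show "(\<lambda>z :: (real ^ 'n) \<times> 'w. fl k (fst z)) \<in> measurable (borel \<Otimes>\<^sub>M M) (count_space UNIV)"
      by (rule measurable_compose[OF measurable_fst])
  qed
  fix z :: "(real ^ 'n) \<times> 'w" assume z: "z \<in> space (borel \<Otimes>\<^sub>M M)"
  have "(\<lambda>k. rd k (fl k (fst z))) \<longlonglongrightarrow> fst z"
    by (rule vec_tendstoI) (simp add: rd_def fl_def tendsto_dyadic_floor)
  moreover have "snd z \<in> space M" using z by (auto simp: space_pair_measure)
  ultimately show "(\<lambda>k. X (rd k (fl k (fst z))) (snd z)) \<longlonglongrightarrow> X (fst z) (snd z)"
    by (intro continuous_on_tendsto_compose[OF X_cont]) auto
qed

text \<open>The location x is relative to X a. On a ball about a only the increments from X a are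
  under control, so in this form a deterministic grid covers the relevant locations; and densities
  of increments from a are what local nondeterminism bounds.\<close>

definition moll :: "real \<Rightarrow> real ^ 'n \<Rightarrow> real ^ 'd \<Rightarrow> real ^ 'n \<Rightarrow> 'w \<Rightarrow> real" where
  "moll e a x t w = (\<Prod>c\<in>UNIV. normal_density 0 e (X t w $ c - X a w $ c - x $ c))"

definition Lmoll :: "(real ^ 'n) set \<Rightarrow> real \<Rightarrow> real ^ 'n \<Rightarrow> real ^ 'd \<Rightarrow> 'w \<Rightarrow> real" where
  "Lmoll S e a x w = (\<integral>t. moll e a x t w \<partial>restrict_space lborel S)"

definition mbound :: "real \<Rightarrow> real" where
  "mbound e = (1 / (e * sqrt (2 * pi))) ^ CARD('d)"

lemma moll_bounds:
  assumes "e > 0" shows "0 \<le> moll e a x t w" "moll e a x t w \<le> mbound e"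
proof -
  show "0 \<le> moll e a x t w" unfolding moll_def by (intro prod_nonneg) simp
  have "moll e a x t w \<le> (\<Prod>c\<in>(UNIV :: 'd set). 1 / (e * sqrt (2 * pi)))"
    unfolding moll_def using normal_density_bounds[OF assms] by (intro prod_mono) auto
  then show "moll e a x t w \<le> mbound e" by (simp add: mbound_def)
qed

lemma moll_measurable [measurable (raw)]:
  assumes f: "f \<in> borel_measurable N" and g: "g \<in> measurable N M"
  shows "(\<lambda>z. moll e a x (f z) (g z)) \<in> borel_measurable N"
proof -
  have [measurable]: "(\<lambda>z. X (f z) (g z)) \<in> borel_measurable N"
    using measurable_compose[OF measurable_Pair[OF f g] X_joint_measurable] by simp
  have [measurable]: "(\<lambda>z. X a (g z)) \<in> borel_measurable N" using g by measurable
  show ?thesis unfolding moll_def by measurable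
qed

lemma ident_restrict_measurable [measurable]: "(\<lambda>t::real^'n. t) \<in> borel_measurable (restrict_space lborel S)"
  by (intro measurable_restrict_space1) simp

lemma Pi_component_measurable:
  "j < n \<Longrightarrow> (\<lambda>t. t j) \<in> borel_measurable (\<Pi>\<^sub>M i\<in>{..<n}. restrict_space lborel (S :: (real ^ 'n) set))"
  using measurable_compose[OF measurable_component_singleton[of j "{..<n}" "\<lambda>_. restrict_space lborel S"] ident_restrict_measurable[of S]]
  by simp

section \<open>Moments over a set of times with volume of order r^Q\<close>

context
  fixes S :: "(real ^ 'n) set" and a :: "real ^ 'n" and r e cS :: real
  assumes S: "S \<in> sets borel" "S \<subseteq> T" and a: "a \<in> T" and r: "r > 0" and e: "e > 0"
    and cS: "0 \<le> cS" "emeasure lborel S \<le> ennreal (cS * r powr (Q_dim H))"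
begin

lemma finite_N: "finite_measure (restrict_space lborel S)"
proof
  have "emeasure (restrict_space lborel S) (space (restrict_space lborel S)) = emeasure lborel S"
    using S by (subst emeasure_restrict_space) (auto simp: space_restrict_space)
  then show "emeasure (restrict_space lborel S) (space (restrict_space lborel S)) \<noteq> \<infinity>"
    using cS(2) by (auto simp: top_unique)
qed

lemma sigma_finite_N: "product_sigma_finite (\<lambda>_::nat. restrict_space lborel S)"
  using finite_N by (intro product_sigma_finite.intro finite_measure.axioms(1))

lemma finite_PiN: "finite_measure (\<Pi>\<^sub>M i\<in>{..<n::nat}. restrict_space lborel S)"
proof
  interpret product_sigma_finite "\<lambda>_::nat. restrict_space lborel S" by (rule sigma_finite_N)
  interpret N: finite_measure "restrict_space lborel S" by (rule finite_N)
  show "emeasure (\<Pi>\<^sub>M i\<in>{..<n::nat}. restrict_space lborel S) (space (\<Pi>\<^sub>M i\<in>{..<n}. restrict_space lborel S)) \<noteq> \<infinity>"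
    unfolding space_PiM by (subst emeasure_PiM) (auto simp: ennreal_prod_eq_top power_eq_top_ennreal)
qed

lemma moll_integrable: "w \<in> space M \<Longrightarrow> integrable (restrict_space lborel S) (\<lambda>t. moll e a x t w)"
  using moll_bounds[OF e]
  by (intro finite_measure.integrable_const_bound[OF finite_N, where B="mbound e"]) auto

lemma Lmoll_nonneg: "0 \<le> Lmoll S e a x w"
  unfolding Lmoll_def using moll_bounds[OF e] by (intro integral_nonneg_AE) auto

lemma Lmoll_measurable [measurable]: "Lmoll S e a x \<in> borel_measurable M"
proof -
  interpret N: finite_measure "restrict_space lborel S" by (rule finite_N)
  have "(\<lambda>(w, t). moll e a x t w) \<in> borel_measurable (M \<Otimes>\<^sub>M restrict_space lborel S)"
    unfolding split_beta' by measurable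
  then show ?thesis unfolding Lmoll_def[abs_def] by (rule N.borel_measurable_lebesgue_integral)
qed

lemma prod_moll_integrable:
  assumes "\<And>j. j < n \<Longrightarrow> f j \<in> borel_measurable M" "\<And>j w. \<bar>f j w\<bar> \<le> B"
  shows "integrable M (\<lambda>w. \<Prod>j<n. f j w :: real)"
proof (rule integrable_const_bound)
  show "AE w in M. norm (\<Prod>j<n. f j w) \<le> (\<Prod>j<n. B)"
    unfolding prod_norm[symmetric] using assms(2) by (intro AE_I2 prod_mono) auto
qed (use assms(1) in measurable)

lemma expectation_prod_moll_le:
  assumes t: "\<And>i. i < n \<Longrightarrow> t i \<in> T"
  shows "(\<integral>w. (\<Prod>j<n. moll e a x (t j) w) \<partial>M)
    \<le> (\<Prod>k<n. ((\<kappa> / 2) powr (- (1/2))) ^ CARD('d) * sep H r e a t k powr (- real CARD('d)))"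
proof -
  let ?B = "1 / (e * sqrt (2 * pi))"
  have "(\<integral>w. (\<Prod>j<n. moll e a x (t j) w) \<partial>M) = (\<integral>w. (\<Prod>c\<in>UNIV. \<Prod>j<n. normal_density 0 e (X (t j) w $ c - X a w $ c - x $ c)) \<partial>M)"
    unfolding moll_def by (subst prod.swap) simp
  also have "\<dots> = (\<Prod>c\<in>UNIV. \<integral>w. (\<Prod>j<n. normal_density 0 e (Y (t j) w - Y a w - x $ c)) \<partial>M')"
    using normal_density_bounds[OF e]
    by (intro factor[where \<phi>="\<lambda>j c z. normal_density 0 e (z - x $ c)" and B="?B"]) auto
  also have "\<dots> \<le> (\<Prod>c\<in>(UNIV :: 'd set). \<Prod>k<n. (\<kappa> / 2) powr (- (1/2)) * sep H r e a t k powr (-1))"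
  proof (intro prod_mono conjI)
    fix c :: 'd
    show "0 \<le> (\<integral>w. (\<Prod>j<n. normal_density 0 e (Y (t j) w - Y a w - x $ c)) \<partial>M')"
      by (intro integral_nonneg_AE AE_I2 prod_nonneg) simp
    show "(\<integral>w. (\<Prod>j<n. normal_density 0 e (Y (t j) w - Y a w - x $ c)) \<partial>M') \<le> (\<Prod>k<n. (\<kappa> / 2) powr (- (1/2)) * sep H r e a t k powr (-1))"
      using density_product_sep_le[where n=n and t=t and y="x $ c", OF Y_field nd t a r e] by linarith
  qed
  also have "\<dots> = (\<Prod>k<n. ((\<kappa> / 2) powr (- (1/2))) ^ CARD('d) * sep H r e a t k powr (- real CARD('d)))"
  proof -
    have "(s powr (-1)) ^ CARD('d) = s powr (- real CARD('d))" if "s > 0" for s :: real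
      using that by (rule powr_minus_one_power)
    then have *: "(sep H r e a t k powr (-1)) ^ CARD('d) = sep H r e a t k powr (- real CARD('d))" for k
      using sep_pos[OF r e] by blast
    show ?thesis by (simp only: prod_constant prod_power_distrib power_mult_distrib *)
  qed
  finally show ?thesis .
qed

text \<open>The n-th power of the integral is an integral over n time points, and after Tonelli the
  expectation is a smoothed joint density. The bound contains neither x nor e.\<close>

lemma Lmoll_moment_le:
  "(\<integral>\<^sup>+w. ennreal (Lmoll S e a x w ^ n) \<partial>M)
    \<le> (\<Prod>k<n. ennreal (((\<kappa> / 2) powr (- (1/2))) ^ CARD('d) * ((cS + singular_const CARD('n) (Q_dim H) (real CARD('d))) * real (k + 2) powr (real CARD('d) / Q_dim H) * r powr (Q_dim H - real CARD('d)))))"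
proof -
  let ?N = "restrict_space lborel S" and ?PN = "\<Pi>\<^sub>M i\<in>{..<n}. restrict_space lborel S"
  let ?K = "((\<kappa> / 2) powr (- (1/2))) ^ CARD('d)"
  interpret PS: product_sigma_finite "\<lambda>_::nat. ?N" by (rule sigma_finite_N)
  interpret PN: finite_measure ?PN by (rule finite_PiN)
  interpret PP: pair_sigma_finite M ?PN ..
  have "(\<integral>\<^sup>+w. ennreal (Lmoll S e a x w ^ n) \<partial>M) = (\<integral>\<^sup>+w. (\<integral>\<^sup>+t. (\<Prod>j<n. ennreal (moll e a x (t j) w)) \<partial>?PN) \<partial>M)"
  proof (intro nn_integral_cong)
    fix w assume w: "w \<in> space M"
    have "ennreal (Lmoll S e a x w) = (\<integral>\<^sup>+t. ennreal (moll e a x t w) \<partial>?N)"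
      unfolding Lmoll_def using moll_integrable[OF w] moll_bounds[OF e]
      by (intro nn_integral_eq_integral[symmetric]) auto
    then have "ennreal (Lmoll S e a x w ^ n) = (\<Prod>j<n. \<integral>\<^sup>+t. ennreal (moll e a x t w) \<partial>?N)"
      using Lmoll_nonneg by (simp add: ennreal_power[symmetric])
    also have "\<dots> = (\<integral>\<^sup>+t. (\<Prod>j<n. ennreal (moll e a x (t j) w)) \<partial>?PN)"
      using w by (intro PS.product_nn_integral_prod[symmetric]) auto
    finally show "ennreal (Lmoll S e a x w ^ n) = \<dots>" .
  qed
  also have "\<dots> = (\<integral>\<^sup>+t. (\<integral>\<^sup>+w. (\<Prod>j<n. ennreal (moll e a x (t j) w)) \<partial>M) \<partial>?PN)"
  proof (rule PP.Fubini'[symmetric])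
    show "(\<lambda>(w, t). \<Prod>j<n. ennreal (moll e a x (t j) w)) \<in> borel_measurable (M \<Otimes>\<^sub>M ?PN)"
      unfolding split_beta'
    proof (intro borel_measurable_prod_ennreal measurable_compose[OF moll_measurable measurable_ennreal])
      fix j assume "j \<in> {..<n}"
      then show "(\<lambda>z. snd z j) \<in> borel_measurable (M \<Otimes>\<^sub>M ?PN)"
        using measurable_compose[OF measurable_snd Pi_component_measurable] by auto
    qed auto
  qed
  also have "\<dots> \<le> (\<integral>\<^sup>+t. (\<Prod>k<n. ennreal ?K) * (\<Prod>k<n. ennreal (sep H r e a t k powr (- real CARD('d)))) \<partial>?PN)"
  proof (intro nn_integral_mono)
    fix t assume "t \<in> space ?PN"
    then have t: "t i \<in> T" if "i < n" for i using that S(2) by (auto simp: space_PiM space_restrict_space PiE_iff)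
    have int: "integrable M (\<lambda>w. \<Prod>j<n. moll e a x (t j) w)"
      using moll_bounds[OF e] by (intro prod_moll_integrable[where B="mbound e"]) auto
    have "(\<integral>\<^sup>+w. (\<Prod>j<n. ennreal (moll e a x (t j) w)) \<partial>M) = (\<integral>\<^sup>+w. ennreal (\<Prod>j<n. moll e a x (t j) w) \<partial>M)"
      using moll_bounds[OF e] by (simp add: prod_ennreal)
    also have "\<dots> = ennreal (\<integral>w. (\<Prod>j<n. moll e a x (t j) w) \<partial>M)"
      using moll_bounds[OF e] by (intro nn_integral_eq_integral int) (auto intro!: prod_nonneg)
    also have "\<dots> \<le> ennreal (\<Prod>k<n. ?K * sep H r e a t k powr (- real CARD('d)))"
      by (intro ennreal_leI expectation_prod_moll_le t)
    also have "\<dots> = (\<Prod>k<n. ennreal ?K) * (\<Prod>k<n. ennreal (sep H r e a t k powr (- real CARD('d))))"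
    proof -
      have "ennreal (\<Prod>k<n. ?K * sep H r e a t k powr (- real CARD('d))) = (\<Prod>k<n. ennreal (?K * sep H r e a t k powr (- real CARD('d))))"
        by (rule prod_ennreal[symmetric]) simp
      also have "\<dots> = (\<Prod>k<n. ennreal ?K * ennreal (sep H r e a t k powr (- real CARD('d))))"
        by (intro prod.cong refl ennreal_mult') simp
      also have "\<dots> = (\<Prod>k<n. ennreal ?K) * (\<Prod>k<n. ennreal (sep H r e a t k powr (- real CARD('d))))"
        by (rule prod.distrib)
      finally show ?thesis .
    qed
    finally show "(\<integral>\<^sup>+w. (\<Prod>j<n. ennreal (moll e a x (t j) w)) \<partial>M) \<le> \<dots>" .
  qed
  also have "\<dots> = (\<Prod>k<n. ennreal ?K) * (\<integral>\<^sup>+t. (\<Prod>k<n. ennreal (sep H r e a t k powr (- real CARD('d)))) \<partial>?PN)"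
    by (intro nn_integral_cmult borel_measurable_prod_ennreal) auto
  also have "\<dots> \<le> (\<Prod>k<n. ennreal ?K) * (\<Prod>k<n. ennreal ((cS + singular_const CARD('n) (Q_dim H) (real CARD('d))) * real (k + 2) powr (real CARD('d) / Q_dim H) * r powr (Q_dim H - real CARD('d))))"
    using H01 r e dQ S cS by (intro mult_left_mono nn_integral_prod_sep_le) auto
  also have "\<dots> = (\<Prod>k<n. ennreal (?K * ((cS + singular_const CARD('n) (Q_dim H) (real CARD('d))) * real (k + 2) powr (real CARD('d) / Q_dim H) * r powr (Q_dim H - real CARD('d)))))"
    unfolding prod.distrib[symmetric] by (intro prod.cong refl ennreal_mult'[symmetric]) simp
  finally show ?thesis .
qed

text \<open>Since x and y differ in the coordinate c0 alone, the difference of the product kernels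
  keeps the product form, with a difference in the factor c0 only. One component then carries the
  Hoelder bound and the others the plain density bound. The d densities account for d in the
  exponent of the separations, the Hoelder factor for 2 g.\<close>

lemma expectation_prod_moll_difference_le:
  assumes t: "\<And>i. i < n \<Longrightarrow> t i \<in> T" and g: "0 < g" "g \<le> 1" and n1: "n \<ge> 1" and gr: "greedy H n t"
    and xy: "\<And>i. i \<noteq> c0 \<Longrightarrow> x $ i = y $ i"
  shows "\<bar>\<integral>w. (\<Prod>j<n. moll e a x (t j) w - moll e a y (t j) w) \<partial>M\<bar>
    \<le> (\<Prod>k<n. (16 * real n * (\<kappa> / 2) powr (- (g / 2)) * ((\<kappa> / 2) powr (- (1/2))) ^ CARD('d))
         * (\<bar>x $ c0 - y $ c0\<bar> powr g * r powr g) * sep H r e a t k powr (- (real CARD('d) + 2 * g)))"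
proof -
  let ?B = "1 / (e * sqrt (2 * pi))"
  let ?s = "\<lambda>k. sep H r e a t k" and ?m = "\<lambda>k. min (sep H r e a t k) (next_sep H r e a n t k)"
  let ?k = "(\<kappa> / 2) powr (- (1/2))" and ?k' = "(\<kappa> / 2) powr (- (g / 2))"
  define \<phi> where "\<phi> = (\<lambda>(j::nat) c z. if c = c0 then normal_density 0 e (z - x $ c0) - normal_density 0 e (z - y $ c0)
      else normal_density 0 e (z - x $ c))"
  have diff: "moll e a x s w - moll e a y s w = (\<Prod>c\<in>UNIV. \<phi> j c (X s w $ c - X a w $ c))" for j s w
  proof -
    have y: "(\<Prod>c\<in>UNIV - {c0}. normal_density 0 e (X s w $ c - X a w $ c - y $ c)) = (\<Prod>c\<in>UNIV - {c0}. normal_density 0 e (X s w $ c - X a w $ c - x $ c))"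
      using xy by (intro prod.cong) auto
    have f: "(\<Prod>c\<in>UNIV - {c0}. \<phi> j c (X s w $ c - X a w $ c)) = (\<Prod>c\<in>UNIV - {c0}. normal_density 0 e (X s w $ c - X a w $ c - x $ c))"
      unfolding \<phi>_def by (intro prod.cong) auto
    show ?thesis
      unfolding moll_def prod.remove[OF finite_class.finite_UNIV UNIV_I[of c0], where g="\<lambda>c. normal_density 0 e (X s w $ c - X a w $ c - x $ c)"]
        prod.remove[OF finite_class.finite_UNIV UNIV_I[of c0], where g="\<lambda>c. normal_density 0 e (X s w $ c - X a w $ c - y $ c)"]
        prod.remove[OF finite_class.finite_UNIV UNIV_I[of c0], where g="\<lambda>c. \<phi> j c (X s w $ c - X a w $ c)"] y f
      by (simp add: \<phi>_def left_diff_distrib)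
  qed
  have pos: "0 < ?s k" "0 < ?m k" for k
    using sep_pos[OF r e, of H a t k] next_sep_bounds[OF r e, of H a n t k] by auto
  have nonneg: "0 \<le> (\<Prod>k<n. ?k * ?s k powr (-1))" by (intro prod_nonneg) simp
  have "(\<integral>w. (\<Prod>j<n. moll e a x (t j) w - moll e a y (t j) w) \<partial>M) = (\<integral>w. (\<Prod>c\<in>UNIV. \<Prod>j<n. \<phi> j c (X (t j) w $ c - X a w $ c)) \<partial>M)"
  proof -
    have "(\<Prod>j<n. moll e a x (t j) w - moll e a y (t j) w) = (\<Prod>c\<in>UNIV. \<Prod>j<n. \<phi> j c (X (t j) w $ c - X a w $ c))" for w
    proof -
      have "(\<Prod>j<n. moll e a x (t j) w - moll e a y (t j) w) = (\<Prod>j<n. \<Prod>c\<in>UNIV. \<phi> j c (X (t j) w $ c - X a w $ c))"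
        by (intro prod.cong refl diff)
      also have "\<dots> = (\<Prod>c\<in>UNIV. \<Prod>j<n. \<phi> j c (X (t j) w $ c - X a w $ c))" by (rule prod.swap)
      finally show ?thesis .
    qed
    then show ?thesis by simp
  qed
  also have "\<dots> = (\<Prod>c\<in>UNIV. \<integral>w. (\<Prod>j<n. \<phi> j c (Y (t j) w - Y a w)) \<partial>M')"
  proof (rule factor[where B="?B"])
    show "\<phi> j c \<in> borel_measurable borel" for j c unfolding \<phi>_def by (cases "c = c0") auto
    show "\<bar>\<phi> j c z\<bar> \<le> ?B" for j c z
    proof -
      have "\<bar>u - v\<bar> \<le> b" if "0 \<le> u" "u \<le> b" "0 \<le> v" "v \<le> b" for u v b :: real using that by linarith
      then show ?thesis unfolding \<phi>_def using normal_density_bounds[OF e] by simp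
    qed
  qed
  also have "\<dots> = (\<integral>w. (\<Prod>j<n. \<phi> j c0 (Y (t j) w - Y a w)) \<partial>M') * (\<Prod>c\<in>UNIV - {c0}. \<integral>w. (\<Prod>j<n. \<phi> j c (Y (t j) w - Y a w)) \<partial>M')"
    by (rule prod.remove) auto
  finally have "\<bar>\<integral>w. (\<Prod>j<n. moll e a x (t j) w - moll e a y (t j) w) \<partial>M\<bar>
     = \<bar>\<integral>w. (\<Prod>j<n. \<phi> j c0 (Y (t j) w - Y a w)) \<partial>M'\<bar> * (\<Prod>c\<in>UNIV - {c0}. \<bar>\<integral>w. (\<Prod>j<n. \<phi> j c (Y (t j) w - Y a w)) \<partial>M'\<bar>)"
    by (simp only: abs_mult abs_prod)
  also have "\<dots> \<le> (\<Prod>k<n. 16 * real n * \<bar>x $ c0 - y $ c0\<bar> powr g * (?k' * ?m k powr (- g)) * (?k * ?s k powr (-1)))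
      * (\<Prod>c\<in>UNIV - {c0}. \<Prod>k<n. ?k * ?s k powr (-1))"
  proof (intro mult_mono prod_mono conjI)
    show "\<bar>\<integral>w. (\<Prod>j<n. \<phi> j c0 (Y (t j) w - Y a w)) \<partial>M'\<bar> \<le> (\<Prod>k<n. 16 * real n * \<bar>x $ c0 - y $ c0\<bar> powr g * (?k' * ?m k powr (- g)) * (?k * ?s k powr (-1)))"
      unfolding \<phi>_def using density_difference_product_sep_le[OF Y_field nd t a r e g n1 gr] by simp
    show "\<bar>\<integral>w. (\<Prod>j<n. \<phi> j c (Y (t j) w - Y a w)) \<partial>M'\<bar> \<le> (\<Prod>k<n. ?k * ?s k powr (-1))" if "c \<in> UNIV - {c0}" for c
      using that density_product_sep_le[where n=n and t=t and y="x $ c", OF Y_field nd t a r e] unfolding \<phi>_def by simp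
  qed (auto intro!: prod_nonneg)
  also have "(\<Prod>c\<in>UNIV - {c0}. \<Prod>k<n. ?k * ?s k powr (-1)) = (\<Prod>k<n. (?k * ?s k powr (-1)) ^ (CARD('d) - 1))"
    by (simp add: prod_power_distrib)
  also have "(\<Prod>k<n. 16 * real n * \<bar>x $ c0 - y $ c0\<bar> powr g * (?k' * ?m k powr (- g)) * (?k * ?s k powr (-1))) * \<dots>
     = (\<Prod>k<n. (16 * real n * ?k' * ?k ^ CARD('d)) * \<bar>x $ c0 - y $ c0\<bar> powr g * ?s k powr (- real CARD('d))) * (\<Prod>k<n. ?m k powr (- g))"
    unfolding prod.distrib[symmetric]
  proof (intro prod.cong refl)
    fix k
    have "(?k * ?s k powr (-1)) * (?k * ?s k powr (-1)) ^ (CARD('d) - 1) = (?k * ?s k powr (-1)) ^ CARD('d)"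
      by (metis power_minus_mult zero_less_card_finite mult.commute)
    also have "\<dots> = ?k ^ CARD('d) * ?s k powr (- real CARD('d))"
      by (simp only: power_mult_distrib powr_minus_one_power[OF pos(1)])
    finally have *: "(?k * ?s k powr (-1)) * (?k * ?s k powr (-1)) ^ (CARD('d) - 1) = ?k ^ CARD('d) * ?s k powr (- real CARD('d))" .
    have "16 * real n * \<bar>x $ c0 - y $ c0\<bar> powr g * (?k' * ?m k powr (- g)) * (?k * ?s k powr (-1)) * (?k * ?s k powr (-1)) ^ (CARD('d) - 1)
       = 16 * real n * \<bar>x $ c0 - y $ c0\<bar> powr g * (?k' * ?m k powr (- g)) * ((?k * ?s k powr (-1)) * (?k * ?s k powr (-1)) ^ (CARD('d) - 1))"
      by (simp only: mult.assoc)
    then show "16 * real n * \<bar>x $ c0 - y $ c0\<bar> powr g * (?k' * ?m k powr (- g)) * (?k * ?s k powr (-1)) * (?k * ?s k powr (-1)) ^ (CARD('d) - 1)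
       = (16 * real n * ?k' * ?k ^ CARD('d)) * \<bar>x $ c0 - y $ c0\<bar> powr g * ?s k powr (- real CARD('d)) * ?m k powr (- g)"
      unfolding * by (simp only: mult_ac)
  qed
  also have "\<dots> \<le> (\<Prod>k<n. (16 * real n * ?k' * ?k ^ CARD('d)) * \<bar>x $ c0 - y $ c0\<bar> powr g * ?s k powr (- real CARD('d))) * (\<Prod>k<n. r powr g * ?s k powr (- (2 * g)))"
    using g n1 by (intro mult_left_mono prod_min_sep_le r e prod_nonneg) auto
  also have "\<dots> = (\<Prod>k<n. (16 * real n * ?k' * ?k ^ CARD('d)) * (\<bar>x $ c0 - y $ c0\<bar> powr g * r powr g) * ?s k powr (- (real CARD('d) + 2 * g)))"
    unfolding prod.distrib[symmetric]
  proof (intro prod.cong refl)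
    fix k
    have "?s k powr (- (real CARD('d) + 2 * g)) = ?s k powr (- real CARD('d)) * ?s k powr (- (2 * g))"
      unfolding powr_add[symmetric] by (rule arg_cong[where f="\<lambda>x. _ powr x"]) simp
    then show "(16 * real n * ?k' * ?k ^ CARD('d)) * \<bar>x $ c0 - y $ c0\<bar> powr g * ?s k powr (- real CARD('d)) * (r powr g * ?s k powr (- (2 * g)))
      = (16 * real n * ?k' * ?k ^ CARD('d)) * (\<bar>x $ c0 - y $ c0\<bar> powr g * r powr g) * ?s k powr (- (real CARD('d) + 2 * g))"
      by (simp only: mult_ac)
  qed
  finally show ?thesis .
qed

lemma Lmoll_difference_moment_le:
  assumes g: "0 < g" "g \<le> 1" "real CARD('d) + 2 * g < Q_dim H" and n1: "n \<ge> 1" and ev: "even n"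
    and xy: "\<And>i. i \<noteq> c0 \<Longrightarrow> x $ i = y $ i"
  shows "(\<integral>\<^sup>+w. ennreal (\<bar>Lmoll S e a x w - Lmoll S e a y w\<bar> ^ n) \<partial>M)
    \<le> ennreal (real (card (orderings n)) * (\<Prod>k<n. (16 * real n * (\<kappa> / 2) powr (- (g / 2)) * ((\<kappa> / 2) powr (- (1/2))) ^ CARD('d))
         * ((cS + singular_const CARD('n) (Q_dim H) (real CARD('d) + 2 * g)) * real (k + 2) powr ((real CARD('d) + 2 * g) / Q_dim H)))
       * (\<bar>x $ c0 - y $ c0\<bar> powr g * r powr (Q_dim H - real CARD('d) - g)) ^ n)"
proof -
  let ?N = "restrict_space lborel S" and ?PN = "\<Pi>\<^sub>M i\<in>{..<n}. restrict_space lborel S"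
  let ?K = "16 * real n * (\<kappa> / 2) powr (- (g / 2)) * ((\<kappa> / 2) powr (- (1/2))) ^ CARD('d)"
  let ?D = "\<bar>x $ c0 - y $ c0\<bar> powr g" and ?s = "real CARD('d) + 2 * g" and ?Q = "Q_dim H"
  let ?C = "\<lambda>k. (cS + singular_const CARD('n) ?Q ?s) * real (k + 2) powr (?s / ?Q)"
  interpret PS: product_sigma_finite "\<lambda>_::nat. ?N" by (rule sigma_finite_N)
  interpret PN: finite_measure ?PN by (rule finite_PiN)
  interpret PP: pair_sigma_finite M ?PN ..
  interpret PF: finite_measure "M \<Otimes>\<^sub>M ?PN"
  proof
    show "emeasure (M \<Otimes>\<^sub>M ?PN) (space (M \<Otimes>\<^sub>M ?PN)) \<noteq> \<infinity>"
      unfolding space_pair_measure using PN.emeasure_finite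
      by (subst PN.emeasure_pair_measure_Times) (auto simp: emeasure_space_1)
  qed
  let ?f = "\<lambda>t w. moll e a x t w - moll e a y t w"
  have fb: "\<bar>?f t w\<bar> \<le> mbound e" for t w
    using moll_bounds[OF e, of a x t w] moll_bounds[OF e, of a y t w] by linarith
  have fi: "integrable ?N (\<lambda>t. ?f t w)" if "w \<in> space M" for w
    by (intro Bochner_Integration.integrable_diff moll_integrable that)
  have fm: "(\<lambda>z. ?f (snd z j) (fst z)) \<in> borel_measurable (M \<Otimes>\<^sub>M ?PN)" if "j < n" for j
  proof -
    have [measurable]: "(\<lambda>z. snd z j) \<in> borel_measurable (M \<Otimes>\<^sub>M ?PN)"
      using measurable_compose[OF measurable_snd Pi_component_measurable[OF that]] by auto
    show ?thesis by measurable
  qed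
  have intF: "integrable (M \<Otimes>\<^sub>M ?PN) (\<lambda>(w, t). \<Prod>j<n. ?f (t j) w)"
  proof (rule PF.integrable_const_bound)
    have "norm (\<Prod>j<n. ?f (t j) w) \<le> (\<Prod>j<n. mbound e)" for w t
      unfolding prod_norm[symmetric] using fb by (intro prod_mono) auto
    then show "AE z in M \<Otimes>\<^sub>M ?PN. norm (case z of (w, t) \<Rightarrow> \<Prod>j<n. ?f (t j) w) \<le> (\<Prod>j<n. mbound e)"
      unfolding split_beta' by (intro AE_I2)
    show "(\<lambda>(w, t). \<Prod>j<n. ?f (t j) w) \<in> borel_measurable (M \<Otimes>\<^sub>M ?PN)"
      unfolding split_beta' using fm by (intro borel_measurable_prod) auto
  qed
  have pow: "\<bar>Lmoll S e a x w - Lmoll S e a y w\<bar> ^ n = (\<integral>t. (\<Prod>j<n. ?f (t j) w) \<partial>?PN)" if w: "w \<in> space M" for w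
  proof -
    have D: "Lmoll S e a x w - Lmoll S e a y w = (\<integral>t. ?f t w \<partial>?N)"
      unfolding Lmoll_def by (rule Bochner_Integration.integral_diff[symmetric]; intro moll_integrable w)
    have "\<bar>Lmoll S e a x w - Lmoll S e a y w\<bar> ^ n = (Lmoll S e a x w - Lmoll S e a y w) ^ n"
      using ev by (simp add: power_even_abs)
    also have "\<dots> = (\<integral>t. ?f t w \<partial>?N) ^ n" by (simp only: D)
    also have "(\<integral>t. ?f t w \<partial>?N) ^ n = (\<Prod>j<n. \<integral>t. ?f t w \<partial>?N)" by simp
    also have "\<dots> = (\<integral>t. (\<Prod>j<n. ?f (t j) w) \<partial>?PN)"
      by (rule PS.product_integral_prod[symmetric]) (auto intro: fi[OF w])
    finally show ?thesis .
  qed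
  have "(\<integral>\<^sup>+w. ennreal (\<bar>Lmoll S e a x w - Lmoll S e a y w\<bar> ^ n) \<partial>M)
      = (\<integral>\<^sup>+w. ennreal (\<integral>t. (\<Prod>j<n. ?f (t j) w) \<partial>?PN) \<partial>M)"
    by (intro nn_integral_cong) (simp only: pow)
  also have "\<dots> = ennreal (\<integral>w. (\<integral>t. (\<Prod>j<n. ?f (t j) w) \<partial>?PN) \<partial>M)"
  proof (intro nn_integral_eq_integral)
    show "integrable M (\<lambda>w. \<integral>t. (\<Prod>j<n. ?f (t j) w) \<partial>?PN)" using PP.integrable_fst[OF intF] by simp
    show "AE w in M. 0 \<le> (\<integral>t. (\<Prod>j<n. ?f (t j) w) \<partial>?PN)"
      by (intro AE_I2) (simp add: pow[symmetric])
  qed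
  also have "(\<integral>w. (\<integral>t. (\<Prod>j<n. ?f (t j) w) \<partial>?PN) \<partial>M) = (\<integral>t. (\<integral>w. (\<Prod>j<n. ?f (t j) w) \<partial>M) \<partial>?PN)"
    by (rule PP.Fubini_integral[symmetric, OF intF])
  also have "ennreal \<dots> \<le> ennreal (norm (\<integral>t. (\<integral>w. (\<Prod>j<n. ?f (t j) w) \<partial>M) \<partial>?PN))"
    by (rule ennreal_leI) simp
  also have "\<dots> \<le> (\<integral>\<^sup>+t. norm (\<integral>w. (\<Prod>j<n. ?f (t j) w) \<partial>M) \<partial>?PN)"
    by (rule integral_norm_bound_ennreal) (use PP.integrable_snd[OF intF] in simp)
  also have "\<dots> \<le> of_nat (card (orderings n)) * (\<integral>\<^sup>+t. (\<Prod>k<n. ennreal (?K * (?D * r powr g))) * (\<Prod>k<n. ennreal (sep H r e a t k powr (- ?s))) \<partial>?PN)"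
  proof (rule nn_integral_greedy_le[where H=H])
    show "sigma_finite_measure ?N" by (rule PS.sigma_finite_measures)
    show "(\<lambda>t. (\<Prod>k<n. ennreal (?K * (?D * r powr g))) * (\<Prod>k<n. ennreal (sep H r e a t k powr (- ?s)))) \<in> borel_measurable ?PN"
      by (intro borel_measurable_times_ennreal borel_measurable_prod_ennreal) auto
    show "ennreal (norm (\<integral>w. (\<Prod>j<n. ?f ((\<lambda>i\<in>{..<n}. t (xs ! i)) j) w) \<partial>M)) = ennreal (norm (\<integral>w. (\<Prod>j<n. ?f (t j) w) \<partial>M))"
      if "xs \<in> orderings n" for xs t
    proof -
      have "(\<Prod>j<n. ?f ((\<lambda>i\<in>{..<n}. t (xs ! i)) j) w) = (\<Prod>j<n. ?f (t (xs ! j)) w)" for w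
        by (intro prod.cong) auto
      also have "\<dots> w = (\<Prod>j<n. ?f (t j) w)" for w
        by (rule prod.reindex_bij_betw[OF orderings_bij[OF that], where g="\<lambda>j. ?f (t j) w"])
      finally show ?thesis by simp
    qed
    fix t assume t: "t \<in> space ?PN" and gr: "greedy H n t"
    have tT: "t i \<in> T" if "i < n" for i using that t S(2) by (auto simp: space_PiM space_restrict_space PiE_iff)
    have "ennreal (norm (\<integral>w. (\<Prod>j<n. ?f (t j) w) \<partial>M)) \<le> ennreal (\<Prod>k<n. ?K * (?D * r powr g) * sep H r e a t k powr (- ?s))"
      unfolding real_norm_def using n1 by (intro ennreal_leI expectation_prod_moll_difference_le tT g gr xy) auto
    also have "\<dots> = (\<Prod>k<n. ennreal (?K * (?D * r powr g))) * (\<Prod>k<n. ennreal (sep H r e a t k powr (- ?s)))"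
    proof -
      have "ennreal (\<Prod>k<n. ?K * (?D * r powr g) * sep H r e a t k powr (- ?s)) = (\<Prod>k<n. ennreal (?K * (?D * r powr g) * sep H r e a t k powr (- ?s)))"
        by (rule prod_ennreal[symmetric]) simp
      also have "\<dots> = (\<Prod>k<n. ennreal (?K * (?D * r powr g)) * ennreal (sep H r e a t k powr (- ?s)))"
        by (intro prod.cong refl ennreal_mult') simp
      also have "\<dots> = (\<Prod>k<n. ennreal (?K * (?D * r powr g))) * (\<Prod>k<n. ennreal (sep H r e a t k powr (- ?s)))"
        by (rule prod.distrib)
      finally show ?thesis .
    qed
    finally show "ennreal (norm (\<integral>w. (\<Prod>j<n. ?f (t j) w) \<partial>M)) \<le> \<dots>" .
  qed
  also have "(\<integral>\<^sup>+t. (\<Prod>k<n. ennreal (?K * (?D * r powr g))) * (\<Prod>k<n. ennreal (sep H r e a t k powr (- ?s))) \<partial>?PN)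
      = (\<Prod>k<n. ennreal (?K * (?D * r powr g))) * (\<integral>\<^sup>+t. (\<Prod>k<n. ennreal (sep H r e a t k powr (- ?s))) \<partial>?PN)"
    by (intro nn_integral_cmult borel_measurable_prod_ennreal) auto
  also have "of_nat (card (orderings n)) * \<dots> \<le> of_nat (card (orderings n)) * ((\<Prod>k<n. ennreal (?K * (?D * r powr g))) * (\<Prod>k<n. ennreal (?C k * r powr (?Q - ?s))))"
    using H01 r e g S cS by (intro mult_left_mono nn_integral_prod_sep_le) auto
  also have "\<dots> = ennreal (real (card (orderings n)) * (\<Prod>k<n. ?K * (?D * r powr g) * (?C k * r powr (?Q - ?s))))"
  proof -
    have C0: "0 \<le> ?C k" for k using cS singular_const_nonneg[OF g(3)] by simp
    have K0: "0 \<le> ?K * (?D * r powr g)" by simp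
    have "(\<Prod>k<n. ennreal (?K * (?D * r powr g))) * (\<Prod>k<n. ennreal (?C k * r powr (?Q - ?s))) = (\<Prod>k<n. ennreal (?K * (?D * r powr g) * (?C k * r powr (?Q - ?s))))"
      unfolding prod.distrib[symmetric] by (intro prod.cong refl ennreal_mult'[symmetric] K0)
    also have "\<dots> = ennreal (\<Prod>k<n. ?K * (?D * r powr g) * (?C k * r powr (?Q - ?s)))"
      by (rule prod_ennreal) (rule mult_nonneg_nonneg[OF K0 mult_nonneg_nonneg[OF C0]], simp)
    finally show ?thesis unfolding ennreal_of_nat_eq_real_of_nat by (simp only: ennreal_mult'[symmetric] of_nat_0_le_iff)
  qed
  also have "(\<Prod>k<n. ?K * (?D * r powr g) * (?C k * r powr (?Q - ?s))) = (\<Prod>k<n. ?K * ?C k * (?D * r powr (?Q - real CARD('d) - g)))"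
  proof (intro prod.cong refl)
    fix k
    have *: "r powr g * r powr (?Q - ?s) = r powr (?Q - real CARD('d) - g)"
      unfolding powr_add[symmetric] by (rule arg_cong[where f="\<lambda>x. _ powr x"]) simp
    have "?K * (?D * r powr g) * (?C k * r powr (?Q - ?s)) = ?K * ?C k * (?D * (r powr g * r powr (?Q - ?s)))"
      by (simp only: mult_ac)
    then show "?K * (?D * r powr g) * (?C k * r powr (?Q - ?s)) = ?K * ?C k * (?D * r powr (?Q - real CARD('d) - g))"
      by (simp only: *)
  qed
  also have "\<dots> = (\<Prod>k<n. ?K * ?C k) * (?D * r powr (?Q - real CARD('d) - g)) ^ n"
    by (subst prod.distrib) (simp only: prod_constant card_lessThan)
  finally show ?thesis by (simp only: mult.assoc)
qed

end

end

subsection \<open>The range of the field\<close>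

lemma tendsto_rho:
  fixes H :: "real ^ 'n::finite"
  assumes H: "\<And>j. 0 < H $ j" and f: "(f \<longlongrightarrow> s) F" and g: "(g \<longlongrightarrow> t) F"
  shows "((\<lambda>x. rho H (f x) (g x)) \<longlongrightarrow> rho H s t) F"
  unfolding rho_def
proof (intro tendsto_sum)
  fix j
  have "((\<lambda>x. \<bar>f x $ j - g x $ j\<bar>) \<longlongrightarrow> \<bar>s $ j - t $ j\<bar>) F"
    using f g by (intro tendsto_intros)
  then show "((\<lambda>x. \<bar>f x $ j - g x $ j\<bar> powr H $ j) \<longlongrightarrow> \<bar>s $ j - t $ j\<bar> powr H $ j) F"
    using H[of j] by (intro tendsto_powr') auto
qed

context smooth_field
begin

text \<open>T may be open while chaining runs over a closed box. The bound passes to the closure by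
  Fatou's lemma, applied to a component of X, because continuity of paths is at hand for X and not
  for Y.\<close>

lemma increment_variance_closure:
  assumes t: "t \<in> closure T" and s: "s \<in> closure T"
  shows "(\<integral>w. (Y t w - Y s w)\<^sup>2 \<partial>M') \<le> C2 * (rho H t s)\<^sup>2"
proof -
  obtain t' where t': "\<And>n. t' n \<in> T" "t' \<longlonglongrightarrow> t" using t by (auto simp: closure_sequential)
  obtain s' where s': "\<And>n. s' n \<in> T" "s' \<longlonglongrightarrow> s" using s by (auto simp: closure_sequential)
  have P': "prob_space M'" using Y_field by (simp add: centered_gaussian_field_def)
  have nn: "(\<integral>\<^sup>+w. ennreal ((Y t w - Y s w)\<^sup>2) \<partial>M') = ennreal (\<integral>w. (Y t w - Y s w)\<^sup>2 \<partial>M')" for t s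
    using centered_gaussian_char(2)[OF P' increment_gaussian[OF Y_field], of t s 1]
    by (intro nn_integral_eq_integral) auto
  have XY: "(\<integral>\<^sup>+w. ennreal ((X t w $ c - X s w $ c)\<^sup>2) \<partial>M) = ennreal (\<integral>w. (Y t w - Y s w)\<^sup>2 \<partial>M')" for t s c
    using moment[of t c s 1] nn[of t s] by simp
  obtain c :: 'd where True by simp
  have "ennreal (\<integral>w. (Y t w - Y s w)\<^sup>2 \<partial>M') = (\<integral>\<^sup>+w. ennreal ((X t w $ c - X s w $ c)\<^sup>2) \<partial>M)" by (rule XY[symmetric])
  also have "\<dots> = (\<integral>\<^sup>+w. liminf (\<lambda>n. ennreal ((X (t' n) w $ c - X (s' n) w $ c)\<^sup>2)) \<partial>M)"
  proof (intro nn_integral_cong)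
    fix w assume w: "w \<in> space M"
    have "(\<lambda>n. X (t' n) w) \<longlonglongrightarrow> X t w" "(\<lambda>n. X (s' n) w) \<longlonglongrightarrow> X s w"
      using continuous_on_tendsto_compose[OF X_cont[OF w] t'(2)] continuous_on_tendsto_compose[OF X_cont[OF w] s'(2)] by auto
    then have "(\<lambda>n. ennreal ((X (t' n) w $ c - X (s' n) w $ c)\<^sup>2)) \<longlonglongrightarrow> ennreal ((X t w $ c - X s w $ c)\<^sup>2)"
      by (intro tendsto_intros tendsto_ennrealI)
    then show "ennreal ((X t w $ c - X s w $ c)\<^sup>2) = liminf (\<lambda>n. ennreal ((X (t' n) w $ c - X (s' n) w $ c)\<^sup>2))"
      by (intro lim_imp_Liminf[symmetric]) auto
  qed
  also have "\<dots> \<le> liminf (\<lambda>n. \<integral>\<^sup>+w. ennreal ((X (t' n) w $ c - X (s' n) w $ c)\<^sup>2) \<partial>M)"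
    by (intro nn_integral_liminf) measurable
  also have "\<dots> \<le> liminf (\<lambda>n. ennreal (C2 * (rho H (t' n) (s' n))\<^sup>2))"
    unfolding XY using t' s' by (intro Liminf_mono always_eventually allI ennreal_leI C2(2)) auto
  also have "\<dots> = ennreal (C2 * (rho H t s)\<^sup>2)"
    using H01(1) t'(2) s'(2) by (intro lim_imp_Liminf tendsto_ennrealI tendsto_intros tendsto_rho) auto
  finally show ?thesis using C2(1) by (subst (asm) ennreal_le_iff) auto
qed

lemma increment_moment_le:
  assumes "t \<in> closure T" "s \<in> closure T"
  shows "(\<integral>\<^sup>+w. ennreal (\<bar>X t w $ c - X s w $ c\<bar> ^ (2 * k)) \<partial>M)
    \<le> ennreal (fact (2 * k) / (2 ^ k * fact k) * C2 ^ k * rho H t s ^ (2 * k))"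
proof -
  have P': "prob_space M'" using Y_field by (simp add: centered_gaussian_field_def)
  have "(\<integral>\<^sup>+w. ennreal (\<bar>X t w $ c - X s w $ c\<bar> ^ (2 * k)) \<partial>M) = (\<integral>\<^sup>+w. ennreal ((Y t w - Y s w) ^ (2 * k)) \<partial>M')"
    using moment[of t c s k] by (simp add: power_even_abs)
  also have "\<dots> = ennreal (\<integral>w. (Y t w - Y s w) ^ (2 * k) \<partial>M')"
    using centered_gaussian_char(2)[OF P' increment_gaussian[OF Y_field]]
    by (intro nn_integral_eq_integral) auto
  also have "(\<integral>w. (Y t w - Y s w) ^ (2 * k) \<partial>M') = fact (2 * k) / (2 ^ k * fact k) * (\<integral>w. (Y t w - Y s w)\<^sup>2 \<partial>M') ^ k"
    by (rule centered_gaussian_char(3)[OF P' increment_gaussian[OF Y_field]])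
  also have "ennreal \<dots> \<le> ennreal (fact (2 * k) / (2 ^ k * fact k) * (C2 * (rho H t s)\<^sup>2) ^ k)"
    by (intro ennreal_leI mult_left_mono power_mono increment_variance_closure assms) auto
  also have "fact (2 * k) / (2 ^ k * fact k) * (C2 * (rho H t s)\<^sup>2) ^ k = fact (2 * k) / (2 ^ k * fact k) * C2 ^ k * rho H t s ^ (2 * k)"
    by (simp only: power_mult_distrib power_mult mult.assoc)
  finally show ?thesis .
qed

lemma Lmoll_continuous:
  assumes S: "S \<in> sets borel" "emeasure lborel S < \<infinity>" and e: "e > 0" and w: "w \<in> space M"
  shows "continuous_on UNIV (\<lambda>x. Lmoll S e a x w)"
proof (rule continuous_on_sequentiallyI)
  fix u :: "nat \<Rightarrow> real ^ 'd" and x assume u: "u \<longlonglongrightarrow> x"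
  have fin: "finite_measure (restrict_space lborel S)"
  proof
    have "emeasure (restrict_space lborel S) (space (restrict_space lborel S)) = emeasure lborel S"
      using S by (subst emeasure_restrict_space) (auto simp: space_restrict_space)
    then show "emeasure (restrict_space lborel S) (space (restrict_space lborel S)) \<noteq> \<infinity>"
      using S(2) by auto
  qed
  show "(\<lambda>n. Lmoll S e a (u n) w) \<longlonglongrightarrow> Lmoll S e a x w"
    unfolding Lmoll_def
  proof (rule integral_dominated_convergence[where w="\<lambda>_. mbound e"])
    show "integrable (restrict_space lborel S) (\<lambda>_. mbound e)" using fin by (simp add: finite_measure.integrable_const)
    show "AE t in restrict_space lborel S. (\<lambda>n. moll e a (u n) t w) \<longlonglongrightarrow> moll e a x t w"
      unfolding moll_def normal_density_def using e
      by (intro AE_I2 tendsto_intros u) auto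
    show "AE t in restrict_space lborel S. norm (moll e a (u n) t w) \<le> mbound e" for n
      using moll_bounds[OF e] by auto
  qed (use w in measurable)
qed

end

locale box_field = smooth_field M X M' Y T H \<kappa> C2
  for M :: "'w measure" and X :: "real ^ 'n::finite \<Rightarrow> 'w \<Rightarrow> real ^ 'd::finite"
    and M' :: "'v measure" and Y T H \<kappa> C2 +
  fixes \<tau> h :: "real ^ 'n"
  assumes h_pos: "\<And>j. 0 < h $ j"
    and T_interval: "T = cbox \<tau> (\<tau> + h) \<or> T = box \<tau> (\<tau> + h)"
begin

text \<open>The lower faces are excluded, so that its local time is a finite difference of local times of corner
  rectangles; the factor 2 keeps the \<open>\<rho>\<close>-ball inside.\<close>

definition locbox :: "real ^ 'n \<Rightarrow> real \<Rightarrow> (real ^ 'n) set" where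
  "locbox a r = {t. \<forall>j. a $ j - 2 * r powr (1 / H $ j) < t $ j \<and> t $ j \<le> a $ j + 2 * r powr (1 / H $ j)}"

lemma T_borel [measurable]: "T \<in> sets borel"
  using T_interval by auto

lemma locbox_borel [measurable]: "locbox a r \<in> sets borel"
  unfolding locbox_def by measurable

lemma T_subset: "T \<subseteq> cbox \<tau> (\<tau> + h)"
  using T_interval box_subset_cbox by auto

lemma closure_T: "closure T = cbox \<tau> (\<tau> + h)"
proof -
  have "box \<tau> (\<tau> + h) \<noteq> {}" using h_pos by (auto simp: interval_ne_empty_cart)
  from closure_box[OF this] show ?thesis using T_interval by (elim disjE) simp_all
qed

lemma rho_ball_subset_locbox:
  assumes "r > 0" shows "rho_ball H a r \<subseteq> locbox a r"
proof
  fix t assume "t \<in> rho_ball H a r"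
  then have *: "\<bar>t $ j - a $ j\<bar> \<le> r powr (1 / H $ j)" for j
    using rho_le_imp_abs_le[OF H01(1)] by (auto simp: rho_ball_def)
  show "t \<in> locbox a r" unfolding locbox_def
  proof (intro CollectI allI conjI)
    fix j
    have "0 < r powr (1 / H $ j)" using assms by simp
    then show "a $ j - 2 * r powr (1 / H $ j) < t $ j" "t $ j \<le> a $ j + 2 * r powr (1 / H $ j)"
      using *[of j] by linarith+
  qed
qed

lemma emeasure_locbox_le:
  assumes "r > 0"
  shows "emeasure lborel (T \<inter> locbox a r) \<le> ennreal (4 ^ CARD('n) * r powr Q_dim H)"
proof -
  let ?l = "\<chi> j. a $ j - 2 * r powr (1 / H $ j)" and ?u = "\<chi> j. a $ j + 2 * r powr (1 / H $ j)"
  have "T \<inter> locbox a r \<subseteq> cbox ?l ?u" unfolding locbox_def by (auto simp: mem_box_cart less_imp_le)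
  then have "emeasure lborel (T \<inter> locbox a r) \<le> emeasure lborel (cbox ?l ?u)"
    by (intro emeasure_mono) auto
  also have "\<dots> = ennreal (\<Prod>j\<in>UNIV. 4 * r powr (1 / H $ j))"
    by (subst emeasure_lborel_cbox_cart) (auto simp: algebra_simps)
  also have "(\<Prod>j\<in>UNIV. 4 * r powr (1 / H $ j)) = 4 ^ CARD('n) * r powr Q_dim H"
    using assms by (simp add: prod.distrib prod_powr_inverse_eq_Q)
  finally show ?thesis .
qed

text \<open>Chaining works with one exponent for all coordinate directions; the smallest H_j serves,
  since distances in the unit cube are at most 1. It also sets the mesh of the grid of centres in
  the uniform law.\<close>

definition eta :: real where "eta = Min (range (\<lambda>j. H $ j))"

lemma eta: "0 < eta" "eta \<le> H $ j"
proof -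
  have "eta \<in> range (\<lambda>j. H $ j)" unfolding eta_def by (intro Min_in) auto
  then show "0 < eta" using H01(1) by auto
  show "eta \<le> H $ j" unfolding eta_def by (intro Min_le) auto
qed

text \<open>An affine image of the unit cube contains the part of T in question. Its j-th side is at
  most 4 r^(1/H_j), so in cube coordinates the increments along one axis scale like r times the
  power \<open>eta\<close> of the distance. Quadratic decay in m is enough: m will be exp(n), which
  matches the order exp(-2n) of the other exceptional events.\<close>

lemma range_tail:
  obtains C where "0 \<le> C" "\<And>a (r :: real) m. a \<in> T \<Longrightarrow> 0 < r \<Longrightarrow> 1 \<le> m \<Longrightarrow>
    \<exists>E\<in>sets M. emeasure M E \<le> ennreal (C / m\<^sup>2) \<and>
      (\<forall>w\<in>space M - E. \<forall>t\<in>T \<inter> locbox a r. \<forall>c. \<bar>X t w $ c - X a w $ c\<bar> \<le> m * r)"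
proof -
  \<comment> \<open>A moment of order 2 k with 2 k \<open>eta\<close> above the dimension of time,
    as chaining requires.\<close>
  obtain k0 :: nat where k0: "real CARD('n) / (2 * eta) < real k0" using reals_Archimedean2 by blast
  define k where "k = max k0 1"
  have k1: "k \<ge> 1" unfolding k_def by simp
  have "real CARD('n) / (2 * eta) < real k" using k0 unfolding k_def by simp
  then have th: "real CARD('n) < 2 * real k * eta" using eta(1) by (simp add: field_simps)
  define G where "G = fact (2 * k) / (2 ^ k * fact k) * C2 ^ k"
  have G0: "0 \<le> G" unfolding G_def using C2(1) by simp
  let ?ch = "chain_const CARD('n) (2 * k) (2 * real k * eta)"
  have ch0: "0 \<le> ?ch" using th k1 by (intro chain_const_nonneg) auto
  define C where "C = real CARD('d) * (?ch * (G * 8 ^ (2 * k)))"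
  have C0: "0 \<le> C" unfolding C_def using G0 ch0 by simp
  show ?thesis
  proof (rule that[OF C0])
    fix a and r m :: real assume a: "a \<in> T" and r: "0 < r" and m: "1 \<le> m"
    define l where "l = (\<chi> j. max (\<tau> $ j) (a $ j - 2 * r powr (1 / H $ j)))"
    define v where "v = (\<chi> j. min (\<tau> $ j + h $ j) (a $ j + 2 * r powr (1 / H $ j)))"
    define pt where "pt = (\<lambda>s :: real ^ 'n. \<chi> j. l $ j + s $ j * (v $ j - l $ j))"
    have aT: "\<tau> $ j \<le> a $ j" "a $ j \<le> \<tau> $ j + h $ j" for j
      using a T_subset by (auto simp: mem_box_cart)
    have rp: "0 < r powr (1 / H $ j)" for j using r by simp
    have lv: "l $ j \<le> a $ j" "a $ j \<le> v $ j" for j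
      unfolding l_def v_def using aT[of j] rp[of j] by auto
    have side: "0 \<le> v $ j - l $ j" "v $ j - l $ j \<le> 4 * r powr (1 / H $ j)" for j
    proof -
      have "v $ j \<le> a $ j + 2 * r powr (1 / H $ j)" "a $ j - 2 * r powr (1 / H $ j) \<le> l $ j"
        unfolding l_def v_def by auto
      then show "0 \<le> v $ j - l $ j" "v $ j - l $ j \<le> 4 * r powr (1 / H $ j)" using lv[of j] by linarith+
    qed
    have pt_cl: "pt s \<in> closure T" if "s \<in> cbox 0 1" for s
      unfolding closure_T mem_box_cart
    proof
      fix j
      have s: "0 \<le> s $ j" "s $ j \<le> 1" using that by (auto simp: mem_box_cart)
      have "0 \<le> s $ j * (v $ j - l $ j)" using s side(1)[of j] by simp
      moreover have "s $ j * (v $ j - l $ j) \<le> 1 * (v $ j - l $ j)"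
        using s side(1)[of j] by (intro mult_right_mono) simp_all
      moreover have "\<tau> $ j \<le> l $ j" "v $ j \<le> \<tau> $ j + h $ j" unfolding l_def v_def by auto
      ultimately show "\<tau> $ j \<le> pt s $ j \<and> pt s $ j \<le> (\<tau> + h) $ j"
        unfolding pt_def by simp
    qed
    have onto: "\<exists>s\<in>cbox 0 1. pt s = t" if t: "\<And>j. l $ j \<le> t $ j" "\<And>j. t $ j \<le> v $ j" for t
    proof (rule bexI)
      let ?s = "\<chi> j. if v $ j = l $ j then 0 else (t $ j - l $ j) / (v $ j - l $ j)"
      show "pt ?s = t"
        unfolding pt_def vec_eq_iff
      proof
        fix j show "(\<chi> j. l $ j + ?s $ j * (v $ j - l $ j)) $ j = t $ j"
          using t[of j] by (cases "v $ j = l $ j") auto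
      qed
      have "0 \<le> ?s $ j \<and> ?s $ j \<le> 1" for j
        using t[of j] side(1)[of j] by (cases "v $ j = l $ j") (auto simp: divide_le_eq)
      then show "?s \<in> cbox 0 1" by (auto simp: mem_box_cart)
    qed
    have incr: "(\<integral>\<^sup>+w. ennreal (\<bar>X (pt s) w $ c - X (pt t) w $ c\<bar> ^ (2 * k)) \<partial>M)
        \<le> ennreal (G * (4 * r) ^ (2 * k) * \<bar>s $ j - t $ j\<bar> powr (2 * real k * eta))"
      if s: "s \<in> cbox 0 1" and t: "t \<in> cbox 0 1" and st: "\<And>i. i \<noteq> j \<Longrightarrow> s $ i = t $ i" for s t j c
    proof -
      have "rho H (pt s) (pt t) = (\<Sum>i\<in>UNIV. if i = j then \<bar>pt s $ j - pt t $ j\<bar> powr H $ j else 0)"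
        unfolding rho_def using st by (intro sum.cong) (auto simp: pt_def)
      also have "\<dots> = \<bar>pt s $ j - pt t $ j\<bar> powr H $ j" by simp
      also have "pt s $ j - pt t $ j = (s $ j - t $ j) * (v $ j - l $ j)"
        unfolding pt_def by (simp add: left_diff_distrib)
      also have "\<bar>(s $ j - t $ j) * (v $ j - l $ j)\<bar> = \<bar>s $ j - t $ j\<bar> * (v $ j - l $ j)"
        using side(1)[of j] by (simp add: abs_mult)
      also have "(\<bar>s $ j - t $ j\<bar> * (v $ j - l $ j)) powr H $ j = \<bar>s $ j - t $ j\<bar> powr H $ j * (v $ j - l $ j) powr H $ j"
        by (rule powr_mult)
      also have "\<dots> \<le> \<bar>s $ j - t $ j\<bar> powr eta * (4 * r)"
      proof (rule mult_mono)
        have "0 \<le> s $ j" "s $ j \<le> 1" "0 \<le> t $ j" "t $ j \<le> 1" using s t by (auto simp: mem_box_cart)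
        then have "\<bar>s $ j - t $ j\<bar> \<le> 1" by linarith
        then show "\<bar>s $ j - t $ j\<bar> powr H $ j \<le> \<bar>s $ j - t $ j\<bar> powr eta"
          using eta(2)[of j] by (cases "s $ j = t $ j") (auto intro!: powr_mono')
        have "(v $ j - l $ j) powr H $ j \<le> (4 * r powr (1 / H $ j)) powr H $ j"
          using side[of j] H01(1)[of j] by (intro powr_mono2) auto
        also have "\<dots> = 4 powr H $ j * (r powr (1 / H $ j)) powr H $ j" by (rule powr_mult)
        also have "(r powr (1 / H $ j)) powr H $ j = r"
          using H01(1)[of j] r by (simp add: powr_powr)
        also have "4 powr H $ j * r \<le> 4 * r"
          using powr_mono[of "H $ j" 1 4] H01(2)[of j] r by (intro mult_right_mono) auto
        finally show "(v $ j - l $ j) powr H $ j \<le> 4 * r" .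
      qed auto
      finally have "rho H (pt s) (pt t) ^ (2 * k) \<le> (\<bar>s $ j - t $ j\<bar> powr eta * (4 * r)) ^ (2 * k)"
        by (intro power_mono rho_nonneg)
      also have "\<dots> = (4 * r) ^ (2 * k) * \<bar>s $ j - t $ j\<bar> powr (2 * real k * eta)"
      proof -
        have "(\<bar>s $ j - t $ j\<bar> powr eta) ^ (2 * k) = \<bar>s $ j - t $ j\<bar> powr (2 * real k * eta)"
        proof (cases "s $ j = t $ j")
          case True then show ?thesis using k1 by simp
        next
          case False
          then have "0 < \<bar>s $ j - t $ j\<bar> powr eta" by simp
          then have "(\<bar>s $ j - t $ j\<bar> powr eta) ^ (2 * k) = (\<bar>s $ j - t $ j\<bar> powr eta) powr real (2 * k)"
            by (rule powr_realpow[symmetric])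
          then show ?thesis by (simp add: powr_powr mult.commute)
        qed
        then show ?thesis by (simp only: power_mult_distrib mult.commute)
      qed
      finally have le: "rho H (pt s) (pt t) ^ (2 * k) \<le> (4 * r) ^ (2 * k) * \<bar>s $ j - t $ j\<bar> powr (2 * real k * eta)" .
      have "(\<integral>\<^sup>+w. ennreal (\<bar>X (pt s) w $ c - X (pt t) w $ c\<bar> ^ (2 * k)) \<partial>M) \<le> ennreal (G * rho H (pt s) (pt t) ^ (2 * k))"
        unfolding G_def by (intro increment_moment_le pt_cl s t)
      also have "\<dots> \<le> ennreal (G * ((4 * r) ^ (2 * k) * \<bar>s $ j - t $ j\<bar> powr (2 * real k * eta)))"
        by (intro ennreal_leI mult_left_mono le G0)
      finally show ?thesis by (simp only: mult.assoc)
    qed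
    \<comment> \<open>The level is m r / 2 because chaining compares with the corner
      \<open>pt 0\<close> and not with a, so that two comparisons are needed. The quotient of 4 r
      and m r / 2 is the 8 / m behind the constant C.\<close>
    have "\<exists>E. E \<in> sets M \<and> emeasure M E \<le> ennreal (?ch * (G * (4 * r) ^ (2 * k)) / (m * r / 2) ^ (2 * k)) \<and>
        (\<forall>w s. w \<in> space M - E \<longrightarrow> s \<in> cbox 0 1 \<longrightarrow> \<bar>X (pt s) w $ c - X (pt 0) w $ c\<bar> \<le> m * r / 2)" for c
    proof (rule chaining[of "\<lambda>s w. X (pt s) w $ c" M "2 * k" "2 * real k * eta" "G * (4 * r) ^ (2 * k)" "m * r / 2"])
      show "(\<lambda>w. X (pt s) w $ c) \<in> borel_measurable M" for s by measurable
      show "continuous_on (cbox 0 1) (\<lambda>s. X (pt s) w $ c)" if "w \<in> space M" for w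
      proof (intro continuous_intros continuous_on_compose2[OF X_cont[OF that]])
        show "continuous_on (cbox 0 1) pt" unfolding pt_def by (intro continuous_on_vec_lambda continuous_intros)
      qed auto
    qed (use incr k1 th G0 r m in auto)
    then obtain E where E: "\<And>c. E c \<in> sets M" "\<And>c. emeasure M (E c) \<le> ennreal (?ch * (G * (4 * r) ^ (2 * k)) / (m * r / 2) ^ (2 * k))"
        "\<And>c w s. w \<in> space M - E c \<Longrightarrow> s \<in> cbox 0 1 \<Longrightarrow> \<bar>X (pt s) w $ c - X (pt 0) w $ c\<bar> \<le> m * r / 2"
      by metis
    show "\<exists>E\<in>sets M. emeasure M E \<le> ennreal (C / m\<^sup>2) \<and>
      (\<forall>w\<in>space M - E. \<forall>t\<in>T \<inter> locbox a r. \<forall>c. \<bar>X t w $ c - X a w $ c\<bar> \<le> m * r)"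
    proof (intro bexI[of _ "\<Union>c\<in>UNIV. E c"] conjI ballI allI)
      have eq: "(G * (4 * r) ^ (2 * k)) / (m * r / 2) ^ (2 * k) = G * 8 ^ (2 * k) / m ^ (2 * k)"
      proof -
        have "(4 * r) ^ (2 * k) / (m * r / 2) ^ (2 * k) = (4 * r / (m * r / 2)) ^ (2 * k)" by (rule power_divide[symmetric])
        also have "4 * r / (m * r / 2) = 8 / m" using r m by (simp add: field_simps)
        finally show ?thesis by (simp only: times_divide_eq_right[symmetric] power_divide)
      qed
      have "emeasure M (\<Union>c\<in>UNIV. E c) \<le> (\<Sum>c\<in>UNIV. emeasure M (E c))"
        using E(1) by (intro emeasure_subadditive_finite) auto
      also have "\<dots> \<le> (\<Sum>c\<in>(UNIV :: 'd set). ennreal (?ch * (G * 8 ^ (2 * k) / m ^ (2 * k))))"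
      proof (intro sum_mono)
        fix c
        have "?ch * (G * (4 * r) ^ (2 * k)) / (m * r / 2) ^ (2 * k) = ?ch * (G * 8 ^ (2 * k) / m ^ (2 * k))"
          using arg_cong[OF eq, of "\<lambda>x. ?ch * x"] by (simp only: times_divide_eq_right)
        with E(2)[of c] show "emeasure M (E c) \<le> ennreal (?ch * (G * 8 ^ (2 * k) / m ^ (2 * k)))" by (simp only:)
      qed
      also have "\<dots> = ennreal (real CARD('d) * (?ch * (G * 8 ^ (2 * k) / m ^ (2 * k))))"
        unfolding sum_constant ennreal_of_nat_eq_real_of_nat
        by (rule ennreal_mult'[symmetric]) simp
      also have "\<dots> \<le> ennreal (C / m\<^sup>2)"
      proof (rule ennreal_leI)
        have "m\<^sup>2 \<le> m ^ (2 * k)" using m k1 by (intro power_increasing) auto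
        then have "C / m ^ (2 * k) \<le> C / m\<^sup>2" using m C0 by (intro divide_left_mono) auto
        then show "real CARD('d) * (?ch * (G * 8 ^ (2 * k) / m ^ (2 * k))) \<le> C / m\<^sup>2" unfolding C_def by simp
      qed
      finally show "emeasure M (\<Union>c\<in>UNIV. E c) \<le> ennreal (C / m\<^sup>2)" .
    next
      fix w t c assume w: "w \<in> space M - (\<Union>c\<in>UNIV. E c)" and t: "t \<in> T \<inter> locbox a r"
      have "l $ j \<le> t $ j" "t $ j \<le> v $ j" for j
        using t T_subset by (auto simp: l_def v_def locbox_def mem_box_cart less_imp_le)
      then obtain s where s: "s \<in> cbox 0 1" "pt s = t" using onto by blast
      obtain s' where s': "s' \<in> cbox 0 1" "pt s' = a" using onto[of a] lv by blast
      have "\<bar>X t w $ c - X (pt 0) w $ c\<bar> \<le> m * r / 2" "\<bar>X a w $ c - X (pt 0) w $ c\<bar> \<le> m * r / 2"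
        using E(3)[of w c s] E(3)[of w c s'] w s s' by auto
      then show "\<bar>X t w $ c - X a w $ c\<bar> \<le> m * r" by linarith
    qed (use E(1) in auto)
  qed
qed

end

subsection \<open>Tails of the mollified local time\<close>

context box_field
begin

definition moment_const :: real where
  "moment_const = ((\<kappa> / 2) powr (- (1/2))) ^ CARD('d) * (4 ^ CARD('n) + singular_const CARD('n) (Q_dim H) (real CARD('d)))"

lemma moment_const_pos: "0 < moment_const"
  unfolding moment_const_def using kappa_bounds singular_const_nonneg[OF dQ, of "CARD('n)"]
  by (intro mult_pos_pos zero_less_power add_pos_nonneg) auto

abbreviation bigS :: "real ^ 'n \<Rightarrow> real \<Rightarrow> (real ^ 'n) set" where
  "bigS a r \<equiv> T \<inter> locbox a r"

text \<open>The growth in n is that of the n-th root of the n-th moment. With n comparable to log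
  log (1/r) or to log (1/r) this is one of the two gauges up to a constant.\<close>

definition rate :: "real \<Rightarrow> nat \<Rightarrow> real" where
  "rate r n = real n powr (real CARD('d) / Q_dim H) * r powr (Q_dim H - real CARD('d))"

text \<open>Markov's inequality with the same n in the level and in the order of the moment; the
  choice of A makes the exponential rate in n as large as desired.\<close>

lemma Lmoll_gt_tail:
  assumes a: "a \<in> T" and r: "0 < r" and e: "0 < e" and n: "1 \<le> n" and A: "0 < A"
  shows "emeasure M {w \<in> space M. A * rate r n < Lmoll (bigS a r) e a x w} \<le> ennreal ((2 * moment_const / A) ^ n)"
proof -
  let ?S = "bigS a r"
  have S: "?S \<in> sets borel" "?S \<subseteq> T" by auto
  have cS: "(0::real) \<le> 4 ^ CARD('n)" by simp
  let ?t = "\<lambda>k::nat. moment_const * real (k + 2) powr (real CARD('d) / Q_dim H) * r powr (Q_dim H - real CARD('d))"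
  have Q0: "0 < Q_dim H" using dQ by (metis of_nat_0_le_iff order_le_less_trans)
  have "(\<integral>\<^sup>+w. ennreal (Lmoll ?S e a x w ^ n) \<partial>M) \<le> (\<Prod>k<n. ennreal (?t k))"
    using Lmoll_moment_le[OF S a r e cS emeasure_locbox_le[OF r], of x n]
    unfolding moment_const_def by (simp only: mult.assoc)
  also have "\<dots> = ennreal (\<Prod>k<n. ?t k)" using moment_const_pos by (intro prod_ennreal) (simp add: less_imp_le)
  also have "\<dots> \<le> ennreal ((2 * moment_const * rate r n) ^ n)"
  proof (rule ennreal_leI)
    have "(\<Prod>k<n. ?t k) \<le> (\<Prod>k<n. 2 * moment_const * rate r n)"
    proof (intro prod_mono conjI)
      fix k assume k: "k \<in> {..<n}"
      \<comment> \<open>Here k + 2 \<le> 2 n because k < n and n \<ge> 1, and since d/Q is below 1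
        the doubling costs at most a factor 2.\<close>
      have "real (k + 2) powr (real CARD('d) / Q_dim H) \<le> (2 * real n) powr (real CARD('d) / Q_dim H)"
        using k n Q0 by (intro powr_mono2) auto
      also have "\<dots> = 2 powr (real CARD('d) / Q_dim H) * real n powr (real CARD('d) / Q_dim H)" by (rule powr_mult)
      also have "\<dots> \<le> 2 * real n powr (real CARD('d) / Q_dim H)"
        using powr_mono[of "real CARD('d) / Q_dim H" 1 2] dQ Q0 by (intro mult_right_mono) auto
      finally have "moment_const * real (k + 2) powr (real CARD('d) / Q_dim H) * r powr (Q_dim H - real CARD('d)) \<le> moment_const * (2 * real n powr (real CARD('d) / Q_dim H)) * r powr (Q_dim H - real CARD('d))"
        using moment_const_pos by (intro mult_right_mono mult_left_mono) auto
      then show "?t k \<le> 2 * moment_const * rate r n" unfolding rate_def by (simp only: mult_ac)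
      show "0 \<le> ?t k" using moment_const_pos by simp
    qed
    then show "(\<Prod>k<n. ?t k) \<le> (2 * moment_const * rate r n) ^ n" by simp
  qed
  finally have mom: "(\<integral>\<^sup>+w. ennreal (Lmoll ?S e a x w ^ n) \<partial>M) \<le> ennreal ((2 * moment_const * rate r n) ^ n)" .
  have sc: "0 < rate r n" unfolding rate_def using n r by simp
  have "emeasure M {w \<in> space M. A * rate r n < Lmoll ?S e a x w} \<le> ennreal ((2 * moment_const * rate r n) ^ n / (A * rate r n) ^ n)"
  proof (rule emeasure_gt_le_of_moment[OF _ _ mom])
    show "Lmoll ?S e a x \<in> borel_measurable M" by (rule Lmoll_measurable[OF S a r e cS emeasure_locbox_le[OF r]])
  qed (use A sc in simp)
  also have "(2 * moment_const * rate r n) ^ n / (A * rate r n) ^ n = (2 * moment_const / A) ^ n"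
  proof -
    have "2 * moment_const * rate r n / (A * rate r n) = 2 * moment_const / A" using sc by simp
    then show ?thesis by (simp only: power_divide[symmetric])
  qed
  finally show ?thesis .
qed

text \<open>On a cell of side r exp(-n) a moment of fixed order p gains exp(-g p n). With g p \<ge>
  2 d + 2 this beats the number of cells, of order exp(2 d n), and leaves exp(-2n). The powers of r
  cancel exactly.\<close>

lemma Lmoll_oscillation_tail:
  obtains C where "0 \<le> C" "\<And>a r e n x. a \<in> T \<Longrightarrow> 0 < r \<Longrightarrow> 0 < e \<Longrightarrow>
    \<exists>E\<in>sets M. emeasure M E \<le> ennreal (C * exp (- (2 * real CARD('d) + 2) * real n)) \<and>
      (\<forall>w\<in>space M - E. \<forall>s\<in>cbox 0 1. \<bar>Lmoll (bigS a r) e a (x + (r * exp (- real n)) *\<^sub>R s) w - Lmoll (bigS a r) e a x w\<bar> \<le> r powr (Q_dim H - real CARD('d)))"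
proof -
  \<comment> \<open>A quarter of the gap between d and Q, so that 2 g uses at most half of the
    gap.\<close>
  define g where "g = min 1 ((Q_dim H - real CARD('d)) / 4)"
  have g: "0 < g" "g \<le> 1" "real CARD('d) + 2 * g < Q_dim H" unfolding g_def using dQ by (auto simp: min_def field_simps)
  obtain k0 :: nat where k0: "(2 * real CARD('d) + 2) / (2 * g) < real k0" using reals_Archimedean2 by blast
  \<comment> \<open>Even, as the difference moments require, and large enough both for the number of
    cells and for chaining in dimension d.\<close>
  define p where "p = 2 * (k0 + 1)"
  have p: "1 \<le> p" "even p" "0 < p" unfolding p_def by auto
  have gp: "2 * real CARD('d) + 2 \<le> g * real p"
  proof -
    have "2 * real CARD('d) + 2 < real k0 * (2 * g)" using k0 g by (simp add: divide_less_eq)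
    also have "\<dots> \<le> g * real p" unfolding p_def using g by (simp add: algebra_simps)
    finally show ?thesis by simp
  qed
  then have th: "real CARD('d) < g * real p" by (smt (verit) of_nat_0_le_iff)
  define CD where "CD = real (card (orderings p)) * (\<Prod>k<p. (16 * real p * (\<kappa> / 2) powr (- (g / 2)) * ((\<kappa> / 2) powr (- (1/2))) ^ CARD('d))
         * ((4 ^ CARD('n) + singular_const CARD('n) (Q_dim H) (real CARD('d) + 2 * g)) * real (k + 2) powr ((real CARD('d) + 2 * g) / Q_dim H)))"
  have CD0: "0 \<le> CD" unfolding CD_def using singular_const_nonneg[OF g(3)]
    by (intro mult_nonneg_nonneg prod_nonneg add_nonneg_nonneg) auto
  let ?ch = "chain_const CARD('d) p (g * real p)"
  have ch0: "0 \<le> ?ch" using th p by (intro chain_const_nonneg) auto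
  show ?thesis
  proof (rule that[of "?ch * CD"])
    show "0 \<le> ?ch * CD" using ch0 CD0 by simp
    fix a and r e :: real and n :: nat and x :: "real ^ 'd"
    assume a: "a \<in> T" and r: "0 < r" and e: "0 < e"
    let ?S = "bigS a r"
    have S: "?S \<in> sets borel" "?S \<subseteq> T" by auto
    have cS: "(0::real) \<le> 4 ^ CARD('n)" by simp
    define \<delta> where "\<delta> = r * exp (- real n)"
    have d0: "0 < \<delta>" unfolding \<delta>_def using r by simp
    define Z where "Z = (\<lambda>s w. Lmoll ?S e a (x + \<delta> *\<^sub>R s) w)"
    define K where "K = CD * (\<delta> powr g * r powr (Q_dim H - real CARD('d) - g)) ^ p"
    have incr: "(\<integral>\<^sup>+w. ennreal (\<bar>Z s w - Z t w\<bar> ^ p) \<partial>M) \<le> ennreal (K * \<bar>s $ j - t $ j\<bar> powr (g * real p))"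
      if st: "\<And>i. i \<noteq> j \<Longrightarrow> s $ i = t $ i" for s t j
    proof -
      have "(\<integral>\<^sup>+w. ennreal (\<bar>Z s w - Z t w\<bar> ^ p) \<partial>M)
         \<le> ennreal (CD * (\<bar>(x + \<delta> *\<^sub>R s) $ j - (x + \<delta> *\<^sub>R t) $ j\<bar> powr g * r powr (Q_dim H - real CARD('d) - g)) ^ p)"
        unfolding Z_def CD_def
        using st by (intro Lmoll_difference_moment_le[OF S a r e cS emeasure_locbox_le[OF r] g p(1,2)]) auto
      also have "(x + \<delta> *\<^sub>R s) $ j - (x + \<delta> *\<^sub>R t) $ j = \<delta> * (s $ j - t $ j)" by (simp add: right_diff_distrib)
      also have "\<bar>\<delta> * (s $ j - t $ j)\<bar> = \<delta> * \<bar>s $ j - t $ j\<bar>" using d0 by (simp add: abs_mult)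
      also have "(\<delta> * \<bar>s $ j - t $ j\<bar>) powr g = \<delta> powr g * \<bar>s $ j - t $ j\<bar> powr g" by (rule powr_mult)
      also have "CD * (\<delta> powr g * \<bar>s $ j - t $ j\<bar> powr g * r powr (Q_dim H - real CARD('d) - g)) ^ p = K * (\<bar>s $ j - t $ j\<bar> powr g) ^ p"
        unfolding K_def by (simp only: power_mult_distrib mult_ac)
      also have "(\<bar>s $ j - t $ j\<bar> powr g) ^ p = \<bar>s $ j - t $ j\<bar> powr (g * real p)"
      proof (cases "s $ j = t $ j")
        case True then show ?thesis using p by simp
      next
        case False
        then have "0 < \<bar>s $ j - t $ j\<bar> powr g" by simp
        then have "(\<bar>s $ j - t $ j\<bar> powr g) ^ p = (\<bar>s $ j - t $ j\<bar> powr g) powr real p" by (rule powr_realpow[symmetric])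
        then show ?thesis by (simp add: powr_powr)
      qed
      finally show ?thesis .
    qed
    let ?u = "r powr (Q_dim H - real CARD('d))"
    have u0: "0 < ?u" using r by simp
    have K0: "0 \<le> K" unfolding K_def using CD0 by simp
    have Zm: "Z s \<in> borel_measurable M" for s unfolding Z_def
      by (rule Lmoll_measurable[OF S a r e cS emeasure_locbox_le[OF r]])
    have finS: "emeasure lborel ?S < \<infinity>" using emeasure_locbox_le[OF r, of a] by (auto simp: less_top[symmetric] top_unique)
    have Zc: "continuous_on (cbox 0 1) (\<lambda>s. Z s w)" if "w \<in> space M" for w
      unfolding Z_def
      by (rule continuous_on_compose2[OF Lmoll_continuous[OF S(1) finS e that]]) (auto intro!: continuous_intros)
    have "\<exists>E. E \<in> sets M \<and> emeasure M E \<le> ennreal (?ch * K / ?u ^ p) \<and>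
      (\<forall>w s. w \<in> space M - E \<longrightarrow> s \<in> cbox 0 1 \<longrightarrow> \<bar>Z s w - Z 0 w\<bar> \<le> ?u)"
      by (rule chaining[of Z M p "g * real p" K ?u]) (use Zm Zc p th K0 u0 incr in auto)
    then obtain E where E: "E \<in> sets M" "emeasure M E \<le> ennreal (?ch * K / ?u ^ p)"
      "\<And>w s. w \<in> space M - E \<Longrightarrow> s \<in> cbox 0 1 \<Longrightarrow> \<bar>Z s w - Z 0 w\<bar> \<le> ?u"
      by blast
    have "K / ?u ^ p = CD * exp (- real n * (g * real p))"
    proof -
      have "\<delta> powr g * r powr (Q_dim H - real CARD('d) - g) / ?u = exp (- real n * g)"
      proof -
        have "\<delta> powr g = r powr g * exp (- real n) powr g" unfolding \<delta>_def by (rule powr_mult)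
        also have "exp (- real n) powr g = exp (- real n * g)" by (simp add: powr_def mult.commute)
        finally have "\<delta> powr g * r powr (Q_dim H - real CARD('d) - g) = exp (- real n * g) * (r powr g * r powr (Q_dim H - real CARD('d) - g))" by simp
        also have "r powr g * r powr (Q_dim H - real CARD('d) - g) = ?u" unfolding powr_add[symmetric] by simp
        finally show ?thesis using u0 by simp
      qed
      then have "K / ?u ^ p = CD * exp (- real n * g) ^ p"
        unfolding K_def times_divide_eq_right[symmetric] power_divide[symmetric] by simp
      then show ?thesis by (simp add: exp_of_nat_mult[symmetric] mult_ac)
    qed
    then have "?ch * K / ?u ^ p = ?ch * CD * exp (- real n * (g * real p))" by (simp only: times_divide_eq_right[symmetric] mult.assoc)
    also have "\<dots> \<le> ?ch * CD * exp (- (2 * real CARD('d) + 2) * real n)"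
    proof (intro mult_left_mono)
      have "real n * (2 * real CARD('d) + 2) \<le> real n * (g * real p)" using gp by (intro mult_left_mono) auto
      then have "- real n * (g * real p) \<le> - (2 * real CARD('d) + 2) * real n" by (simp only: mult_minus_left mult.commute neg_le_iff_le)
      then show "exp (- real n * (g * real p)) \<le> exp (- (2 * real CARD('d) + 2) * real n)" by (simp only: exp_le_cancel_iff)
    qed (use ch0 CD0 in simp)
    finally have "emeasure M E \<le> ennreal (?ch * CD * exp (- (2 * real CARD('d) + 2) * real n))"
      using E(2) ennreal_leI order_trans by blast
    moreover have "\<forall>w\<in>space M - E. \<forall>s\<in>cbox 0 1. \<bar>Lmoll ?S e a (x + \<delta> *\<^sub>R s) w - Lmoll ?S e a x w\<bar> \<le> ?u"
      using E(3) unfolding Z_def by auto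
    ultimately show "\<exists>E\<in>sets M. emeasure M E \<le> ennreal (?ch * CD * exp (- (2 * real CARD('d) + 2) * real n)) \<and>
      (\<forall>w\<in>space M - E. \<forall>s\<in>cbox 0 1. \<bar>Lmoll ?S e a (x + (r * exp (- real n)) *\<^sub>R s) w - Lmoll ?S e a x w\<bar> \<le> ?u)"
      using E(1) unfolding \<delta>_def by blast
  qed
qed

text \<open>A grid of mesh r exp(-n) in the cube of half side r exp(n) has at most 3 exp(2n) indices
  per coordinate. \<open>A1\<close> is chosen such that a grid point fails with probability at most
  exp(-(2 d + 2) n), like a cell up to a constant. The half side is the radius at which
  \<open>range_tail\<close> is applied, so locations outside the cube carry no local time off a
  small event.\<close>

lemma Lmoll_sup_tail:
  obtains A C where "0 < A" "0 \<le> C" "\<And>a r e n. a \<in> T \<Longrightarrow> 0 < r \<Longrightarrow> 0 < e \<Longrightarrow> 1 \<le> n \<Longrightarrow>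
    \<exists>E\<in>sets M. emeasure M E \<le> ennreal (C * exp (- 2 * real n)) \<and>
      (\<forall>w\<in>space M - E. \<forall>x. (\<forall>c. \<bar>x $ c\<bar> \<le> r * exp (real n)) \<longrightarrow> Lmoll (bigS a r) e a x w \<le> A * rate r n)"
proof -
  obtain C0 where C0: "0 \<le> C0" and osc: "\<And>a r e n x. a \<in> T \<Longrightarrow> 0 < r \<Longrightarrow> 0 < e \<Longrightarrow>
    \<exists>E\<in>sets M. emeasure M E \<le> ennreal (C0 * exp (- (2 * real CARD('d) + 2) * real n)) \<and>
      (\<forall>w\<in>space M - E. \<forall>s\<in>cbox 0 1. \<bar>Lmoll (bigS a r) e a (x + (r * exp (- real n)) *\<^sub>R s) w - Lmoll (bigS a r) e a x w\<bar> \<le> r powr (Q_dim H - real CARD('d)))"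
    by (rule Lmoll_oscillation_tail) (rule that)
  define A1 where "A1 = 2 * moment_const * exp (2 * real CARD('d) + 2)"
  have A1: "0 < A1" unfolding A1_def using moment_const_pos by simp
  show ?thesis
  proof (rule that[of "A1 + 1" "3 ^ CARD('d) * (1 + C0)"])
    show "0 < A1 + 1" "0 \<le> 3 ^ CARD('d) * (1 + C0)" using A1 C0 by auto
    fix a and r e :: real and n :: nat assume a: "a \<in> T" and r: "0 < r" and e: "0 < e" and n: "1 \<le> n"
    let ?S = "bigS a r"
    have S: "?S \<in> sets borel" "?S \<subseteq> T" by auto
    have cS: "(0::real) \<le> 4 ^ CARD('n)" by simp
    define \<delta> where "\<delta> = r * exp (- real n)"
    have d0: "0 < \<delta>" unfolding \<delta>_def using r by simp
    define R where "R = r * exp (real n)"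
    define N where "N = nat \<lfloor>2 * exp (2 * real n)\<rfloor>"
    define G where "G = {z :: 'd \<Rightarrow> nat. \<forall>i. z i \<le> N}"
    define px where "px = (\<lambda>z :: 'd \<Rightarrow> nat. \<chi> c. - R + \<delta> * real (z c))"
    have G: "finite G" "card G = (N + 1) ^ CARD('d)" unfolding G_def by (rule finite_grid, rule card_grid)
    have cG: "real (card G) * exp (- (2 * real CARD('d) + 2) * real n) \<le> 3 ^ CARD('d) * exp (- 2 * real n)"
    proof -
      have "real N \<le> 2 * exp (2 * real n)" unfolding N_def by simp
      moreover have "1 \<le> exp (2 * real n)" by simp
      ultimately have "real N + 1 \<le> 3 * exp (2 * real n)" by linarith
      then have "(real N + 1) ^ CARD('d) \<le> (3 * exp (2 * real n)) ^ CARD('d)" by (intro power_mono) auto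
      then have "real (card G) \<le> (3 * exp (2 * real n)) ^ CARD('d)" unfolding G by (simp add: add.commute)
      also have "\<dots> = 3 ^ CARD('d) * exp (2 * real CARD('d) * real n)"
        by (simp add: power_mult_distrib exp_of_nat_mult[symmetric] mult_ac)
      finally have "real (card G) * exp (- (2 * real CARD('d) + 2) * real n) \<le> 3 ^ CARD('d) * exp (2 * real CARD('d) * real n) * exp (- (2 * real CARD('d) + 2) * real n)"
        by (rule mult_right_mono) simp
      also have "\<dots> = 3 ^ CARD('d) * exp (- 2 * real n)"
        unfolding mult.assoc exp_add[symmetric] by (simp add: algebra_simps)
      finally show ?thesis .
    qed
    define B where "B = (\<lambda>z. {w \<in> space M. A1 * rate r n < Lmoll ?S e a (px z) w})"
    have Bs: "B z \<in> sets M" for z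
      unfolding B_def using Lmoll_measurable[OF S a r e cS emeasure_locbox_le[OF r], of "px z"] by measurable
    have Bm: "emeasure M (B z) \<le> ennreal (exp (- (2 * real CARD('d) + 2) * real n))" for z
    proof -
      have "emeasure M (B z) \<le> ennreal ((2 * moment_const / A1) ^ n)" unfolding B_def by (rule Lmoll_gt_tail[OF a r e n A1])
      also have "2 * moment_const / A1 = exp (- (2 * real CARD('d) + 2))" unfolding A1_def exp_minus using moment_const_pos by (simp add: field_simps)
      also have "exp (- (2 * real CARD('d) + 2)) ^ n = exp (- (2 * real CARD('d) + 2) * real n)" by (simp add: exp_of_nat_mult[symmetric] mult.commute)
      finally show ?thesis .
    qed
    have "\<forall>z. \<exists>E. E \<in> sets M \<and> emeasure M E \<le> ennreal (C0 * exp (- (2 * real CARD('d) + 2) * real n)) \<and>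
      (\<forall>w\<in>space M - E. \<forall>s\<in>cbox 0 1. \<bar>Lmoll ?S e a (px z + \<delta> *\<^sub>R s) w - Lmoll ?S e a (px z) w\<bar> \<le> r powr (Q_dim H - real CARD('d)))"
      using osc[OF a r e] unfolding \<delta>_def by blast
    then obtain E where E: "\<And>z. E z \<in> sets M" "\<And>z. emeasure M (E z) \<le> ennreal (C0 * exp (- (2 * real CARD('d) + 2) * real n))"
      "\<And>z w s. w \<in> space M - E z \<Longrightarrow> s \<in> cbox 0 1 \<Longrightarrow> \<bar>Lmoll ?S e a (px z + \<delta> *\<^sub>R s) w - Lmoll ?S e a (px z) w\<bar> \<le> r powr (Q_dim H - real CARD('d))"
      by metis
    show "\<exists>E\<in>sets M. emeasure M E \<le> ennreal (3 ^ CARD('d) * (1 + C0) * exp (- 2 * real n)) \<and>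
      (\<forall>w\<in>space M - E. \<forall>x. (\<forall>c. \<bar>x $ c\<bar> \<le> r * exp (real n)) \<longrightarrow> Lmoll ?S e a x w \<le> (A1 + 1) * rate r n)"
    proof (intro bexI[of _ "\<Union>z\<in>G. B z \<union> E z"] conjI ballI allI impI)
      have "emeasure M (\<Union>z\<in>G. B z \<union> E z) \<le> (\<Sum>z\<in>G. emeasure M (B z \<union> E z))"
        using G Bs E(1) by (intro emeasure_subadditive_finite) auto
      also have "\<dots> \<le> (\<Sum>z\<in>G. ennreal (exp (- (2 * real CARD('d) + 2) * real n)) + ennreal (C0 * exp (- (2 * real CARD('d) + 2) * real n)))"
        using Bs E(1) by (intro sum_mono order_trans[OF emeasure_subadditive] add_mono Bm E(2)) auto
      also have "\<dots> = ennreal (real (card G) * ((1 + C0) * exp (- (2 * real CARD('d) + 2) * real n)))"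
      proof -
        have "ennreal (exp (- (2 * real CARD('d) + 2) * real n)) + ennreal (C0 * exp (- (2 * real CARD('d) + 2) * real n)) = ennreal ((1 + C0) * exp (- (2 * real CARD('d) + 2) * real n))"
          using C0 by (simp add: ennreal_plus[symmetric] distrib_right del: ennreal_plus)
        then show ?thesis unfolding sum_constant ennreal_of_nat_eq_real_of_nat
          by (simp only: ennreal_mult'[symmetric] of_nat_0_le_iff)
      qed
      also have "\<dots> \<le> ennreal (3 ^ CARD('d) * (1 + C0) * exp (- 2 * real n))"
      proof (rule ennreal_leI)
        have "(1 + C0) * (real (card G) * exp (- (2 * real CARD('d) + 2) * real n)) \<le> (1 + C0) * (3 ^ CARD('d) * exp (- 2 * real n))"
          using C0 by (intro mult_left_mono cG) auto
        then show "real (card G) * ((1 + C0) * exp (- (2 * real CARD('d) + 2) * real n)) \<le> 3 ^ CARD('d) * (1 + C0) * exp (- 2 * real n)"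
          by (simp only: mult_ac)
      qed
      finally show "emeasure M (\<Union>z\<in>G. B z \<union> E z) \<le> ennreal (3 ^ CARD('d) * (1 + C0) * exp (- 2 * real n))" .
    next
      fix w and x :: "real ^ 'd" assume w: "w \<in> space M - (\<Union>z\<in>G. B z \<union> E z)" and x: "\<forall>c. \<bar>x $ c\<bar> \<le> r * exp (real n)"
      \<comment> \<open>The index of the lower corner of the cell that contains x; the position
        inside the cell is s below.\<close>
      define z where "z = (\<lambda>c :: 'd. nat \<lfloor>(x $ c + R) / \<delta>\<rfloor>)"
      have xR: "0 \<le> x $ c + R" "x $ c + R \<le> 2 * R" for c using x[rule_format, of c] unfolding R_def by linarith+
      have RD: "2 * R / \<delta> = 2 * exp (2 * real n)"
        unfolding R_def \<delta>_def using r by (simp add: exp_minus field_simps exp_add[symmetric])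
      have zG: "z \<in> G" unfolding G_def
      proof (intro CollectI allI)
        fix c
        have "(x $ c + R) / \<delta> \<le> 2 * exp (2 * real n)"
          unfolding RD[symmetric] using xR[of c] d0 by (intro divide_right_mono) auto
        then show "z c \<le> N" unfolding z_def N_def by (intro nat_mono floor_mono)
      qed
      define s where "s = (\<chi> c. (x $ c + R) / \<delta> - real (z c))"
      have zc: "real (z c) = of_int \<lfloor>(x $ c + R) / \<delta>\<rfloor>" for c
        unfolding z_def using xR[of c] d0 by simp
      have s01: "s \<in> cbox 0 1"
      proof -
        have "0 \<le> s $ c \<and> s $ c \<le> 1" for c unfolding s_def zc vec_lambda_beta by linarith
        then show ?thesis by (simp add: mem_box_cart)
      qed
      have xs: "px z + \<delta> *\<^sub>R s = x"
        unfolding vec_eq_iff px_def s_def using d0 by (simp add: right_diff_distrib)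
      have "w \<in> space M" "w \<notin> B z" "w \<in> space M - E z" using w zG by auto
      then have b: "Lmoll ?S e a (px z) w \<le> A1 * rate r n" unfolding B_def by auto
      have "\<bar>Lmoll ?S e a x w - Lmoll ?S e a (px z) w\<bar> \<le> r powr (Q_dim H - real CARD('d))"
        using E(3)[OF \<open>w \<in> space M - E z\<close> s01] unfolding xs .
      moreover have "r powr (Q_dim H - real CARD('d)) \<le> 1 * rate r n"
      proof -
        have "0 < Q_dim H" using dQ by (metis of_nat_0_le_iff order_le_less_trans)
        then have "1 \<le> real n powr (real CARD('d) / Q_dim H)" using n by (intro ge_one_powr_ge_zero) auto
        then have "1 * r powr (Q_dim H - real CARD('d)) \<le> real n powr (real CARD('d) / Q_dim H) * r powr (Q_dim H - real CARD('d))"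
          by (rule mult_right_mono) simp
        then show ?thesis unfolding rate_def by simp
      qed
      ultimately show "Lmoll ?S e a x w \<le> (A1 + 1) * rate r n"
        using b unfolding distrib_right by linarith
    qed (use G Bs E(1) in auto)
  qed
qed

end

subsection \<open>Local times as limits of mollifications\<close>

lemma prod_mono_ennreal:
  fixes f g :: "'a \<Rightarrow> ennreal"
  shows "(\<And>i. i \<in> A \<Longrightarrow> f i \<le> g i) \<Longrightarrow> prod f A \<le> prod g A"
  by (induction A rule: infinite_finite_induct) (auto intro: mult_mono)

lemma nn_integral_lborel_prod_cart:
  fixes \<phi> :: "'d::finite \<Rightarrow> real \<Rightarrow> ennreal"
  assumes \<phi>: "\<And>c. \<phi> c \<in> borel_measurable borel"
  shows "(\<integral>\<^sup>+y. (\<Prod>c\<in>UNIV. \<phi> c (y $ c)) \<partial>(lborel :: (real ^ 'd) measure)) = (\<Prod>c\<in>UNIV. \<integral>\<^sup>+z. \<phi> c z \<partial>lborel)"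
proof -
  let ?ax = "\<lambda>c :: 'd. axis c (1 :: real)"
  have B: "(Basis :: (real ^ 'd) set) = range ?ax" by (auto simp: Basis_vec_def)
  have inj: "inj ?ax" by (auto simp: inj_def axis_eq_axis)
  have inv: "inv ?ax (?ax c) = c" for c by (rule inv_f_f[OF inj])
  have "(\<integral>\<^sup>+y. (\<Prod>c\<in>UNIV. \<phi> c (y $ c)) \<partial>(lborel :: (real ^ 'd) measure)) = (\<integral>\<^sup>+y. (\<Prod>b\<in>Basis. \<phi> (inv ?ax b) (y \<bullet> b)) \<partial>lborel)"
    unfolding B by (subst prod.reindex[OF inj]) (simp add: inv cart_eq_inner_axis)
  also have "\<dots> = (\<Prod>b\<in>(Basis :: (real ^ 'd) set). \<integral>\<^sup>+z. \<phi> (inv ?ax b) z \<partial>lborel)"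
    using \<phi> by (intro nn_integral_lborel_prod) auto
  also have "\<dots> = (\<Prod>c\<in>UNIV. \<integral>\<^sup>+z. \<phi> c z \<partial>lborel)"
    unfolding B by (subst prod.reindex[OF inj]) (simp add: inv)
  finally show ?thesis .
qed

text \<open>Chebyshev's inequality for the normal law with variance e^2.\<close>

lemma normal_density_mass_near:
  assumes e: "0 < e" and b: "0 < b"
  shows "ennreal (1 - e\<^sup>2 / b\<^sup>2) \<le> (\<integral>\<^sup>+z. ennreal (normal_density 0 e (z - x)) * indicator {x - b..x + b} z \<partial>lborel)"
proof -
  let ?g = "\<lambda>z. normal_density 0 e (z - x)"
  have g: "?g z = normal_density x e z" for z by (simp add: normal_density_def)
  have "1 = (\<integral>\<^sup>+z. ennreal (?g z) \<partial>lborel)"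
    unfolding g using e by (subst nn_integral_eq_integral) auto
  also have "\<dots> \<le> (\<integral>\<^sup>+z. ennreal (?g z) * indicator {x - b..x + b} z + ennreal (?g z * ((z - x) ^ (2 * 1) / b\<^sup>2)) \<partial>lborel)"
  proof (intro nn_integral_mono)
    fix z
    show "ennreal (?g z) \<le> ennreal (?g z) * indicator {x - b..x + b} z + ennreal (?g z * ((z - x) ^ (2 * 1) / b\<^sup>2))"
    proof (cases "z \<in> {x - b..x + b}")
      case False
      then have "b < \<bar>z - x\<bar>" by auto
      then have "b\<^sup>2 \<le> \<bar>z - x\<bar>\<^sup>2" using b by (intro power_mono) auto
      then have "1 \<le> (z - x)\<^sup>2 / b\<^sup>2" using b by simp
      then have "?g z * 1 \<le> ?g z * ((z - x)\<^sup>2 / b\<^sup>2)" by (rule mult_left_mono) simp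
      then show ?thesis using False by (simp add: ennreal_leI)
    qed simp
  qed
  also have "\<dots> = (\<integral>\<^sup>+z. ennreal (?g z) * indicator {x - b..x + b} z \<partial>lborel) + (\<integral>\<^sup>+z. ennreal (?g z * ((z - x) ^ (2 * 1) / b\<^sup>2)) \<partial>lborel)"
    by (intro nn_integral_add) auto
  also have "(\<integral>\<^sup>+z. ennreal (?g z * ((z - x) ^ (2 * 1) / b\<^sup>2)) \<partial>lborel) = ennreal (e\<^sup>2 / b\<^sup>2)"
  proof -
    have "has_bochner_integral lborel (\<lambda>z. ?g z * (z - x) ^ (2 * 1)) (fact (2 * 1) / ((2 / e\<^sup>2) ^ 1 * fact 1))"
      unfolding g by (rule normal_moment_even[OF e])
    then have h: "has_bochner_integral lborel (\<lambda>z. ?g z * (z - x) ^ (2 * 1)) (e\<^sup>2)"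
      by (simp add: fact_2)
    have "has_bochner_integral lborel (\<lambda>z. ?g z * ((z - x) ^ (2 * 1) / b\<^sup>2)) (e\<^sup>2 / b\<^sup>2)"
      using has_bochner_integral_divide_zero[OF h, of "b\<^sup>2"] by simp
    then show ?thesis using b by (subst nn_integral_eq_integral) (auto simp: has_bochner_integral_iff)
  qed
  finally have 1: "1 \<le> (\<integral>\<^sup>+z. ennreal (?g z) * indicator {x - b..x + b} z \<partial>lborel) + ennreal (e\<^sup>2 / b\<^sup>2)" .
  have "ennreal (1 - e\<^sup>2 / b\<^sup>2) = 1 - ennreal (e\<^sup>2 / b\<^sup>2)"
    using b by (simp add: ennreal_minus[symmetric] del: ennreal_minus)
  also have "\<dots> \<le> (\<integral>\<^sup>+z. ennreal (?g z) * indicator {x - b..x + b} z \<partial>lborel)"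
    using 1 by (subst ennreal_minus_le_iff) (auto simp: add.commute)
  finally show ?thesis .
qed

context
  fixes f :: "real ^ 'n::finite \<Rightarrow> real ^ 'd::finite" and S :: "(real ^ 'n) set" and l :: "real ^ 'd \<Rightarrow> (real ^ 'n) measure"
  assumes f: "continuous_on UNIV f" and S: "S \<in> sets borel"
    and lt: "is_local_time f S (\<lambda>x. emeasure (l x) S)"
    and fin: "\<And>x. finite_measure (l x)"
    and cont: "continuous_on UNIV (\<lambda>x. measure (l x) S)"
begin

lemma emeasure_l: "emeasure (l x) S = ennreal (measure (l x) S)"
  using fin[of x] by (simp add: finite_measure.emeasure_eq_measure)

text \<open>The Radon-Nikodym density may be replaced by the given version of the local time, since
  the two agree almost everywhere.\<close>

lemma occupation_formula:
  fixes g :: "real ^ 'd \<Rightarrow> ennreal"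
  assumes g [measurable]: "g \<in> borel_measurable borel"
  shows "(\<integral>\<^sup>+t. g (f t) \<partial>restrict_space lborel S) = (\<integral>\<^sup>+y. emeasure (l y) S * g y \<partial>lborel)"
proof -
  have [measurable]: "f \<in> borel_measurable borel" using f by (rule borel_measurable_continuous_onI)
  then have fm: "f \<in> measurable (restrict_space lborel S) borel" by (intro measurable_restrict_space1) simp
  let ?\<mu> = "occupation_measure f S"
  have ac: "absolutely_continuous lborel ?\<mu>" and ae: "AE x in lborel. emeasure (l x) S = RN_deriv lborel ?\<mu> x"
    using lt unfolding is_local_time_def by auto
  have "density lborel (RN_deriv lborel ?\<mu>) = ?\<mu>"
    by (rule sigma_finite_measure.density_RN_deriv[OF sigma_finite_lborel ac]) (simp add: occupation_measure_def)
  then have "(\<integral>\<^sup>+y. g y \<partial>?\<mu>) = (\<integral>\<^sup>+y. g y \<partial>density lborel (RN_deriv lborel ?\<mu>))" by simp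
  also have "\<dots> = (\<integral>\<^sup>+y. RN_deriv lborel ?\<mu> y * g y \<partial>lborel)" by (intro nn_integral_density) auto
  also have "\<dots> = (\<integral>\<^sup>+y. emeasure (l y) S * g y \<partial>lborel)"
    using ae by (intro nn_integral_cong_AE) auto
  finally show ?thesis unfolding occupation_measure_def using fm by (simp add: nn_integral_distr)
qed

lemma local_time_neighbourhood:
  assumes "\<eta> > 0"
  obtains \<beta> where "\<beta> > 0" "\<And>y. (\<And>c. \<bar>y $ c - x $ c\<bar> \<le> \<beta>) \<Longrightarrow> measure (l x) S - \<eta> \<le> measure (l y) S"
proof -
  obtain \<delta> where d: "\<delta> > 0" "\<And>y. dist y x < \<delta> \<Longrightarrow> dist (measure (l y) S) (measure (l x) S) < \<eta>"
    using cont assms unfolding continuous_on_iff by (metis UNIV_I)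
  show ?thesis
  proof (rule that[of "\<delta> / (2 * real CARD('d))"])
    show "0 < \<delta> / (2 * real CARD('d))" using d by simp
    fix y assume y: "\<And>c. \<bar>y $ c - x $ c\<bar> \<le> \<delta> / (2 * real CARD('d))"
    have "dist y x \<le> (\<Sum>c\<in>UNIV. \<bar>(y - x) $ c\<bar>)" unfolding dist_norm by (rule norm_le_l1_cart)
    also have "\<dots> \<le> (\<Sum>c\<in>(UNIV :: 'd set). \<delta> / (2 * real CARD('d)))" using y by (intro sum_mono) simp
    also have "\<dots> < \<delta>" using d by simp
    finally have "dist (measure (l y) S) (measure (l x) S) < \<eta>" by (rule d(2))
    then show "measure (l x) S - \<eta> \<le> measure (l y) S" unfolding dist_real_def by linarith
  qed
qed

text \<open>If the local time at x exceeded u, continuity in space would keep it above some v > u on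
  a cube about x. By the occupation formula the mollified value is at least v times the product of
  the kernel masses near x, which tends to v. Infinitely many widths below the bound u already
  contradict this.\<close>

lemma local_time_le_of_mollified:
  assumes e: "\<And>i. 0 < e i" "e \<longlonglongrightarrow> 0" and u: "0 \<le> u"
    and freq: "\<exists>\<^sub>F i in sequentially. (\<integral>\<^sup>+t. (\<Prod>c\<in>UNIV. ennreal (normal_density 0 (e i) (f t $ c - x $ c))) \<partial>restrict_space lborel S) \<le> ennreal u"
  shows "measure (l x) S \<le> u"
proof (rule ccontr)
  assume "\<not> ?thesis"
  then have gt: "u < measure (l x) S" by simp
  define \<eta> where "\<eta> = (measure (l x) S - u) / 2"
  have eta: "\<eta> > 0" "u < measure (l x) S - \<eta>" unfolding \<eta>_def using gt by (auto simp: field_simps)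
  obtain \<beta> where b: "\<beta> > 0" "\<And>y. (\<And>c. \<bar>y $ c - x $ c\<bar> \<le> \<beta>) \<Longrightarrow> measure (l x) S - \<eta> \<le> measure (l y) S"
    using local_time_neighbourhood[OF eta(1)] by metis
  let ?v = "measure (l x) S - \<eta>"
  have v0: "0 < ?v" using eta u by linarith
  have lower: "ennreal (?v * (1 - (e i)\<^sup>2 / \<beta>\<^sup>2) ^ CARD('d)) \<le> (\<integral>\<^sup>+t. (\<Prod>c\<in>UNIV. ennreal (normal_density 0 (e i) (f t $ c - x $ c))) \<partial>restrict_space lborel S)"
    if small: "(e i)\<^sup>2 / \<beta>\<^sup>2 \<le> 1" for i
  proof -
    let ?g = "\<lambda>c z. ennreal (normal_density 0 (e i) (z - x $ c))" and ?I = "\<lambda>c z. indicator {x $ c - \<beta>..x $ c + \<beta>} z :: ennreal"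
    have "ennreal (?v * (1 - (e i)\<^sup>2 / \<beta>\<^sup>2) ^ CARD('d)) = ennreal ?v * (\<Prod>c\<in>(UNIV :: 'd set). ennreal (1 - (e i)\<^sup>2 / \<beta>\<^sup>2))"
      using v0 small by (simp add: ennreal_mult ennreal_power)
    also have "\<dots> \<le> ennreal ?v * (\<Prod>c\<in>UNIV. \<integral>\<^sup>+z. ?g c z * ?I c z \<partial>lborel)"
      by (intro mult_left_mono prod_mono_ennreal normal_density_mass_near e(1) b(1)) simp
    also have "\<dots> = ennreal ?v * (\<integral>\<^sup>+y. (\<Prod>c\<in>UNIV. ?g c (y $ c) * ?I c (y $ c)) \<partial>lborel)"
      by (subst nn_integral_lborel_prod_cart) auto
    also have "\<dots> = (\<integral>\<^sup>+y. ennreal ?v * (\<Prod>c\<in>UNIV. ?g c (y $ c) * ?I c (y $ c)) \<partial>lborel)"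
      by (rule nn_integral_cmult[symmetric]) measurable
    also have "\<dots> \<le> (\<integral>\<^sup>+y. emeasure (l y) S * (\<Prod>c\<in>UNIV. ?g c (y $ c)) \<partial>lborel)"
    proof (intro nn_integral_mono)
      fix y
      show "ennreal ?v * (\<Prod>c\<in>UNIV. ?g c (y $ c) * ?I c (y $ c)) \<le> emeasure (l y) S * (\<Prod>c\<in>UNIV. ?g c (y $ c))"
      proof (cases "\<forall>c. y $ c \<in> {x $ c - \<beta>..x $ c + \<beta>}")
        case True
        then have "\<bar>y $ c - x $ c\<bar> \<le> \<beta>" for c by (simp add: abs_le_iff) (smt (verit))
        then have "ennreal ?v \<le> emeasure (l y) S" unfolding emeasure_l using b(2)[of y] by (intro ennreal_leI) auto
        then show ?thesis using True by (intro mult_mono) auto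
      next
        case False
        then obtain c where "y $ c \<notin> {x $ c - \<beta>..x $ c + \<beta>}" by blast
        then have "(\<Prod>c\<in>UNIV. ?g c (y $ c) * ?I c (y $ c)) = 0"
          by (intro prod_zero bexI[of _ c]) auto
        then show ?thesis by (simp only: mult_zero_right zero_le)
      qed
    qed
    also have "\<dots> = (\<integral>\<^sup>+t. (\<Prod>c\<in>UNIV. ?g c (f t $ c)) \<partial>restrict_space lborel S)"
      by (rule occupation_formula[symmetric]) measurable
    finally show ?thesis .
  qed
  have "(\<lambda>i. ?v * (1 - (e i)\<^sup>2 / \<beta>\<^sup>2) ^ CARD('d)) \<longlonglongrightarrow> ?v * (1 - 0\<^sup>2 / \<beta>\<^sup>2) ^ CARD('d)"
    using b(1) by (intro tendsto_intros e(2)) auto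
  then have "(\<lambda>i. ?v * (1 - (e i)\<^sup>2 / \<beta>\<^sup>2) ^ CARD('d)) \<longlonglongrightarrow> ?v" by simp
  then have ev1: "\<forall>\<^sub>F i in sequentially. u < ?v * (1 - (e i)\<^sup>2 / \<beta>\<^sup>2) ^ CARD('d)"
    using eta(2) by (rule order_tendstoD(1))
  have "(\<lambda>i. (e i)\<^sup>2 / \<beta>\<^sup>2) \<longlonglongrightarrow> 0\<^sup>2 / \<beta>\<^sup>2" using b(1) by (intro tendsto_intros e(2)) auto
  then have ev2: "\<forall>\<^sub>F i in sequentially. (e i)\<^sup>2 / \<beta>\<^sup>2 < 1"
    by (rule order_tendstoD(2)) simp
  have "\<exists>\<^sub>F i in sequentially. False"
    using frequently_eventually_conj[OF freq eventually_conj[OF ev1 ev2]]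
  proof (rule frequently_elim1)
    fix i assume *: "(u < ?v * (1 - (e i)\<^sup>2 / \<beta>\<^sup>2) ^ CARD('d) \<and> (e i)\<^sup>2 / \<beta>\<^sup>2 < 1) \<and>
      (\<integral>\<^sup>+t. (\<Prod>c\<in>UNIV. ennreal (normal_density 0 (e i) (f t $ c - x $ c))) \<partial>restrict_space lborel S) \<le> ennreal u"
    then have "ennreal (?v * (1 - (e i)\<^sup>2 / \<beta>\<^sup>2) ^ CARD('d)) \<le> ennreal u"
      using lower[of i] by (intro order_trans[OF lower]) auto
    then show False using * u by (auto simp: ennreal_le_iff)
  qed
  then show False by simp
qed

text \<open>By continuity a positive value at x would be bounded away from 0 on a cube about x and
  give this cube positive occupation time, though the path on S stays away from it.\<close>

lemma local_time_off_range:
  assumes m: "\<And>t c. t \<in> S \<Longrightarrow> \<bar>f t $ c - b $ c\<bar> \<le> m" and x: "m < \<bar>x $ c0 - b $ c0\<bar>"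
  shows "measure (l x) S = 0"
proof (rule ccontr)
  assume "measure (l x) S \<noteq> 0"
  then have pos: "0 < measure (l x) S" by (simp add: zero_less_measure_iff)
  then obtain \<beta> where b: "\<beta> > 0" "\<And>y. (\<And>c. \<bar>y $ c - x $ c\<bar> \<le> \<beta>) \<Longrightarrow> measure (l x) S - measure (l x) S / 2 \<le> measure (l y) S"
    using local_time_neighbourhood[of "measure (l x) S / 2" x] by (metis half_gt_zero)
  define z where "z = \<bar>x $ c0 - b $ c0\<bar> - m"
  have z: "0 < z" unfolding z_def using x by simp
  \<comment> \<open>Small enough for continuity, and below the gap z, so that the whole cube lies
    beyond the level m in the coordinate c0.\<close>
  define \<beta>' where "\<beta>' = min \<beta> (z / 2)"
  have b': "0 < \<beta>'" "\<beta>' \<le> \<beta>" "\<beta>' < z" unfolding \<beta>'_def using b(1) z by (auto simp: min_def)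
  define W where "W = cbox (\<chi> c. x $ c - \<beta>') (\<chi> c. x $ c + \<beta>')"
  have W: "\<bar>y $ c - x $ c\<bar> \<le> \<beta>'" if "y \<in> W" for y c
    using that unfolding W_def mem_box_cart by (simp add: abs_le_iff) (smt (verit))
  have eW: "emeasure lborel W = ennreal ((2 * \<beta>') ^ CARD('d))"
    unfolding W_def using b' by (subst emeasure_lborel_cbox_cart) (auto simp: algebra_simps)
  have "ennreal (measure (l x) S / 2) * emeasure lborel W = (\<integral>\<^sup>+y. ennreal (measure (l x) S / 2) * indicator W y \<partial>lborel)"
    by (rule nn_integral_cmult_indicator[symmetric]) (simp add: W_def)
  also have "\<dots> \<le> (\<integral>\<^sup>+y. emeasure (l y) S * indicator W y \<partial>lborel)"
  proof (intro nn_integral_mono)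
    fix y show "ennreal (measure (l x) S / 2) * indicator W y \<le> emeasure (l y) S * indicator W y"
    proof (cases "y \<in> W")
      case True
      have "\<bar>y $ c - x $ c\<bar> \<le> \<beta>" for c using W[OF True, of c] b'(2) by linarith
      then have "ennreal (measure (l x) S / 2) \<le> emeasure (l y) S"
        unfolding emeasure_l using b(2)[of y] by (intro ennreal_leI) (auto simp: field_simps)
      then show ?thesis by (rule mult_right_mono) simp
    qed simp
  qed
  also have "\<dots> = (\<integral>\<^sup>+t. indicator W (f t) \<partial>restrict_space lborel S)"
    by (rule occupation_formula[symmetric]) (simp add: W_def)
  also have "\<dots> = (\<integral>\<^sup>+t. 0 \<partial>restrict_space lborel S)"
  proof (intro nn_integral_cong)
    fix t assume "t \<in> space (restrict_space lborel S)"
    then have "\<bar>f t $ c0 - b $ c0\<bar> \<le> m" using m by (auto simp: space_restrict_space)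
    moreover have "\<bar>x $ c0 - b $ c0\<bar> \<le> \<bar>f t $ c0 - x $ c0\<bar> + \<bar>f t $ c0 - b $ c0\<bar>"
      using abs_triangle_ineq4[of "f t $ c0 - b $ c0" "f t $ c0 - x $ c0"] by simp
    ultimately have "z \<le> \<bar>f t $ c0 - x $ c0\<bar>" unfolding z_def by linarith
    then have "f t \<notin> W" using W[of "f t" c0] b'(3) by fastforce
    then show "(indicator W (f t) :: ennreal) = 0" by simp
  qed
  finally have "ennreal (measure (l x) S / 2) * ennreal ((2 * \<beta>') ^ CARD('d)) \<le> 0" unfolding eW by simp
  then show False using pos b' by (simp add: ennreal_mult[symmetric])
qed

end

text \<open>Joint continuity speaks of rectangles with corner \<tau>. J lists the coordinates in
  which a lower face is imposed; cutting off the part below one face expresses the local time as a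
  difference of two instances with smaller J. If that face lies above the upper end, the set is
  empty.\<close>

lemma continuous_local_time_rectangle:
  fixes f :: "real ^ 'n::finite \<Rightarrow> real ^ 'd::finite" and \<tau> h :: "real ^ 'n"
  assumes jc: "jointly_continuous_local_time f T \<tau> h l" and T: "T \<in> sets borel" "T \<subseteq> cbox \<tau> (\<tau> + h)"
    and J: "finite J" and c: "\<And>j. 0 \<le> c $ j" "\<And>j. c $ j \<le> h $ j" and s: "\<And>j. 0 \<le> s $ j" "\<And>j. s $ j \<le> h $ j"
  shows "continuous_on UNIV (\<lambda>x. measure (l x) {t \<in> T. (\<forall>j. t $ j \<le> \<tau> $ j + s $ j) \<and> (\<forall>j\<in>J. \<tau> $ j + c $ j < t $ j)})"
  using J s
proof (induction J arbitrary: s)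
  case empty
  have "{t \<in> T. (\<forall>j. t $ j \<le> \<tau> $ j + s $ j) \<and> (\<forall>j\<in>{}. \<tau> $ j + c $ j < t $ j)} = T \<inter> cbox \<tau> (\<tau> + s)"
    using T(2) by (auto simp: mem_box_cart)
  moreover have "continuous_on UNIV (\<lambda>x. measure (l x) (T \<inter> cbox \<tau> (\<tau> + s)))"
  proof -
    have "continuous_on (UNIV \<times> cbox 0 h) (\<lambda>(x, s). measure (l x) (T \<inter> cbox \<tau> (\<tau> + s)))"
      using jc by (simp add: jointly_continuous_local_time_def)
    moreover have "continuous_on UNIV (\<lambda>x :: real ^ 'd. (x, s))" by (intro continuous_intros)
    moreover have "range (\<lambda>x :: real ^ 'd. (x, s)) \<subseteq> UNIV \<times> cbox 0 h" using empty by (auto simp: mem_box_cart)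
    ultimately show ?thesis using continuous_on_compose2 by fastforce
  qed
  ultimately show ?case by simp
next
  case (insert i J)
  let ?B = "\<lambda>J s. {t \<in> T. (\<forall>j. t $ j \<le> \<tau> $ j + s $ j) \<and> (\<forall>j\<in>J. \<tau> $ j + c $ j < t $ j)}"
  have sets: "?B J s \<in> sets (l x)" for J s x
  proof -
    have "{t. (\<forall>j. t $ j \<le> \<tau> $ j + s $ j) \<and> (\<forall>j\<in>J. \<tau> $ j + c $ j < t $ j)} \<in> sets (borel :: (real ^ 'n) measure)"
      unfolding Ball_def by measurable
    then have "T \<inter> {t. (\<forall>j. t $ j \<le> \<tau> $ j + s $ j) \<and> (\<forall>j\<in>J. \<tau> $ j + c $ j < t $ j)} \<in> sets (restrict_space borel T)"
      using T(1) by (subst sets_restrict_space_iff) auto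
    moreover have "?B J s = T \<inter> {t. (\<forall>j. t $ j \<le> \<tau> $ j + s $ j) \<and> (\<forall>j\<in>J. \<tau> $ j + c $ j < t $ j)}" by auto
    ultimately show ?thesis using jc by (simp add: jointly_continuous_local_time_def)
  qed
  show ?case
  proof (cases "c $ i \<le> s $ i")
    case False
    have "?B (insert i J) s = {}"
    proof -
      have "\<not> (t $ i \<le> \<tau> $ i + s $ i \<and> \<tau> $ i + c $ i < t $ i)" for t using False by linarith
      then show ?thesis by blast
    qed
    then show ?thesis by (simp only: measure_empty) simp
  next
    case True
    let ?s = "\<chi> j. if j = i then c $ i else s $ j"
    have eq: "?B (insert i J) s = ?B J s - ?B J ?s"
    proof (intro set_eqI iffI)
      fix t assume "t \<in> ?B (insert i J) s" then show "t \<in> ?B J s - ?B J ?s" by (auto simp: not_le intro: exI[of _ i])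
    next
      fix t assume t: "t \<in> ?B J s - ?B J ?s"
      then obtain j where j: "\<not> t $ j \<le> \<tau> $ j + ?s $ j" by auto
      have "j = i" using j t by (auto split: if_splits)
      then show "t \<in> ?B (insert i J) s" using t j by auto
    qed
    have sub: "?B J ?s \<subseteq> ?B J s"
    proof
      fix t assume t: "t \<in> ?B J ?s"
      have "t $ j \<le> \<tau> $ j + s $ j" for j
      proof -
        have "t $ j \<le> \<tau> $ j + ?s $ j" using t by blast
        also have "\<dots> \<le> \<tau> $ j + s $ j" using True by simp
        finally show ?thesis .
      qed
      then show "t \<in> ?B J s" using t by auto
    qed
    have "measure (l x) (?B (insert i J) s) = measure (l x) (?B J s) - measure (l x) (?B J ?s)" for x
      unfolding eq using jc
      by (intro finite_measure.finite_measure_Diff[OF _ sets sets sub]) (simp add: jointly_continuous_local_time_def)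
    moreover have "continuous_on UNIV (\<lambda>x. measure (l x) (?B J s) - measure (l x) (?B J ?s))"
      using insert.prems c by (intro continuous_on_diff insert.IH) auto
    ultimately show ?thesis by simp
  qed
qed

context box_field
begin

text \<open>Locations off the range carry no local time, and the others lie in the cube about X a on
  which the mollified local time is bounded. The bound holds on the whole cube at once, so it
  survives the shift by X a, which depends on the sample point.\<close>

lemma max_local_time_locbox_le:
  assumes jc: "jointly_continuous_local_time (\<lambda>t. X t w) T \<tau> h l" and w: "w \<in> space M"
    and a: "a \<in> T" and r: "0 < r"
    and range: "\<And>t c. t \<in> bigS a r \<Longrightarrow> \<bar>X t w $ c - X a w $ c\<bar> \<le> m"
    and e: "\<And>i. 0 < e i" "e \<longlonglongrightarrow> 0" and u: "0 \<le> u"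
    and freq: "\<exists>\<^sub>F i in sequentially. \<forall>x. (\<forall>c. \<bar>x $ c\<bar> \<le> m) \<longrightarrow> Lmoll (bigS a r) (e i) a x w \<le> u"
  shows "max_local_time l T (locbox a r) \<le> ennreal u"
  unfolding max_local_time_def
proof (rule SUP_least)
  fix x
  let ?S = "bigS a r" and ?f = "\<lambda>t. X t w"
  have S: "?S \<in> sets borel" "?S \<subseteq> T" by auto
  have cS: "(0::real) \<le> 4 ^ CARD('n)" by simp
  have fin: "finite_measure (l x)" for x using jc by (simp add: jointly_continuous_local_time_def)
  have lt: "is_local_time ?f ?S (\<lambda>x. emeasure (l x) ?S)" using jc S by (simp add: jointly_continuous_local_time_def)
  have cont: "continuous_on UNIV (\<lambda>x. measure (l x) ?S)"
  proof -
    let ?R = "\<lambda>j. 2 * r powr (1 / H $ j)"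
    define s where "s = (\<chi> j. min (h $ j) (a $ j + ?R j - \<tau> $ j))"
    \<comment> \<open>The coordinates in which the lower face has to be cut off. Equality belongs
      here, since the strict inequality then still removes a face. In the other coordinates all
      points of T satisfy the lower bound.\<close>
    define J where "J = {j. \<tau> $ j \<le> a $ j - ?R j}"
    define c where "c = (\<chi> j. if j \<in> J then a $ j - ?R j - \<tau> $ j else 0)"
    have aT: "\<tau> $ j \<le> a $ j" "a $ j \<le> \<tau> $ j + h $ j" for j
      using a T_subset by (auto simp: mem_box_cart)
    have rp: "0 < r powr (1 / H $ j)" for j using r by simp
    have tT: "\<tau> $ j \<le> t $ j" "t $ j \<le> \<tau> $ j + h $ j" if "t \<in> T" for t j
      using that T_subset by (auto simp: mem_box_cart)
    have "?S = {t \<in> T. (\<forall>j. t $ j \<le> \<tau> $ j + s $ j) \<and> (\<forall>j\<in>J. \<tau> $ j + c $ j < t $ j)}"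
    proof (intro set_eqI iffI)
      fix t assume t: "t \<in> ?S"
      have "t $ j \<le> \<tau> $ j + s $ j" for j
      proof -
        have "t $ j \<le> a $ j + ?R j" "t $ j \<le> \<tau> $ j + h $ j" using t tT[of t j] by (auto simp: locbox_def)
        then show ?thesis unfolding s_def by (simp add: min_def)
      qed
      moreover have "\<tau> $ j + c $ j < t $ j" if "j \<in> J" for j
        using t that unfolding c_def locbox_def by auto
      ultimately show "t \<in> {t \<in> T. (\<forall>j. t $ j \<le> \<tau> $ j + s $ j) \<and> (\<forall>j\<in>J. \<tau> $ j + c $ j < t $ j)}" using t by auto
    next
      fix t assume t: "t \<in> {t \<in> T. (\<forall>j. t $ j \<le> \<tau> $ j + s $ j) \<and> (\<forall>j\<in>J. \<tau> $ j + c $ j < t $ j)}"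
      have "a $ j - ?R j < t $ j \<and> t $ j \<le> a $ j + ?R j" for j
      proof
        show "a $ j - ?R j < t $ j"
        proof (cases "j \<in> J")
          case True
          then have "\<tau> $ j + c $ j < t $ j" using t by blast
          then show ?thesis using True unfolding c_def by simp
        next
          case False
          then have "a $ j - ?R j < \<tau> $ j" unfolding J_def by simp
          also have "\<tau> $ j \<le> t $ j" using t tT by blast
          finally show ?thesis .
        qed
        have "t $ j \<le> \<tau> $ j + s $ j" using t by blast
        also have "\<dots> \<le> a $ j + ?R j" unfolding s_def by simp
        finally show "t $ j \<le> a $ j + ?R j" .
      qed
      then show "t \<in> ?S" using t unfolding locbox_def by blast
    qed
    moreover have "continuous_on UNIV (\<lambda>x. measure (l x) {t \<in> T. (\<forall>j. t $ j \<le> \<tau> $ j + s $ j) \<and> (\<forall>j\<in>J. \<tau> $ j + c $ j < t $ j)})"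
    proof (rule continuous_local_time_rectangle[OF jc T_borel T_subset])
      fix j
      show "0 \<le> c $ j" unfolding c_def J_def by simp
      have "0 \<le> h $ j" using h_pos[of j] by simp
      moreover have "a $ j - ?R j - \<tau> $ j \<le> h $ j" using aT[of j] rp[of j] by linarith
      ultimately show "c $ j \<le> h $ j" unfolding c_def by simp
      have "0 \<le> a $ j + ?R j - \<tau> $ j" using aT[of j] rp[of j] by linarith
      then show "0 \<le> s $ j" unfolding s_def using \<open>0 \<le> h $ j\<close> by simp
      show "s $ j \<le> h $ j" unfolding s_def by simp
    qed simp
    ultimately show ?thesis by (simp only:)
  qed
  have ctx: "continuous_on UNIV ?f" by (rule X_cont[OF w])
  have "measure (l x) ?S \<le> u"
  proof (cases "\<forall>c. \<bar>x $ c - X a w $ c\<bar> \<le> m")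
    case False
    then obtain c0 where "m < \<bar>x $ c0 - X a w $ c0\<bar>" by (auto simp: not_le)
    then show ?thesis
      using local_time_off_range[OF ctx S(1) lt fin cont, of "X a w" m x c0] range u by auto
  next
    case True
    show ?thesis
    proof (rule local_time_le_of_mollified[OF ctx S(1) lt fin cont e u])
      show "\<exists>\<^sub>F i in sequentially. (\<integral>\<^sup>+t. (\<Prod>c\<in>UNIV. ennreal (normal_density 0 (e i) (X t w $ c - x $ c))) \<partial>restrict_space lborel ?S) \<le> ennreal u"
        using freq
      proof (rule frequently_elim1)
        fix i assume *: "\<forall>x. (\<forall>c. \<bar>x $ c\<bar> \<le> m) \<longrightarrow> Lmoll ?S (e i) a x w \<le> u"
        have "(\<integral>\<^sup>+t. (\<Prod>c\<in>UNIV. ennreal (normal_density 0 (e i) (X t w $ c - x $ c))) \<partial>restrict_space lborel ?S)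
           = (\<integral>\<^sup>+t. ennreal (moll (e i) a (x - X a w) t w) \<partial>restrict_space lborel ?S)"
          unfolding moll_def by (simp add: prod_ennreal)
        also have "\<dots> = ennreal (Lmoll ?S (e i) a (x - X a w) w)"
          unfolding Lmoll_def
          using moll_integrable[OF S a r e(1) cS emeasure_locbox_le[OF r] w] moll_bounds[OF e(1)]
          by (intro nn_integral_eq_integral) auto
        also have "\<dots> \<le> ennreal u"
          using * True by (intro ennreal_leI) auto
        finally show "(\<integral>\<^sup>+t. (\<Prod>c\<in>UNIV. ennreal (normal_density 0 (e i) (X t w $ c - x $ c))) \<partial>restrict_space lborel ?S) \<le> ennreal u" .
      qed
    qed
  qed
  moreover have "emeasure (l x) (locbox a r \<inter> T) = ennreal (measure (l x) ?S)"
    using fin[of x] by (simp add: finite_measure.emeasure_eq_measure Int_commute)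
  ultimately show "emeasure (l x) (locbox a r \<inter> T) \<le> ennreal u" by (simp add: ennreal_leI)
qed

end

subsection \<open>The two laws\<close>

lemma exp_minus_two_ln_le:
  fixes x y :: real
  shows "0 < x \<Longrightarrow> ln x \<le> y \<Longrightarrow> exp (- 2 * y) \<le> 1 / x\<^sup>2"
proof -
  assume x: "0 < x" "ln x \<le> y"
  have "exp (- 2 * y) \<le> exp (- 2 * ln x)" using x by simp
  also have "\<dots> = 1 / x\<^sup>2" using x(1) by (simp add: exp_minus exp_double inverse_eq_divide)
  finally show ?thesis .
qed

text \<open>P k is known only almost surely off E k, and the statement asks for no measurability of
  P k; the countably many null sets are discarded together.\<close>

lemma borel_cantelli_sup_bound:
  fixes E :: "nat \<Rightarrow> 'w set" and P :: "nat \<Rightarrow> 'w \<Rightarrow> bool"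
  assumes prob: "prob_space M" and E: "\<And>k. E k \<in> sets M" "\<And>k. emeasure M (E k) \<le> ennreal (b k)" "\<And>k. 0 \<le> b k" "summable b"
    and P: "\<And>k. AE w in M. w \<notin> E k \<longrightarrow> P k w"
  shows "AE w in M. \<forall>\<^sub>F k in sequentially. P k w"
proof -
  interpret prob_space M by fact
  have "measure M (E k) \<le> b k" for k
    using E(2)[of k] E(3)[of k] unfolding emeasure_eq_measure by (subst (asm) ennreal_le_iff) auto
  then have "summable (\<lambda>k. measure M (E k))"
    by (intro summable_comparison_test'[OF E(4), of 0]) auto
  then have "AE w in M. \<forall>\<^sub>F k in sequentially. w \<in> space M - E k"
    using E(1) by (intro borel_cantelli_AE1) (auto simp: emeasure_eq_measure)
  moreover have "AE w in M. \<forall>k. w \<notin> E k \<longrightarrow> P k w" using P by (subst AE_all_countable) auto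
  ultimately show ?thesis
  proof eventually_elim
    case (elim w)
    from elim(1) show ?case by (rule eventually_mono) (use elim(2) in blast)
  qed
qed

lemma dyadic_level:
  assumes "0 < r" "r \<le> 1"
  obtains k :: nat where "r \<le> 1 / 2 ^ k" "1 / 2 ^ k \<le> 2 * r" "real k * ln 2 \<le> ln (1 / r)"
proof -
  define k where "k = nat \<lfloor>log 2 (1 / r)\<rfloor>"
  have l0: "0 \<le> log 2 (1 / r)" using assms by simp
  have k: "real k \<le> log 2 (1 / r)" "log 2 (1 / r) < real k + 1" unfolding k_def using l0 by linarith+
  have p: "2 powr log 2 (1 / r) = 1 / r" using assms by simp
  have "2 powr real k \<le> 1 / r" using powr_mono[OF k(1), of 2] p by simp
  then have 1: "2 ^ k \<le> 1 / r" by (simp add: powr_realpow)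
  have "1 / r \<le> 2 powr (real k + 1)" using powr_mono[of "log 2 (1 / r)" "real k + 1" 2] k(2) p by simp
  then have 2: "1 / r \<le> 2 * 2 ^ k" by (simp add: powr_add powr_realpow)
  have "real k * ln 2 \<le> log 2 (1 / r) * ln 2" using k(1) by (intro mult_right_mono) auto
  then have 3: "real k * ln 2 \<le> ln (1 / r)" by (simp add: log_def)
  show ?thesis
  proof (rule that[of k])
    show "r \<le> 1 / 2 ^ k" using 1 assms by (simp add: field_simps)
    show "1 / 2 ^ k \<le> 2 * r" using 2 assms by (simp add: field_simps)
  qed (rule 3)
qed

text \<open>Given r, choose k with r \<le> 2^(-k) \<le> 2 r. The change of radius costs 2^p, and the
  comparison of n k with the gauge costs c^q. In the applications g is log log (1/r) or log (1/r),
  and r0 keeps it positive.\<close>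

lemma Limsup_of_dyadic:
  fixes F :: "real \<Rightarrow> ennreal" and g :: "real \<Rightarrow> real" and n :: "nat \<Rightarrow> real"
  assumes ev: "\<forall>\<^sub>F k in sequentially. \<forall>r. 0 < r \<longrightarrow> r \<le> 1 / 2 ^ k \<longrightarrow> F r \<le> ennreal (A * (n k powr q * (1 / 2 ^ k) powr p))"
    and A: "0 \<le> A" and q: "0 \<le> q" and p: "0 \<le> p" and c: "0 \<le> c" and n: "\<And>k. 0 \<le> n k"
    and g: "\<And>r k. 0 < r \<Longrightarrow> r < r0 \<Longrightarrow> r \<le> 1 / 2 ^ k \<Longrightarrow> real k * ln 2 \<le> ln (1 / r) \<Longrightarrow> 0 < g r \<and> n k \<le> c * g r"
    and r0: "0 < r0" "r0 \<le> 1"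
  shows "Limsup (at_right 0) (\<lambda>r. F r / ennreal (r powr p * g r powr q)) \<le> ennreal (A * (c powr q * 2 powr p))"
proof -
  obtain K where K: "\<And>k r. k \<ge> K \<Longrightarrow> 0 < r \<Longrightarrow> r \<le> 1 / 2 ^ k \<Longrightarrow> F r \<le> ennreal (A * (n k powr q * (1 / 2 ^ k) powr p))"
    using ev by (auto simp: eventually_sequentially)
  define r1 where "r1 = min r0 (1 / 2 ^ (K + 1))"
  have r1: "0 < r1" unfolding r1_def using r0 by simp
  show ?thesis
  proof (rule Limsup_bounded)
    show "\<forall>\<^sub>F r in at_right 0. F r / ennreal (r powr p * g r powr q) \<le> ennreal (A * (c powr q * 2 powr p))"
      using eventually_at_right_real[OF r1]
    proof eventually_elim
      fix r assume "r \<in> {0<..<r1}"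
      then have r: "0 < r" "r < r0" "r < 1 / 2 ^ (K + 1)" by (auto simp: r1_def)
      then have "r \<le> 1" using r0 by simp
      obtain k where k: "r \<le> 1 / 2 ^ k" "1 / 2 ^ k \<le> 2 * r" "real k * ln 2 \<le> ln (1 / r)"
        using dyadic_level[OF r(1) \<open>r \<le> 1\<close>] by blast
      have "K \<le> k"
      proof (rule ccontr)
        assume "\<not> K \<le> k"
        then have "(2::real) ^ k \<le> 2 ^ K" by (intro power_increasing) auto
        then have "1 / 2 ^ K \<le> (1::real) / 2 ^ k" by (intro divide_left_mono) auto
        then have "1 / 2 ^ K \<le> 2 * r" using k(2) by linarith
        then show False using r(3) by simp
      qed
      have gr: "0 < g r" "n k \<le> c * g r" using g[OF r(1,2) k(1,3)] by auto
      have "F r \<le> ennreal (A * (n k powr q * (1 / 2 ^ k) powr p))" by (rule K[OF \<open>K \<le> k\<close> r(1) k(1)])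
      also have "\<dots> \<le> ennreal (A * ((c * g r) powr q * (2 * r) powr p))"
        using A gr k(2) q p n by (intro ennreal_leI mult_left_mono mult_mono powr_mono2) auto
      also have "A * ((c * g r) powr q * (2 * r) powr p) = (A * (c powr q * 2 powr p)) * (r powr p * g r powr q)"
        by (simp only: powr_mult mult_ac)
      also have "ennreal \<dots> = ennreal (A * (c powr q * 2 powr p)) * ennreal (r powr p * g r powr q)"
        using A by (intro ennreal_mult) auto
      finally have le: "F r \<le> ennreal (A * (c powr q * 2 powr p)) * ennreal (r powr p * g r powr q)" .
      have "0 < ennreal (r powr p * g r powr q)" using r gr by simp
      then show "F r / ennreal (r powr p * g r powr q) \<le> ennreal (A * (c powr q * 2 powr p))"
        using le by (intro divide_le_posI_ennreal) (simp_all add: mult.commute)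
    qed
  qed
qed

lemma max_local_time_mono: "(\<And>x. sets (l x) = sets (restrict_space borel T)) \<Longrightarrow> B \<in> sets borel \<Longrightarrow> T \<in> sets borel \<Longrightarrow> A \<subseteq> B \<Longrightarrow>
  max_local_time l T A \<le> max_local_time l T B"
  unfolding max_local_time_def
  by (intro SUP_mono' emeasure_mono) (auto simp: sets_restrict_space)

context box_field
begin

text \<open>Each width of the mollifier has its own exceptional event, of order exp(-2n), and
  nothing bounds their union. The sample points that lie in all but finitely many of these events
  form an increasing union of intersections, whose measure obeys the same bound as a single event.
  Outside it infinitely many widths are good, and that is enough for
  \<open>max_local_time_locbox_le\<close>.\<close>

lemma local_time_tail:
  fixes L :: "'w \<Rightarrow> real ^ 'd \<Rightarrow> (real ^ 'n) measure"
  assumes L: "AE w in M. jointly_continuous_local_time (\<lambda>t. X t w) T \<tau> h (L w)"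
  obtains A C where "0 < A" "0 \<le> C" "\<And>a r n. a \<in> T \<Longrightarrow> 0 < r \<Longrightarrow> 1 \<le> n \<Longrightarrow>
    \<exists>E\<in>sets M. emeasure M E \<le> ennreal (C * exp (- 2 * real n)) \<and>
      (AE w in M. w \<notin> E \<longrightarrow> max_local_time (L w) T (locbox a r) \<le> ennreal (A * rate r n))"
proof -
  obtain C1 where C1: "0 \<le> C1" and R: "\<And>a (r :: real) m. a \<in> T \<Longrightarrow> 0 < r \<Longrightarrow> 1 \<le> m \<Longrightarrow>
    \<exists>E\<in>sets M. emeasure M E \<le> ennreal (C1 / m\<^sup>2) \<and>
      (\<forall>w\<in>space M - E. \<forall>t\<in>bigS a r. \<forall>c. \<bar>X t w $ c - X a w $ c\<bar> \<le> m * r)"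
    by (rule range_tail) (rule that)
  obtain A C2 where A: "0 < A" and C2: "0 \<le> C2" and S: "\<And>a r e n. a \<in> T \<Longrightarrow> 0 < r \<Longrightarrow> 0 < e \<Longrightarrow> 1 \<le> n \<Longrightarrow>
    \<exists>E\<in>sets M. emeasure M E \<le> ennreal (C2 * exp (- 2 * real n)) \<and>
      (\<forall>w\<in>space M - E. \<forall>x. (\<forall>c. \<bar>x $ c\<bar> \<le> r * exp (real n)) \<longrightarrow> Lmoll (bigS a r) e a x w \<le> A * rate r n)"
    by (rule Lmoll_sup_tail) (rule that)
  show ?thesis
  proof (rule that[of A "C1 + C2"])
    show "0 < A" "0 \<le> C1 + C2" using A C1 C2 by auto
    fix a and r :: real and n :: nat assume a: "a \<in> T" and r: "0 < r" and n: "1 \<le> n"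
    \<comment> \<open>With m = exp(n) the range fails with probability at most C1 exp(-2n), and the
      radius r exp(n) is the half side of the cube in \<open>Lmoll_sup_tail\<close>.\<close>
    have "1 \<le> exp (real n)" by simp
    from R[OF a r this] obtain E0 where E0': "E0 \<in> sets M" "emeasure M E0 \<le> ennreal (C1 / (exp (real n))\<^sup>2)"
      "\<forall>w\<in>space M - E0. \<forall>t\<in>bigS a r. \<forall>c. \<bar>X t w $ c - X a w $ c\<bar> \<le> exp (real n) * r" by (elim bexE conjE) (rule that)
    then have E0: "E0 \<in> sets M" "emeasure M E0 \<le> ennreal (C1 / (exp (real n))\<^sup>2)"
      "\<And>w t c. w \<in> space M - E0 \<Longrightarrow> t \<in> bigS a r \<Longrightarrow> \<bar>X t w $ c - X a w $ c\<bar> \<le> exp (real n) * r"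
      by blast+
    define e where "e = (\<lambda>i::nat. inverse (real (Suc i)))"
    have e: "0 < e i" for i unfolding e_def by simp
    have e0: "e \<longlonglongrightarrow> 0" unfolding e_def by (rule LIMSEQ_inverse_real_of_nat)
    have "\<forall>i. \<exists>E. E \<in> sets M \<and> emeasure M E \<le> ennreal (C2 * exp (- 2 * real n)) \<and>
      (\<forall>w\<in>space M - E. \<forall>x. (\<forall>c. \<bar>x $ c\<bar> \<le> r * exp (real n)) \<longrightarrow> Lmoll (bigS a r) (e i) a x w \<le> A * rate r n)"
      using S[OF a r e n] by blast
    from choice[OF this] obtain E where E': "\<forall>i. E i \<in> sets M \<and> emeasure M (E i) \<le> ennreal (C2 * exp (- 2 * real n)) \<and>
      (\<forall>w\<in>space M - E i. \<forall>x. (\<forall>c. \<bar>x $ c\<bar> \<le> r * exp (real n)) \<longrightarrow> Lmoll (bigS a r) (e i) a x w \<le> A * rate r n)" ..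
    then have E: "\<And>i. E i \<in> sets M" "\<And>i. emeasure M (E i) \<le> ennreal (C2 * exp (- 2 * real n))"
      "\<And>i w x. w \<in> space M - E i \<Longrightarrow> (\<And>c. \<bar>x $ c\<bar> \<le> r * exp (real n)) \<Longrightarrow> Lmoll (bigS a r) (e i) a x w \<le> A * rate r n"
      by blast+
    define G where "G = (\<lambda>N. \<Inter>i\<in>{N..}. E i)"
    have G: "G N \<in> sets M" for N unfolding G_def using E(1) by (intro sets.countable_INT') auto
    have "incseq G" unfolding G_def by (intro monoI INF_superset_mono) auto
    then have "emeasure M (\<Union>N. G N) = (SUP N. emeasure M (G N))"
      using G by (intro SUP_emeasure_incseq[symmetric]) auto
    also have "\<dots> \<le> ennreal (C2 * exp (- 2 * real n))"
    proof (intro SUP_least order_trans[OF emeasure_mono E(2)])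
      show "G N \<subseteq> E N" for N unfolding G_def by auto
    qed (rule E(1))
    finally have Gm: "emeasure M (\<Union>N. G N) \<le> ennreal (C2 * exp (- 2 * real n))" .
    have GU: "(\<Union>N. G N) \<in> sets M" using G by auto
    show "\<exists>E\<in>sets M. emeasure M E \<le> ennreal ((C1 + C2) * exp (- 2 * real n)) \<and>
      (AE w in M. w \<notin> E \<longrightarrow> max_local_time (L w) T (locbox a r) \<le> ennreal (A * rate r n))"
    proof (intro bexI[of _ "E0 \<union> (\<Union>N. G N)"] conjI)
      have "emeasure M (E0 \<union> (\<Union>N. G N)) \<le> emeasure M E0 + emeasure M (\<Union>N. G N)"
        using E0(1) GU by (rule emeasure_subadditive)
      also have "\<dots> \<le> ennreal (C1 * exp (- 2 * real n)) + ennreal (C2 * exp (- 2 * real n))"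
      proof (intro add_mono Gm)
        have "C1 / (exp (real n))\<^sup>2 = C1 * exp (- 2 * real n)"
          by (simp add: exp_double[symmetric] exp_minus divide_inverse)
        then show "emeasure M E0 \<le> ennreal (C1 * exp (- 2 * real n))" using E0(2) by simp
      qed
      also have "\<dots> = ennreal ((C1 + C2) * exp (- 2 * real n))"
        using C1 C2 by (simp add: ennreal_plus[symmetric] distrib_right del: ennreal_plus)
      finally show "emeasure M (E0 \<union> (\<Union>N. G N)) \<le> ennreal ((C1 + C2) * exp (- 2 * real n))" .
      show "E0 \<union> (\<Union>N. G N) \<in> sets M" using E0(1) GU by auto
      show "AE w in M. w \<notin> E0 \<union> (\<Union>N. G N) \<longrightarrow> max_local_time (L w) T (locbox a r) \<le> ennreal (A * rate r n)"
        using L AE_space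
      proof eventually_elim
        case (elim w)
        show ?case
        proof
          assume w: "w \<notin> E0 \<union> (\<Union>N. G N)"
          show "max_local_time (L w) T (locbox a r) \<le> ennreal (A * rate r n)"
          proof (rule max_local_time_locbox_le[OF elim(1,2) a r _ e e0, where m="exp (real n) * r"])
            show "\<bar>X t w $ c - X a w $ c\<bar> \<le> exp (real n) * r" if "t \<in> bigS a r" for t c
              using E0(3)[of w t c] w elim(2) that by auto
            show "0 \<le> A * rate r n" using A unfolding rate_def by simp
            have "\<exists>i\<ge>N. w \<notin> E i" for N using w unfolding G_def by auto
            then have "\<exists>\<^sub>F i in sequentially. w \<notin> E i" by (simp add: frequently_sequentially)
            then show "\<exists>\<^sub>F i in sequentially. \<forall>x. (\<forall>c. \<bar>x $ c\<bar> \<le> exp (real n) * r) \<longrightarrow> Lmoll (bigS a r) (e i) a x w \<le> A * rate r n"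
              by (rule frequently_elim1) (use E(3) elim(2) in \<open>auto simp: mult.commute\<close>)
          qed
        qed
      qed
    qed
  qed
qed

lemma Q_pos: "0 < Q_dim H" using dQ by (metis of_nat_0_le_iff order_le_less_trans)

text \<open>The failure probabilities exp(-2n) become summable like 1/(k+2)^2, and k is of order log
  (1/r), whence the iterated logarithm. The constant is built from A, d and Q alone, so it is the
  same for all centres.\<close>

lemma law_iterated_log:
  fixes L :: "'w \<Rightarrow> real ^ 'd \<Rightarrow> (real ^ 'n) measure"
  assumes L: "AE w in M. jointly_continuous_local_time (\<lambda>t. X t w) T \<tau> h (L w)"
  obtains C where "\<And>t. t \<in> T \<Longrightarrow> AE w in M.
       Limsup (at_right 0) (\<lambda>r. max_local_time (L w) T (rho_ball H t r)
           / ennreal (phi_gauge (Q_dim H) (real CARD('d)) r)) \<le> ennreal C"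
proof -
  obtain A C where A: "0 < A" and C: "0 \<le> C" and tail: "\<And>a r n. a \<in> T \<Longrightarrow> 0 < r \<Longrightarrow> 1 \<le> n \<Longrightarrow>
    \<exists>E\<in>sets M. emeasure M E \<le> ennreal (C * exp (- 2 * real n)) \<and>
      (AE w in M. w \<notin> E \<longrightarrow> max_local_time (L w) T (locbox a r) \<le> ennreal (A * rate r n))"
    by (rule local_time_tail[OF L]) (rule that)
  let ?q = "real CARD('d) / Q_dim H" and ?p = "Q_dim H - real CARD('d)"
  \<comment> \<open>The shift by 2 keeps the logarithm positive, so that the moment order is at
    least 1.\<close>
  define n where "n = (\<lambda>k::nat. nat \<lceil>ln (real (k + 2))\<rceil>)"
  have ln_pos: "0 < ln (real (k + 2))" for k by simp
  have n1: "1 \<le> n k" for k unfolding n_def using ln_pos[of k] by linarith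
  have n_ge: "ln (real (k + 2)) \<le> real (n k)" for k unfolding n_def by linarith
  have n_le: "real (n k) \<le> ln (real (k + 2)) + 1" for k unfolding n_def using ln_pos[of k] by linarith
  show ?thesis
  proof (rule that[of "A * (3 powr ?q * 2 powr ?p)"])
    fix a assume a: "a \<in> T"
    have "\<forall>k. \<exists>E. E \<in> sets M \<and> emeasure M E \<le> ennreal (C * exp (- 2 * real (n k))) \<and>
      (AE w in M. w \<notin> E \<longrightarrow> max_local_time (L w) T (locbox a (1 / 2 ^ k)) \<le> ennreal (A * rate (1 / 2 ^ k) (n k)))"
    proof
      fix k
      have "0 < (1::real) / 2 ^ k" by simp
      from tail[OF a this n1[of k]] show "\<exists>E. E \<in> sets M \<and> emeasure M E \<le> ennreal (C * exp (- 2 * real (n k))) \<and>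
        (AE w in M. w \<notin> E \<longrightarrow> max_local_time (L w) T (locbox a (1 / 2 ^ k)) \<le> ennreal (A * rate (1 / 2 ^ k) (n k)))"
        by blast
    qed
    from choice[OF this] obtain E where E': "\<forall>k. E k \<in> sets M \<and> emeasure M (E k) \<le> ennreal (C * exp (- 2 * real (n k))) \<and>
      (AE w in M. w \<notin> E k \<longrightarrow> max_local_time (L w) T (locbox a (1 / 2 ^ k)) \<le> ennreal (A * rate (1 / 2 ^ k) (n k)))" ..
    then have E: "\<And>k. E k \<in> sets M" "\<And>k. emeasure M (E k) \<le> ennreal (C * exp (- 2 * real (n k)))"
      "\<And>k. AE w in M. w \<notin> E k \<longrightarrow> max_local_time (L w) T (locbox a (1 / 2 ^ k)) \<le> ennreal (A * rate (1 / 2 ^ k) (n k))"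
      by simp_all
    have sm: "summable (\<lambda>k. C * exp (- 2 * real (n k)))"
    proof (rule summable_comparison_test'[of "\<lambda>k. C * (1 / (real (k + 2))\<^sup>2)" 0])
      have "summable (\<lambda>k. inverse (real (k + 2) ^ 2))"
        using inverse_power_summable[of 2, where 'a=real] by (subst summable_iff_shift) auto
      then show "summable (\<lambda>k. C * (1 / (real (k + 2))\<^sup>2))" by (intro summable_mult) (simp add: inverse_eq_divide)
      show "norm (C * exp (- 2 * real (n k))) \<le> C * (1 / (real (k + 2))\<^sup>2)" for k
      proof -
        have "exp (- 2 * real (n k)) \<le> 1 / (real (k + 2))\<^sup>2"
          by (rule exp_minus_two_ln_le[OF _ n_ge]) simp
        then have "C * exp (- 2 * real (n k)) \<le> C * (1 / (real (k + 2))\<^sup>2)" using C by (rule mult_left_mono)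
        then show ?thesis using C by simp
      qed
    qed
    have "AE w in M. \<forall>\<^sub>F k in sequentially. max_local_time (L w) T (locbox a (1 / 2 ^ k)) \<le> ennreal (A * rate (1 / 2 ^ k) (n k))"
      by (rule borel_cantelli_sup_bound[OF prob E(1,2) _ sm E(3)]) (use C in simp)
    then show "AE w in M. Limsup (at_right 0) (\<lambda>r. max_local_time (L w) T (rho_ball H a r)
           / ennreal (phi_gauge (Q_dim H) (real CARD('d)) r)) \<le> ennreal (A * (3 powr ?q * 2 powr ?p))"
      using L
    proof eventually_elim
      case (elim w)
      show ?case unfolding phi_gauge_def
      proof (rule Limsup_of_dyadic[where n="\<lambda>k. real (n k)" and ?r0.0="exp (- 6)"])
        show "\<forall>\<^sub>F k in sequentially. \<forall>r. 0 < r \<longrightarrow> r \<le> 1 / 2 ^ k \<longrightarrow>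
            max_local_time (L w) T (rho_ball H a r) \<le> ennreal (A * (real (n k) powr ?q * (1 / 2 ^ k) powr ?p))"
          using elim(1)
        proof (rule eventually_mono, intro allI impI)
          fix k and r :: real assume *: "max_local_time (L w) T (locbox a (1 / 2 ^ k)) \<le> ennreal (A * rate (1 / 2 ^ k) (n k))"
            and r: "0 < r" "r \<le> 1 / 2 ^ k"
          have "rho_ball H a r \<subseteq> rho_ball H a (1 / 2 ^ k)" using r unfolding rho_ball_def by auto
          also have "\<dots> \<subseteq> locbox a (1 / 2 ^ k)" by (rule rho_ball_subset_locbox) simp
          finally have "max_local_time (L w) T (rho_ball H a r) \<le> max_local_time (L w) T (locbox a (1 / 2 ^ k))"
            using elim(2) by (intro max_local_time_mono) (auto simp: jointly_continuous_local_time_def)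
          then show "max_local_time (L w) T (rho_ball H a r) \<le> ennreal (A * (real (n k) powr ?q * (1 / 2 ^ k) powr ?p))"
            using * unfolding rate_def by (rule order_trans)
        qed
        show "0 < ln (ln (1 / r)) \<and> real (n k) \<le> 3 * ln (ln (1 / r))"
          if r: "0 < r" "r < exp (- 6)" and k: "real k * ln 2 \<le> ln (1 / r)" for r k
        proof -
          \<comment> \<open>For y > 6 one has e (k + 2) \<le> 3 (2 y + 2) \<le> y^3, so log (k + 2),
            plus 1 for rounding up, is at most 3 log y. This is the origin of the constant 3 and of
            the threshold exp(-6).\<close>
          define y where "y = ln (1 / r)"
          have "ln r < ln (exp (- 6))" using r by (subst ln_less_cancel_iff) auto
          then have y6: "6 < y" unfolding y_def using r by (simp add: ln_div)
          have "real k * (1/2) \<le> real k * ln 2" using ln2_ge_two_thirds by (intro mult_left_mono) auto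
          then have "real (k + 2) \<le> 2 * y + 2" using k unfolding y_def by simp
          then have "exp 1 * real (k + 2) \<le> 3 * (2 * y + 2)" using exp_le by (intro mult_mono) auto
          also have "\<dots> \<le> y * y + 6"
          proof -
            have "6 * y \<le> y * y" using y6 by (intro mult_right_mono) auto
            then show ?thesis by simp
          qed
          finally have "exp 1 * real (k + 2) \<le> y * y + 6" .
          also have "\<dots> \<le> y * y * y" 
          proof -
            have "6 * (y * y) \<le> y * (y * y)" using y6 by (intro mult_right_mono) auto
            moreover have "6 * 6 \<le> y * y" using y6 by (intro mult_mono) auto
            ultimately show ?thesis by (simp add: mult.assoc)
          qed
          finally have "exp 1 * real (k + 2) \<le> y ^ 3" by (simp add: power3_eq_cube)
          then have "ln (exp 1 * real (k + 2)) \<le> ln (y ^ 3)" using y6 by (subst ln_le_cancel_iff) auto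
          then have "ln (real (k + 2)) + 1 \<le> 3 * ln y" using y6 by (simp add: ln_mult ln_realpow)
          then show ?thesis using n_le[of k] y6 unfolding y_def[symmetric] by (auto intro: order_trans)
        qed
      qed (use A dQ Q_pos in auto)
    qed
  qed
qed

text \<open>T is cut into cells of side \<delta> k, and the number of cells grows like a power of
  2^k, which forces a moment order proportional to k. A cell is represented by one of its own points
  in T, because the tail bound requires centres in T, and grid points may fall outside.\<close>

lemma law_uniform:
  fixes L :: "'w \<Rightarrow> real ^ 'd \<Rightarrow> (real ^ 'n) measure"
  assumes L: "AE w in M. jointly_continuous_local_time (\<lambda>t. X t w) T \<tau> h (L w)"
  obtains C where "AE w in M.
       Limsup (at_right 0) (\<lambda>r. SUP t\<in>T. max_local_time (L w) T (rho_ball H t r)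
           / ennreal (Phi_gauge (Q_dim H) (real CARD('d)) r)) \<le> ennreal C"
proof -
  obtain A C where A: "0 < A" and C: "0 \<le> C" and tail: "\<And>a r n. a \<in> T \<Longrightarrow> 0 < r \<Longrightarrow> 1 \<le> n \<Longrightarrow>
    \<exists>E\<in>sets M. emeasure M E \<le> ennreal (C * exp (- 2 * real n)) \<and>
      (AE w in M. w \<notin> E \<longrightarrow> max_local_time (L w) T (locbox a r) \<le> ennreal (A * rate r n))"
    by (rule local_time_tail[OF L]) (rule that)
  let ?q = "real CARD('d) / Q_dim H" and ?p = "Q_dim H - real CARD('d)"
  \<comment> \<open>The exponent 1/\<open>eta\<close> is the largest of the 1/H_j and the base is at
    most 1, so this single mesh is fine enough in every coordinate.\<close>
  define \<delta> where "\<delta> = (\<lambda>k::nat. (1 / 2 ^ k :: real) powr (1 / eta))"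
  have d: "0 < \<delta> k" "\<delta> k \<le> 1" "\<delta> k \<le> (1 / 2 ^ k) powr (1 / H $ j)" for k j
  proof -
    show "0 < \<delta> k" unfolding \<delta>_def by simp
    have x: "(1::real) / 2 ^ k \<le> 1" by simp
    show "\<delta> k \<le> 1" unfolding \<delta>_def using x eta(1) by (intro powr_le1) auto
    have "1 / H $ j \<le> 1 / eta" using eta(1) eta(2)[of j] by (intro divide_left_mono) auto
    then show "\<delta> k \<le> (1 / 2 ^ k) powr (1 / H $ j)" unfolding \<delta>_def using x by (intro powr_mono') auto
  qed
  define hm where "hm = (\<Sum>j\<in>UNIV. h $ j)"
  have hm: "h $ j \<le> hm" "0 \<le> hm" for j
  proof -
    have h0: "0 \<le> h $ j" for j using h_pos[of j] by simp
    show "h $ j \<le> hm" unfolding hm_def by (rule member_le_sum) (use h0 in auto)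
    show "0 \<le> hm" unfolding hm_def by (rule sum_nonneg) (rule h0)
  qed
  define N where "N = (\<lambda>k. nat \<lfloor>hm / \<delta> k\<rfloor>)"
  define ix where "ix = (\<lambda>k t j. nat \<lfloor>(t $ j - \<tau> $ j) / \<delta> k\<rfloor>)"
  define Zs where "Zs = (\<lambda>k. ix k ` T)"
  define rep where "rep = (\<lambda>k z. SOME t. t \<in> T \<and> ix k t = z)"
  have rep: "rep k z \<in> T" "ix k (rep k z) = z" if "z \<in> Zs k" for k z
    using that someI_ex[of "\<lambda>t. t \<in> T \<and> ix k t = z"] unfolding Zs_def rep_def by auto
  have tT: "\<tau> $ j \<le> t $ j" "t $ j \<le> \<tau> $ j + h $ j" if "t \<in> T" for t j
    using that T_subset by (auto simp: mem_box_cart)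
  have Zsub: "Zs k \<subseteq> {z. \<forall>j. z j \<le> N k}" for k
  proof
    fix z assume "z \<in> Zs k"
    then obtain t where t: "t \<in> T" "z = ix k t" unfolding Zs_def by auto
    have "z j \<le> N k" for j
    proof -
      have "t $ j - \<tau> $ j \<le> hm" using tT(2)[OF t(1), of j] hm(1)[of j] by linarith
      then have "(t $ j - \<tau> $ j) / \<delta> k \<le> hm / \<delta> k" using d(1)[of k] by (intro divide_right_mono) auto
      then show ?thesis unfolding t(2) ix_def N_def by (intro nat_mono floor_mono)
    qed
    then show "z \<in> {z. \<forall>j. z j \<le> N k}" by simp
  qed
  have finZ: "finite (Zs k)" for k by (rule finite_subset[OF Zsub finite_grid])
  define \<kappa>' where "\<kappa>' = real CARD('n) * (ln 2 / eta)"
  have cardZ: "real (card (Zs k)) \<le> (hm + 1) ^ CARD('n) * exp (\<kappa>' * real k)" for k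
  proof -
    have "card (Zs k) \<le> (N k + 1) ^ CARD('n)"
      using card_mono[OF finite_grid Zsub, of k] unfolding card_grid .
    then have "real (card (Zs k)) \<le> (real (N k) + 1) ^ CARD('n)"
      by (metis of_nat_1 of_nat_add of_nat_mono of_nat_power)
    also have "\<dots> \<le> ((hm + 1) * exp (ln 2 / eta * real k)) ^ CARD('n)"
    proof (rule power_mono)
      have "real (N k) \<le> hm / \<delta> k" unfolding N_def using hm(2) d(1)[of k] by simp
      moreover have "1 \<le> 1 / \<delta> k" using d(1,2)[of k] by simp
      ultimately have "real (N k) + 1 \<le> (hm + 1) * (1 / \<delta> k)" by (simp add: add_divide_distrib)
      also have "1 / \<delta> k = exp (ln 2 / eta * real k)"
        unfolding \<delta>_def powr_def by (simp add: ln_div ln_realpow exp_minus field_simps)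
      finally show "real (N k) + 1 \<le> (hm + 1) * exp (ln 2 / eta * real k)" .
    qed simp
    also have "\<dots> = (hm + 1) ^ CARD('n) * exp (\<kappa>' * real k)"
      unfolding \<kappa>'_def by (simp add: power_mult_distrib exp_of_nat_mult[symmetric] mult.assoc)
    finally show ?thesis .
  qed
  \<comment> \<open>The number of cells is of order exp(\<kappa>' k); with q0 \<ge> \<kappa>' + 1
    its product with exp(-2 n k) is at most of order exp(-k), hence summable.\<close>
  obtain q0 :: nat where q0: "\<kappa>' + 1 \<le> real q0" using real_arch_simple by blast
  have "0 \<le> \<kappa>'" unfolding \<kappa>'_def using eta(1) by simp
  then have q1: "1 \<le> q0" using q0 by linarith
  define n where "n = (\<lambda>k::nat. q0 * (k + 1))"
  have n1: "1 \<le> n k" for k unfolding n_def using q1 by simp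
  define b where "b = (\<lambda>k::nat. (hm + 1) ^ CARD('n) * C * exp (- 1) ^ k)"
  have bound: "real (card (Zs k)) * (C * exp (- 2 * real (n k))) \<le> b k" for k
  proof -
    have "(\<kappa>' + 1) * real k \<le> real q0 * (2 * real (k + 1))" using q0 \<open>0 \<le> \<kappa>'\<close> by (intro mult_mono) auto
    then have "exp (- 2 * real (n k)) \<le> exp (- (\<kappa>' + 1) * real k)" unfolding n_def by (simp add: algebra_simps)
    then have "real (card (Zs k)) * (C * exp (- 2 * real (n k))) \<le> ((hm + 1) ^ CARD('n) * exp (\<kappa>' * real k)) * (C * exp (- (\<kappa>' + 1) * real k))"
      using C hm(2) by (intro mult_mono cardZ mult_left_mono) auto
    also have "\<dots> = (hm + 1) ^ CARD('n) * C * (exp (\<kappa>' * real k) * exp (- (\<kappa>' + 1) * real k))" by (simp only: mult_ac)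
    also have "exp (\<kappa>' * real k) * exp (- (\<kappa>' + 1) * real k) = exp (- 1) ^ k"
      unfolding exp_add[symmetric] exp_of_nat_mult[symmetric] by (rule arg_cong[where f=exp]) (simp add: algebra_simps)
    finally show ?thesis unfolding b_def .
  qed
  let ?P = "\<lambda>k w. \<forall>z\<in>Zs k. max_local_time (L w) T (locbox (rep k z) (1 / 2 ^ k)) \<le> ennreal (A * rate (1 / 2 ^ k) (n k))"
  have "\<forall>k. \<exists>E. E \<in> sets M \<and> emeasure M E \<le> ennreal (b k) \<and> (AE w in M. w \<notin> E \<longrightarrow> ?P k w)"
  proof
    fix k
    have "\<forall>z\<in>Zs k. \<exists>E. E \<in> sets M \<and> emeasure M E \<le> ennreal (C * exp (- 2 * real (n k))) \<and>
      (AE w in M. w \<notin> E \<longrightarrow> max_local_time (L w) T (locbox (rep k z) (1 / 2 ^ k)) \<le> ennreal (A * rate (1 / 2 ^ k) (n k)))"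
    proof
      fix z assume z: "z \<in> Zs k"
      have "0 < (1::real) / 2 ^ k" by simp
      from tail[OF rep(1)[OF z] this n1[of k]] show "\<exists>E. E \<in> sets M \<and> emeasure M E \<le> ennreal (C * exp (- 2 * real (n k))) \<and>
        (AE w in M. w \<notin> E \<longrightarrow> max_local_time (L w) T (locbox (rep k z) (1 / 2 ^ k)) \<le> ennreal (A * rate (1 / 2 ^ k) (n k)))"
        by blast
    qed
    from bchoice[OF this] obtain E where E: "\<forall>z\<in>Zs k. E z \<in> sets M \<and> emeasure M (E z) \<le> ennreal (C * exp (- 2 * real (n k))) \<and>
      (AE w in M. w \<notin> E z \<longrightarrow> max_local_time (L w) T (locbox (rep k z) (1 / 2 ^ k)) \<le> ennreal (A * rate (1 / 2 ^ k) (n k)))" ..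
    have Es: "(\<Union>z\<in>Zs k. E z) \<in> sets M" using E finZ by (intro sets.finite_UN) auto
    have "emeasure M (\<Union>z\<in>Zs k. E z) \<le> (\<Sum>z\<in>Zs k. emeasure M (E z))"
      using E finZ by (intro emeasure_subadditive_finite) auto
    also have "\<dots> \<le> (\<Sum>z\<in>Zs k. ennreal (C * exp (- 2 * real (n k))))" using E by (intro sum_mono) auto
    also have "\<dots> = ennreal (real (card (Zs k)) * (C * exp (- 2 * real (n k))))"
      unfolding sum_constant ennreal_of_nat_eq_real_of_nat by (rule ennreal_mult'[symmetric]) simp
    also have "\<dots> \<le> ennreal (b k)" by (rule ennreal_leI[OF bound])
    finally have Em: "emeasure M (\<Union>z\<in>Zs k. E z) \<le> ennreal (b k)" .
    have "AE w in M. \<forall>z\<in>Zs k. w \<notin> E z \<longrightarrow> max_local_time (L w) T (locbox (rep k z) (1 / 2 ^ k)) \<le> ennreal (A * rate (1 / 2 ^ k) (n k))"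
      using E finZ by (intro AE_finite_allI) auto
    then have "AE w in M. w \<notin> (\<Union>z\<in>Zs k. E z) \<longrightarrow> ?P k w" by eventually_elim blast
    with Es Em show "\<exists>E. E \<in> sets M \<and> emeasure M E \<le> ennreal (b k) \<and> (AE w in M. w \<notin> E \<longrightarrow> ?P k w)" by blast
  qed
  from choice[OF this] obtain E where E': "\<forall>k. E k \<in> sets M \<and> emeasure M (E k) \<le> ennreal (b k) \<and> (AE w in M. w \<notin> E k \<longrightarrow> ?P k w)" ..
  then have E: "\<And>k. E k \<in> sets M" "\<And>k. emeasure M (E k) \<le> ennreal (b k)" "\<And>k. AE w in M. w \<notin> E k \<longrightarrow> ?P k w"
    by simp_all
  have b0: "0 \<le> b k" for k unfolding b_def using C hm(2) by simp
  have sm: "summable b" unfolding b_def by (intro summable_mult summable_geometric) simp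
  show ?thesis
  proof (rule that[of "A * ((3 * real q0) powr ?q * 2 powr ?p)"])
    have "AE w in M. \<forall>\<^sub>F k in sequentially. ?P k w"
      by (rule borel_cantelli_sup_bound[OF prob E(1,2) b0 sm E(3)])
    then show "AE w in M. Limsup (at_right 0) (\<lambda>r. SUP t\<in>T. max_local_time (L w) T (rho_ball H t r)
           / ennreal (Phi_gauge (Q_dim H) (real CARD('d)) r)) \<le> ennreal (A * ((3 * real q0) powr ?q * 2 powr ?p))"
      using L
    proof eventually_elim
      case (elim w)
      \<comment> \<open>The denominator does not depend on t and is taken out of the supremum; the
        inequality in this direction suffices.\<close>
      have "Limsup (at_right 0) (\<lambda>r. SUP t\<in>T. max_local_time (L w) T (rho_ball H t r) / ennreal (Phi_gauge (Q_dim H) (real CARD('d)) r))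
         \<le> Limsup (at_right 0) (\<lambda>r. (SUP t\<in>T. max_local_time (L w) T (rho_ball H t r)) / ennreal (r powr ?p * ln (1 / r) powr ?q))"
        unfolding Phi_gauge_def
        by (intro Limsup_mono always_eventually allI SUP_least divide_right_mono_ennreal SUP_upper)
      also have "\<dots> \<le> ennreal (A * ((3 * real q0) powr ?q * 2 powr ?p))"
      proof (rule Limsup_of_dyadic[where n="\<lambda>k. real (n k)" and ?r0.0="exp (- 1)"])
        show "\<forall>\<^sub>F k in sequentially. \<forall>r. 0 < r \<longrightarrow> r \<le> 1 / 2 ^ k \<longrightarrow>
            (SUP t\<in>T. max_local_time (L w) T (rho_ball H t r)) \<le> ennreal (A * (real (n k) powr ?q * (1 / 2 ^ k) powr ?p))"
          using elim(1)
        proof (rule eventually_mono, intro allI impI SUP_least)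
          fix k and r :: real and t assume P: "?P k w" and r: "0 < r" "r \<le> 1 / 2 ^ k" and t: "t \<in> T"
          define z where "z = ix k t"
          have z: "z \<in> Zs k" unfolding z_def Zs_def using t by simp
          let ?a = "rep k z"
          have near: "\<bar>t $ j - ?a $ j\<bar> < \<delta> k" for j
          proof -
            have "ix k t j = ix k ?a j" using rep(2)[OF z] unfolding z_def by metis
            moreover have "0 \<le> (t $ j - \<tau> $ j) / \<delta> k" "0 \<le> (?a $ j - \<tau> $ j) / \<delta> k"
              using tT(1)[OF t, of j] tT(1)[OF rep(1)[OF z], of j] d(1)[of k] by auto
            ultimately have "\<lfloor>(t $ j - \<tau> $ j) / \<delta> k\<rfloor> = \<lfloor>(?a $ j - \<tau> $ j) / \<delta> k\<rfloor>"
              unfolding ix_def by (simp add: eq_nat_nat_iff)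
            then have "\<bar>(t $ j - \<tau> $ j) / \<delta> k - (?a $ j - \<tau> $ j) / \<delta> k\<bar> < 1" by linarith
            also have "(t $ j - \<tau> $ j) / \<delta> k - (?a $ j - \<tau> $ j) / \<delta> k = (t $ j - ?a $ j) / \<delta> k"
              by (simp add: diff_divide_distrib[symmetric])
            finally show ?thesis using d(1)[of k] by (simp add: abs_divide)
          qed
          \<comment> \<open>The displacement from t to the representative and the extent of the ball
            each use at most (2^(-k))^(1/H_j) in coordinate j, the first one strictly less. This is
            where the factor 2 in \<open>locbox\<close> is spent.\<close>
          have "rho_ball H t r \<subseteq> locbox ?a (1 / 2 ^ k)"
          proof
            fix s assume "s \<in> rho_ball H t r"
            then have "\<bar>s $ j - t $ j\<bar> \<le> r powr (1 / H $ j)" for j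
              using rho_le_imp_abs_le[OF H01(1)] by (auto simp: rho_ball_def)
            moreover have "r powr (1 / H $ j) \<le> (1 / 2 ^ k) powr (1 / H $ j)" for j
              using r H01(1)[of j] by (intro powr_mono2) auto
            ultimately have "\<bar>s $ j - t $ j\<bar> \<le> (1 / 2 ^ k) powr (1 / H $ j)" for j by (rule order_trans)
            then have "?a $ j - 2 * (1 / 2 ^ k) powr (1 / H $ j) < s $ j \<and> s $ j \<le> ?a $ j + 2 * (1 / 2 ^ k) powr (1 / H $ j)" for j
              using near[of j] d(3)[of k j] by (smt (verit))
            then show "s \<in> locbox ?a (1 / 2 ^ k)" unfolding locbox_def by blast
          qed
          then have "max_local_time (L w) T (rho_ball H t r) \<le> max_local_time (L w) T (locbox ?a (1 / 2 ^ k))"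
            using elim(2) by (intro max_local_time_mono) (auto simp: jointly_continuous_local_time_def)
          also have "\<dots> \<le> ennreal (A * rate (1 / 2 ^ k) (n k))" using P z by blast
          finally show "max_local_time (L w) T (rho_ball H t r) \<le> ennreal (A * (real (n k) powr ?q * (1 / 2 ^ k) powr ?p))"
            unfolding rate_def .
        qed
        show "0 < ln (1 / r) \<and> real (n k) \<le> 3 * real q0 * ln (1 / r)"
          if r: "0 < r" "r < exp (- 1)" and k: "real k * ln 2 \<le> ln (1 / r)" for r k
        proof -
          define y where "y = ln (1 / r)"
          have "ln r < ln (exp (- 1))" using r by (subst ln_less_cancel_iff) auto
          then have y1: "1 < y" unfolding y_def using r by (simp add: ln_div)
          have "real k * (1/2) \<le> real k * ln 2" using ln2_ge_two_thirds by (intro mult_left_mono) auto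
          then have "real (k + 1) \<le> 3 * y" using k y1 unfolding y_def[symmetric] by simp
          then have *: "real q0 * real (k + 1) \<le> real q0 * (3 * y)" by (intro mult_left_mono) auto
          have "real (n k) = real q0 * real (k + 1)" unfolding n_def by (rule of_nat_mult)
          then have "real (n k) \<le> 3 * real q0 * y" using * by (simp only: mult_ac)
          then show ?thesis unfolding y_def[symmetric] using y1 by simp
        qed
      qed (use A dQ Q_pos q1 in auto)
      finally show ?case .
    qed
  qed
qed

end

section \<open>Transfer of the law of Y to the components of X\<close>

lemma path_measurable:
  assumes "\<And>t. Z t \<in> borel_measurable M"
  shows "(\<lambda>w t. Z t w) \<in> measurable M (Pi\<^sub>M UNIV (\<lambda>_. borel))"
  using assms by (intro measurable_PiM_single') auto

text \<open>Each inner product is a bounded functional of the path of one component. Independence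
  factorises the expectation over the components, and equality in law replaces each path by that of
  Y.\<close>

lemma iid_copies_factor:
  fixes X :: "'t \<Rightarrow> 'w \<Rightarrow> real ^ 'd::finite" and \<phi> :: "nat \<Rightarrow> 'd \<Rightarrow> real \<Rightarrow> real"
  assumes M: "prob_space M" and X [measurable]: "\<And>t. X t \<in> borel_measurable M" and Y [measurable]: "\<And>t. Y t \<in> borel_measurable M'"
    and iid: "iid_copies M X M' Y"
    and \<phi> [measurable]: "\<And>j c. \<phi> j c \<in> borel_measurable borel" and B: "\<And>j c z. \<bar>\<phi> j c z\<bar> \<le> B"
  shows "(\<integral>w. (\<Prod>c\<in>UNIV. \<Prod>j<n. \<phi> j c (X (t j) w $ c - X a w $ c)) \<partial>M)
        = (\<Prod>c\<in>UNIV. \<integral>w. (\<Prod>j<n. \<phi> j c (Y (t j) w - Y a w)) \<partial>M')"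
proof -
  interpret prob_space M by fact
  define \<Psi> where "\<Psi> = (\<lambda>c (p :: 't \<Rightarrow> real). \<Prod>j<n. \<phi> j c (p (t j) - p a))"
  have ev: "(\<lambda>p :: 't \<Rightarrow> real. p s) \<in> borel_measurable (Pi\<^sub>M UNIV (\<lambda>_. borel))" for s
    by (rule measurable_component_singleton) simp
  note [measurable] = ev
  have \<Psi> [measurable]: "\<Psi> c \<in> borel_measurable (Pi\<^sub>M UNIV (\<lambda>_. borel))" for c
    unfolding \<Psi>_def by (intro borel_measurable_prod measurable_compose[OF _ \<phi>] borel_measurable_diff ev)
  have Xp: "(\<lambda>w t. X t w $ c) \<in> measurable M (Pi\<^sub>M UNIV (\<lambda>_. borel))" for c
    by (rule path_measurable) measurable
  have Yp: "(\<lambda>w t. Y t w) \<in> measurable M' (Pi\<^sub>M UNIV (\<lambda>_. borel))"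
    by (rule path_measurable) measurable
  have "indep_vars (\<lambda>_. Pi\<^sub>M UNIV (\<lambda>_. borel)) (\<lambda>i w t. X t w $ i) UNIV"
    using iid by (simp add: iid_copies_def)
  then have ind: "indep_vars (\<lambda>_. borel) (\<lambda>c w. \<Psi> c (\<lambda>t. X t w $ c)) UNIV"
    by (rule indep_vars_compose2) (rule \<Psi>)
  have bd: "\<bar>\<Psi> c p\<bar> \<le> (\<Prod>j<n. B)" for c p
    unfolding \<Psi>_def abs_prod using B by (intro prod_mono) auto
  have "(\<integral>w. (\<Prod>c\<in>UNIV. \<Psi> c (\<lambda>t. X t w $ c)) \<partial>M) = (\<Prod>c\<in>UNIV. \<integral>w. \<Psi> c (\<lambda>t. X t w $ c) \<partial>M)"
  proof (rule indep_vars_lebesgue_integral[OF finite_class.finite_UNIV ind])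
    show "integrable M (\<lambda>w. \<Psi> c (\<lambda>t. X t w $ c))" for c
      by (rule integrable_const_bound[where B="\<Prod>j<n. B"])
        (use bd measurable_compose[OF Xp \<Psi>] in auto)
  qed
  also have "\<dots> = (\<Prod>c\<in>UNIV. \<integral>w. \<Psi> c (\<lambda>t. Y t w) \<partial>M')"
  proof (intro prod.cong refl)
    fix c
    have "(\<integral>w. \<Psi> c (\<lambda>t. X t w $ c) \<partial>M) = (\<integral>p. \<Psi> c p \<partial>distr M (Pi\<^sub>M UNIV (\<lambda>_. borel)) (\<lambda>w t. X t w $ c))"
      by (rule integral_distr[symmetric, OF Xp \<Psi>])
    also have "distr M (Pi\<^sub>M UNIV (\<lambda>_. borel)) (\<lambda>w t. X t w $ c) = distr M' (Pi\<^sub>M UNIV (\<lambda>_. borel)) (\<lambda>w t. Y t w)"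
      using iid by (simp add: iid_copies_def)
    also have "(\<integral>p. \<Psi> c p \<partial>\<dots>) = (\<integral>w. \<Psi> c (\<lambda>t. Y t w) \<partial>M')"
      by (rule integral_distr[OF Yp \<Psi>])
    finally show "(\<integral>w. \<Psi> c (\<lambda>t. X t w $ c) \<partial>M) = (\<integral>w. \<Psi> c (\<lambda>t. Y t w) \<partial>M')" .
  qed
  finally show ?thesis unfolding \<Psi>_def .
qed

lemma iid_copies_moment:
  fixes X :: "'t \<Rightarrow> 'w \<Rightarrow> real ^ 'd::finite"
  assumes X [measurable]: "\<And>t. X t \<in> borel_measurable M" and Y [measurable]: "\<And>t. Y t \<in> borel_measurable M'"
    and iid: "iid_copies M X M' Y"
  shows "(\<integral>\<^sup>+w. ennreal ((X t w $ c - X s w $ c) ^ k) \<partial>M) = (\<integral>\<^sup>+w. ennreal ((Y t w - Y s w) ^ k) \<partial>M')"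
proof -
  let ?F = "\<lambda>p :: 't \<Rightarrow> real. ennreal ((p t - p s) ^ k)"
  have ev: "(\<lambda>p :: 't \<Rightarrow> real. p s) \<in> borel_measurable (Pi\<^sub>M UNIV (\<lambda>_. borel))" for s
    by (rule measurable_component_singleton) simp
  note [measurable] = ev
  have F: "?F \<in> borel_measurable (Pi\<^sub>M UNIV (\<lambda>_. borel))" by measurable
  have Xp: "(\<lambda>w t. X t w $ c) \<in> measurable M (Pi\<^sub>M UNIV (\<lambda>_. borel))"
    by (rule path_measurable) measurable
  have Yp: "(\<lambda>w t. Y t w) \<in> measurable M' (Pi\<^sub>M UNIV (\<lambda>_. borel))"
    by (rule path_measurable) measurable
  have "(\<integral>\<^sup>+w. ennreal ((X t w $ c - X s w $ c) ^ k) \<partial>M) = (\<integral>\<^sup>+p. ?F p \<partial>distr M (Pi\<^sub>M UNIV (\<lambda>_. borel)) (\<lambda>w t. X t w $ c))"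
    by (rule nn_integral_distr[symmetric, OF Xp]) (use F in simp)
  also have "distr M (Pi\<^sub>M UNIV (\<lambda>_. borel)) (\<lambda>w t. X t w $ c) = distr M' (Pi\<^sub>M UNIV (\<lambda>_. borel)) (\<lambda>w t. Y t w)"
    using iid by (simp add: iid_copies_def)
  also have "(\<integral>\<^sup>+p. ?F p \<partial>\<dots>) = (\<integral>\<^sup>+w. ennreal ((Y t w - Y s w) ^ k) \<partial>M')"
    by (rule nn_integral_distr[OF Yp]) (use F in simp)
  finally show ?thesis .
qed

theorem theorem3p2:
  fixes M :: "'w measure"
    and X :: "real ^ 'n::finite \<Rightarrow> 'w \<Rightarrow> real ^ 'd::finite"
    and M' :: "'v measure"
    and Y :: "real ^ 'n \<Rightarrow> 'v \<Rightarrow> real"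
    and T :: "(real ^ 'n) set"
    and \<tau> h H :: "real ^ 'n"
    and L :: "'w \<Rightarrow> real ^ 'd \<Rightarrow> (real ^ 'n) measure"
  assumes X_gaussian: "centered_gaussian_field M X"
    and X_continuous: "AE w in M. continuous_on UNIV (\<lambda>t. X t w)"
    and Y_gaussian: "centered_gaussian_field M' Y"
    and X_copies: "iid_copies M X M' Y"
    and h_pos: "\<And>j. 0 < h $ j"
    and T_interval: "T = cbox \<tau> (\<tau> + h) \<or> T = box \<tau> (\<tau> + h)"
    and cond_A: "condition_A M' Y T H"
    and d_less_Q: "real CARD('d) < Q_dim H"
    and L_version: "AE w in M. jointly_continuous_local_time (\<lambda>t. X t w) T \<tau> h (L w)"
  shows "\<exists>C C' :: real.
    (\<forall>t\<in>T. AE w in M.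
       Limsup (at_right 0) (\<lambda>r. max_local_time (L w) T (rho_ball H t r)
           / ennreal (phi_gauge (Q_dim H) (real CARD('d)) r)) \<le> ennreal C) \<and>
    (AE w in M.
       Limsup (at_right 0) (\<lambda>r. (SUP t\<in>T. max_local_time (L w) T (rho_ball H t r)
           / ennreal (Phi_gauge (Q_dim H) (real CARD('d)) r))) \<le> ennreal C')"
proof -
  have M: "prob_space M" using X_gaussian by (simp add: centered_gaussian_field_def)
  have Xm [measurable]: "X t \<in> borel_measurable M" for t using X_gaussian by (simp add: centered_gaussian_field_def)
  have Ym [measurable]: "Y t \<in> borel_measurable M'" for t using Y_gaussian by (simp add: centered_gaussian_field_def)
  obtain N where N: "N \<in> null_sets M" "{w \<in> space M. \<not> continuous_on UNIV (\<lambda>t. X t w)} \<subseteq> N"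
    using X_continuous by (auto simp: eventually_ae_filter)
  \<comment> \<open>Setting X to 0 on a null set makes all paths continuous; the laws, and almost
    surely the local times, are unaffected.\<close>
  define X' where "X' = (\<lambda>t w. if w \<in> N then 0 else X t w)"
  have [measurable]: "N \<in> sets M" using N(1) by auto
  have X'm [measurable]: "X' t \<in> borel_measurable M" for t
    unfolding X'_def by measurable
  have eqX: "AE w in M. \<forall>t. X' t w = X t w"
    using AE_not_in[OF N(1)] by eventually_elim (simp add: X'_def)
  obtain \<kappa> where nd: "nondeterminism M' Y T H \<kappa>" using condition_A_nondeterminism[OF Y_gaussian cond_A] by blast
  have "\<exists>C1 C2. 0 < C1 \<and> C1 \<le> C2 \<and> (\<forall>t\<in>T. \<forall>s\<in>T.
      C1 * (rho H t s)\<^sup>2 \<le> (LINT w|M'. (Y t w - Y s w)\<^sup>2) \<and> (LINT w|M'. (Y t w - Y s w)\<^sup>2) \<le> C2 * (rho H t s)\<^sup>2)"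
    using cond_A unfolding condition_A_def by (elim conjE)
  then obtain C1 C2 where C12: "0 < C1 \<and> C1 \<le> C2 \<and> (\<forall>t\<in>T. \<forall>s\<in>T.
      C1 * (rho H t s)\<^sup>2 \<le> (LINT w|M'. (Y t w - Y s w)\<^sup>2) \<and> (LINT w|M'. (Y t w - Y s w)\<^sup>2) \<le> C2 * (rho H t s)\<^sup>2)"
    by (elim exE)
  then have C: "0 < C1" "C1 \<le> C2" "\<And>t s. t \<in> T \<Longrightarrow> s \<in> T \<Longrightarrow> (\<integral>w. (Y t w - Y s w)\<^sup>2 \<partial>M') \<le> C2 * (rho H t s)\<^sup>2"
    by simp_all
  have H: "0 < H $ j" "H $ j < 1" for j using cond_A unfolding condition_A_def by auto
  interpret box_field M X' M' Y T H \<kappa> C2 \<tau> h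
  proof (intro box_field.intro smooth_field.intro box_field_axioms.intro)
    show "prob_space M" by (rule M)
    show "X' t \<in> borel_measurable M" for t by (rule X'm)
    show "continuous_on UNIV (\<lambda>t. X' t w)" if "w \<in> space M" for w
      using N(2) that unfolding X'_def by (cases "w \<in> N") auto
    show "(\<integral>w. (\<Prod>c\<in>UNIV. \<Prod>j<n. \<phi> j c (X' (t j) w $ c - X' a w $ c)) \<partial>M)
        = (\<Prod>c\<in>UNIV. \<integral>w. (\<Prod>j<n. \<phi> j c (Y (t j) w - Y a w)) \<partial>M')"
      if \<phi> [measurable]: "\<And>j c. \<phi> j c \<in> borel_measurable borel" and B: "\<And>j c z. \<bar>\<phi> j c z\<bar> \<le> B" for n :: nat and t a and \<phi> :: "nat \<Rightarrow> 'd \<Rightarrow> real \<Rightarrow> real" and B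
    proof -
      have m: "(\<lambda>w. \<phi> j c (X' s w $ c - X' a w $ c)) \<in> borel_measurable M"
          "(\<lambda>w. \<phi> j c (X s w $ c - X a w $ c)) \<in> borel_measurable M" for j c s
        by (rule measurable_compose[OF _ \<phi>], measurable)+
      have "(\<integral>w. (\<Prod>c\<in>UNIV. \<Prod>j<n. \<phi> j c (X' (t j) w $ c - X' a w $ c)) \<partial>M) = (\<integral>w. (\<Prod>c\<in>UNIV. \<Prod>j<n. \<phi> j c (X (t j) w $ c - X a w $ c)) \<partial>M)"
      proof (rule integral_cong_AE)
        show "AE w in M. (\<Prod>c\<in>UNIV. \<Prod>j<n. \<phi> j c (X' (t j) w $ c - X' a w $ c)) = (\<Prod>c\<in>UNIV. \<Prod>j<n. \<phi> j c (X (t j) w $ c - X a w $ c))"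
          using eqX by eventually_elim simp
      qed (intro borel_measurable_prod m)+
      also have "\<dots> = (\<Prod>c\<in>UNIV. \<integral>w. (\<Prod>j<n. \<phi> j c (Y (t j) w - Y a w)) \<partial>M')"
        by (rule iid_copies_factor[OF M Xm Ym X_copies \<phi> B])
      finally show ?thesis .
    qed
    show "(\<integral>\<^sup>+w. ennreal ((X' t w $ c - X' s w $ c) ^ (2 * k)) \<partial>M) = (\<integral>\<^sup>+w. ennreal ((Y t w - Y s w) ^ (2 * k)) \<partial>M')" for t s c k
    proof -
      have "(\<integral>\<^sup>+w. ennreal ((X' t w $ c - X' s w $ c) ^ (2 * k)) \<partial>M) = (\<integral>\<^sup>+w. ennreal ((X t w $ c - X s w $ c) ^ (2 * k)) \<partial>M)"
        by (rule nn_integral_cong_AE) (use eqX in eventually_elim, simp)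
      also have "\<dots> = (\<integral>\<^sup>+w. ennreal ((Y t w - Y s w) ^ (2 * k)) \<partial>M')"
        by (rule iid_copies_moment[OF Xm Ym X_copies])
      finally show ?thesis .
    qed
    show "0 \<le> C2" using C by simp
  qed (rule Y_gaussian nd H d_less_Q C(3) h_pos T_interval | assumption)+
  have L': "AE w in M. jointly_continuous_local_time (\<lambda>t. X' t w) T \<tau> h (L w)"
    using L_version eqX by eventually_elim simp
  obtain C where "\<And>t. t \<in> T \<Longrightarrow> AE w in M. Limsup (at_right 0) (\<lambda>r. max_local_time (L w) T (rho_ball H t r)
           / ennreal (phi_gauge (Q_dim H) (real CARD('d)) r)) \<le> ennreal C"
    by (rule law_iterated_log[OF L']) (rule that)
  moreover obtain C' where "AE w in M. Limsup (at_right 0) (\<lambda>r. SUP t\<in>T. max_local_time (L w) T (rho_ball H t r)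
           / ennreal (Phi_gauge (Q_dim H) (real CARD('d)) r)) \<le> ennreal C'"
    by (rule law_uniform[OF L']) (rule that)
  ultimately show ?thesis by blast
qed

end
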